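(* Let $a\ge 1$ be an integer, $d$ a real number such that $ad$ is a nonnegative integer, and $c>0$ a real number. Let $b,\lambda$ be indeterminates (unless specialized to real values below). Let $[\mathcal{T}_{n,k}]_{n,k\ge 0}$ be the array with $$\mathcal{T}_{n,k}=c\,\mathcal{T}_{n-1,k-1}+[ab(n-1)-bk+abd+c\lambda]\,\mathcal{T}_{n-1,k}-b\lambda(k+1)\,\mathcal{T}_{n-1,k+1}\qquad(n\ge 1,\ k\ge 0),$$ where $\mathcal{T}_{0,0}=1$ and $\mathcal{T}_{n,k}=0$ unless $0\le k\le n$. Let $\mathcal{T}_n(q)=\sum_{k\ge 0}\mathcal{T}_{n,k}q^k$. Then: (i) for $n,k\ge 1$, $$\mathcal{T}_{n,k}=\frac{a^n}{k!}\sum_{j\ge 0}\sum_{i=0}^{k+j}\frac{(-1)^{n-i}b^{n-k-j}c^{k+j}\lambda^j}{j!}\binom{k+j}{i}\Big(\frac{i-ad}{a}\Big)_n;$$ (ii) the lower-triangular matrix $[\mathcal{T}_{n,k}]_{n,k\ge 0}$ is $(b,\lambda)$-TP; (iii) if $0\le ad\le a-1$, then $(\mathcal{T}_n(q))_{n\ge 0}$ is $(b,\lambda,q)$-SM and $3$-$(b,\lambda,q)$-log-convex; in particular, $(\mathcal{T}_{n,0})_{n\ge 0}$ is $(b,\lambda)$-SM and $3$-$(b,\lambda)$-log-convex; (iv) for real $b>0$, the sequence $(f_n)_{n\ge 1}$ is SM, where $\sum_{n\ge 1}f_n\frac{t^n}{n!}=\frac{c}{b}\big[1-(1-abt)^{1/a}\big]$;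 (v) if $0\le ad\le a-1$ and $b,\lambda$ are nonnegative real numbers, then $z_n=\sum_{k\ge 0}\mathcal{T}_{n,k}x_ky_{n-k}$ preserves the Stieltjes moment property of sequences.
   Context: $(x)_n=x(x-1)\cdots(x-n+1)$ is the falling factorial; in (i) the inner sum over $i$ vanishes when $j>n-k$, so the outer sum is finite. For a set $\mathbf{x}$ of indeterminates, a matrix with entries in $\mathbb{R}[\mathbf{x}]$ is $\mathbf{x}$-TP if all its minors are polynomials with nonnegative coefficients in $\mathbf{x}$. A sequence $(\alpha_n)_{n\ge 0}$ in $\mathbb{R}[\mathbf{x}]$ is $\mathbf{x}$-SM if $[\alpha_{i+j}]_{i,j\ge 0}$ is $\mathbf{x}$-TP. Let $\mathcal{L}[\alpha_i]=\alpha_{i-1}\alpha_{i+1}-\alpha_i^2$ for $i\ge 1$ and $\mathcal{L}^m=\mathcal{L}(\mathcal{L}^{m-1})$ (so $\mathcal{L}^m[\alpha_i]$ is defined for $i\ge m$); the sequence is $3$-$\mathbf{x}$-log-convex if for $m=1,2,3$ all $\mathcal{L}^m[\alpha_i]$ have nonnegative coefficients. A real sequence $(a_k)_{k\ge 0}$ is SM (Stieltjes moment) if $a_k=\int_0^{+\infty}x^k\,d\mu(x)$ for a nonnegative measure $\mu$ on $[0,+\infty)$; $(f_n)_{n\ge 1}$ being SM means $(f_{n+1})_{n\ge 0}$ is SM. The convolution in (v) preserves the Stieltjes moment property if $(z_n)_{n\ge 0}$ is SM whenever the real sequences $(x_n)_{n\ge 0},(y_n)_{n\ge 0}$ both are.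 *)

theory Defs
  imports
    "HOL-Library.Poly_Mapping"
    "HOL-Computational_Algebra.Formal_Power_Series"
    "HOL-Analysis.Analysis"
    "Jordan_Normal_Form.Determinant"
begin

section \<open>Polynomials with nonnegative coefficients\<close>

text \<open>
  Real polynomials in indeterminates indexed by the natural numbers: a monomial is a finitely
  supported exponent function, a polynomial a finitely supported coefficient function on
  monomials.  The ring of polynomials in a set \<open>X\<close> of indeterminates is the subring \<open>polys_in X\<close>.
\<close>

type_synonym rpoly = "(nat \<Rightarrow>\<^sub>0 nat) \<Rightarrow>\<^sub>0 real"

definition Const :: "real \<Rightarrow> rpoly" where
  "Const r = Poly_Mapping.single 0 r"

definition Var :: "nat \<Rightarrow> rpoly" where
  "Var v = Poly_Mapping.single (Poly_Mapping.single v 1) 1"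

definition polys_in :: "nat set \<Rightarrow> rpoly set" where
  "polys_in X = {p. \<forall>m \<in> Poly_Mapping.keys p. Poly_Mapping.keys m \<subseteq> X}"

definition nonneg_coeffs :: "rpoly \<Rightarrow> bool" where
  "nonneg_coeffs p \<longleftrightarrow> (\<forall>m. Poly_Mapping.lookup p m \<ge> 0)"


section \<open>Total positivity, Stieltjes moment property and log-convexity for polynomials\<close>

definition minor :: "(nat \<Rightarrow> nat \<Rightarrow> 'a::comm_ring_1) \<Rightarrow> nat \<Rightarrow> (nat \<Rightarrow> nat) \<Rightarrow> (nat \<Rightarrow> nat) \<Rightarrow> 'a" where
  "minor M s r c = Determinant.det (Matrix.mat s s (\<lambda>(i, j). M (r i) (c j)))"

definition poly_TP :: "nat set \<Rightarrow> (nat \<Rightarrow> nat \<Rightarrow> rpoly) \<Rightarrow> bool" where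
  "poly_TP X M \<longleftrightarrow>
     (\<forall>i j. M i j \<in> polys_in X) \<and>
     (\<forall>s r c. strict_mono_on {..<s} r \<longrightarrow> strict_mono_on {..<s} c \<longrightarrow>
        nonneg_coeffs (minor M s r c))"

definition poly_SM :: "nat set \<Rightarrow> (nat \<Rightarrow> rpoly) \<Rightarrow> bool" where
  "poly_SM X \<alpha> \<longleftrightarrow> poly_TP X (\<lambda>i j. \<alpha> (i + j))"

text \<open>
  The operator is meaningful for \<open>i \<ge> 1\<close> only; its \<open>m\<close>-th iterate at \<open>i\<close> is independent of the
  junk value at \<open>0\<close> exactly in the range \<open>i \<ge> m\<close>, to which log-convexity refers.
\<close>

definition L_op :: "(nat \<Rightarrow> 'a::comm_ring_1) \<Rightarrow> nat \<Rightarrow> 'a" where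
  "L_op \<alpha> i = \<alpha> (i - 1) * \<alpha> (i + 1) - (\<alpha> i)\<^sup>2"

definition poly_log_convex :: "nat \<Rightarrow> nat set \<Rightarrow> (nat \<Rightarrow> rpoly) \<Rightarrow> bool" where
  "poly_log_convex r X \<alpha> \<longleftrightarrow>
     (\<forall>i. \<alpha> i \<in> polys_in X) \<and>
     (\<forall>m \<in> {1..r}. \<forall>i \<ge> m. nonneg_coeffs ((L_op ^^ m) \<alpha> i))"


section \<open>Stieltjes moment sequences of real numbers\<close>

definition stieltjes_moment :: "(nat \<Rightarrow> real) \<Rightarrow> bool" where
  "stieltjes_moment s \<longleftrightarrow>
     (\<exists>\<mu> :: real measure. sets \<mu> = sets (restrict_space borel {0..}) \<and>
        (\<forall>k. has_bochner_integral \<mu> (\<lambda>x. x ^ k) (s k)))"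

definition convolution_preserves_SM :: "(nat \<Rightarrow> nat \<Rightarrow> real) \<Rightarrow> bool" where
  "convolution_preserves_SM M \<longleftrightarrow>
     (\<forall>x y. stieltjes_moment x \<longrightarrow> stieltjes_moment y \<longrightarrow>
        stieltjes_moment (\<lambda>n. \<Sum>k\<le>n. M n k * x k * y (n - k)))"


section \<open>The array\<close>

definition falling_factorial :: "'a::comm_ring_1 \<Rightarrow> nat \<Rightarrow> 'a" where
  "falling_factorial x n = (\<Prod>i<n. x - of_nat i)"

text \<open>
  The parameters live in an arbitrary commutative ring, so that \<open>b\<close> and \<open>l\<close> (the paper's
  \<open>\<lambda>\<close>) may be indeterminates as well as real numbers.  The recurrence itself forces
  the entries with \<open>k > n\<close> to vanish.
\<close>

primrec T_arr :: "nat \<Rightarrow> 'a::comm_ring_1 \<Rightarrow> 'a \<Rightarrow> 'a \<Rightarrow> 'a \<Rightarrow> nat \<Rightarrow> nat \<Rightarrow> 'a" where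
  "T_arr a d c b l 0 k = (if k = 0 then 1 else 0)"
| "T_arr a d c b l (Suc n) k =
     c * (if k = 0 then 0 else T_arr a d c b l n (k - 1))
     + (of_nat a * b * of_nat n - b * of_nat k + of_nat a * b * d + c * l) * T_arr a d c b l n k
     - b * l * of_nat (k + 1) * T_arr a d c b l n (k + 1)"

lemma T_arr_eq_0: "k > n \<Longrightarrow> T_arr a d c b l n k = 0"
  by (induction n arbitrary: k) auto

definition T_row :: "nat \<Rightarrow> 'a::comm_ring_1 \<Rightarrow> 'a \<Rightarrow> 'a \<Rightarrow> 'a \<Rightarrow> 'a \<Rightarrow> nat \<Rightarrow> 'a" where
  "T_row a d c b l q n = (\<Sum>k\<le>n. T_arr a d c b l n k * q ^ k)"

end

theory Submission
  imports
    Defs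
    "HOL-Computational_Algebra.Fundamental_Theorem_Algebra"
begin

text \<open>
Put \<open>D = a d\<close> and \<open>\<beta> = b / c\<close>, and let \<open>w\<close> be multiplication by \<open>q + \<lambda>\<close> and
\<open>N = 1 - \<beta> d/dq\<close>, acting on polynomials in \<open>q\<close>.  The recurrence of the array says that the row
polynomials satisfy \<open>T\<^sub>n\<^sub>+\<^sub>1 = c w N T\<^sub>n + b (D + a n) T\<^sub>n\<close>.  Positivity is hidden here by the minus
sign in \<open>N\<close> and by the dependence on \<open>n\<close>.  Both disappear when one passes to the resolvent
\<open>E = N\<^sup>-\<^sup>1 = \<Sum>\<beta>\<^sup>j (d/dq)\<^sup>j\<close>.  For \<open>m + D = a - 1\<close> let \<open>X = E\<^sup>D w E\<^sup>m\<close>.  From \<open>N w = w N - \<beta>\<close> one gets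
\<open>N\<^sup>a X = w N - (m + 1) \<beta>\<close> and \<open>X N\<^sup>a = w N + D \<beta>\<close>, so \<open>N\<^sup>a X = X N\<^sup>a - a \<beta>\<close>, a Weyl relation.  Hence
the iterates \<open>R\<^sub>n = (c X)\<^sup>n 1\<close> satisfy \<open>X R\<^sub>n = X N\<^sup>a R\<^sub>n + a \<beta> n R\<^sub>n = w N R\<^sub>n + \<beta> (D + a n) R\<^sub>n\<close>, which is
the recurrence of the rows: \<open>T\<^sub>n = (c X)\<^sup>n 1\<close> (\<open>row_poly_production\<close>).

The matrices of \<open>c w\<close> (bidiagonal) and of \<open>E\<close> (single-pair, entries \<open>n!/k! \<beta>\<^sup>n\<^sup>-\<^sup>k\<close>) are totally
positive, hence so is that of \<open>c X\<close> by the Cauchy--Binet formula.  A totally positive production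
matrix yields a totally positive output array and a totally positive Hankel matrix of its first
column (\<open>TP_output_rows\<close>, \<open>TP_Hankel_output\<close>).  The rows depend on \<open>q + \<lambda>\<close> only, so \<open>T\<^sub>n(q)\<close> is the
first column entry for \<open>\<lambda> + q\<close> in place of \<open>\<lambda>\<close>; this gives the Stieltjes property.  The
condition \<open>D \<le> a - 1\<close> is what makes \<open>m \<ge> 0\<close>.  For arbitrary \<open>D\<close> the operator \<open>E\<^sup>D\<close> carries the rows for
\<open>d = 0\<close> to the rows for \<open>d\<close> (\<open>row_poly_shift_d\<close>), so the array is a product of totally positive
matrices.  Log-convexity is Dodgson condensation: the second and third iterates of the
log-convexity operator are sums of products of Hankel minors (\<open>L_op2\<close>, \<open>L_op3\<close>).  The explicit formula
for \<open>\<lambda> = 0\<close> is verified against the recurrence, and the translation \<open>q \<mapsto> q + \<lambda>\<close> gives the sum over \<open>j\<close>.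

The statements about real sequences need measures, which come from Stieltjes' theorem (\<open>Stieltjes_criterion\<close>): a
sequence whose Hankel matrix and shifted Hankel matrix are positive semidefinite has a representing
measure.  Its proof extends the moment functional from polynomials to the indicators of the rational
half-lines \<open>(q, \<infinity>)\<close>, one at a time and keeping positivity, and reads off the tail function of the
measure.  For real parameters the Hankel minors above are nonnegative, and nonnegative principal
minors force semidefiniteness.  For the coefficients of the
binomial series, \<open>f\<^sub>n\<^sub>+\<^sub>1 = c T\<^sub>n\<^sub>,\<^sub>0\<close> for \<open>D = a - 1\<close> and \<open>\<lambda> = 0\<close>.  For the convolution, the
homogeneity \<open>v\<^sup>n\<^sup>-\<^sup>k T\<^sub>n\<^sub>,\<^sub>k(b, \<lambda>) = T\<^sub>n\<^sub>,\<^sub>k(b v, \<lambda> v)\<close> shows that \<open>n \<mapsto> \<Sum>\<^sub>k T\<^sub>n\<^sub>,\<^sub>k u\<^sup>k v\<^sup>n\<^sup>-\<^sup>k\<close> has semidefinite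
Hankel matrices for all \<open>u, v \<ge> 0\<close>; integrating \<open>u\<close> and then \<open>v\<close> preserves this, so \<open>(z\<^sub>n)\<close> is a moment
sequence as well.
\<close>

hide_const (open) Module.smult


section \<open>Minors and the Cauchy--Binet formula\<close>

lemma minor_carrier [simp]: "Matrix.mat s s g \<in> carrier_mat s s"
  by simp

definition set_enum :: "nat set \<Rightarrow> nat \<Rightarrow> nat" where
  "set_enum S i = sorted_list_of_set S ! i"

lemma set_enum_strict_mono:
  assumes "finite S" "card S = s"
  shows "strict_mono_on {..<s} (set_enum S)"
  unfolding set_enum_def strict_mono_on_def
  using assms by (auto intro!: sorted_wrt_nth_less[OF strict_sorted_list_of_set])

lemma set_enum_bij:
  assumes "finite S" "card S = s"
  shows "bij_betw (set_enum S) {0..<s} S"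
proof -
  have "bij_betw ((!) (sorted_list_of_set S)) {..<s} (set (sorted_list_of_set S))"
    by (rule bij_betw_nth) (use assms in auto)
  thus ?thesis using assms by (simp add: set_enum_def[abs_def] atLeast0LessThan)
qed

text \<open>
Multilinearity in the rows: each row of the product is a linear combination of rows of \<open>B\<close>, and \<open>f\<close>
records which row is chosen.  The functions \<open>f\<close> are normalised to be the identity off \<open>{0..<s}\<close>.
\<close>

lemma minor_expand_rows:
  fixes A B :: "nat \<Rightarrow> nat \<Rightarrow> 'a::comm_ring_1"
  shows "minor (\<lambda>i j. \<Sum>k<K. A i k * B k j) s r c =
    (\<Sum>f | (\<forall>i\<in>{0..<s}. f i \<in> {0..<K}) \<and> (\<forall>i. i \<notin> {0..<s} \<longrightarrow> f i = i).
       (\<Prod>i<s. A (r i) (f i)) * Determinant.det (Matrix.mat s s (\<lambda>(i, j). B (f i) (c j))))"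
proof -
  define a where "a = (\<lambda>i k. A (r i) k \<cdot>\<^sub>v Matrix.vec s (\<lambda>j. B k (c j)))"
  have a: "a \<in> {0..<s} \<rightarrow> {0..<K} \<rightarrow> carrier_vec s" by (auto simp: a_def)
  have 1: "Matrix.mat s s (\<lambda>(i, j). \<Sum>k<K. A (r i) k * B k (c j)) =
     mat\<^sub>r s s (\<lambda>i. finsum_vec TYPE('a) s (a i) {0..<K})"
    by (rule eq_matI)
      (auto simp: a_def index_finsum_vec atLeast0LessThan intro!: sum.cong)
  show ?thesis
    unfolding minor_def 1 det_linear_rows_sum[OF finite_atLeastLessThan a]
  proof (rule sum.cong[OF refl])
    fix f assume "f \<in> {f. (\<forall>i\<in>{0..<s}. f i \<in> {0..<K}) \<and> (\<forall>i. i \<notin> {0..<s} \<longrightarrow> f i = i)}"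
    have "mat\<^sub>r s s (\<lambda>i. a i (f i)) = mat\<^sub>r s s (\<lambda>i. A (r i) (f i) \<cdot>\<^sub>v Matrix.vec s (\<lambda>j. B (f i) (c j)))"
      by (simp add: a_def)
    also have "Determinant.det \<dots> = prod (\<lambda>i. A (r i) (f i)) {0..<s} *
        Determinant.det (mat\<^sub>r s s (\<lambda>i. Matrix.vec s (\<lambda>j. B (f i) (c j))))"
      by (rule det_rows_mul) auto
    also have "mat\<^sub>r s s (\<lambda>i. Matrix.vec s (\<lambda>j. B (f i) (c j))) = Matrix.mat s s (\<lambda>(i, j). B (f i) (c j))"
      by (rule eq_matI) auto
    finally show "Determinant.det (mat\<^sub>r s s (\<lambda>i. a i (f i))) =
        (\<Prod>i<s. A (r i) (f i)) * Determinant.det (Matrix.mat s s (\<lambda>(i, j). B (f i) (c j)))"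
      by (simp add: atLeast0LessThan)
  qed
qed

text \<open>
The choice functions with a fixed image \<open>S\<close> are the increasing enumeration of \<open>S\<close> composed with a
permutation.  Sorting the rows of \<open>B\<close> produces the sign of the permutation, and the signed products
of entries of \<open>A\<close> add up to a minor of \<open>A\<close>.
\<close>

lemma Cauchy_Binet_block:
  fixes A B :: "nat \<Rightarrow> nat \<Rightarrow> 'a::comm_ring_1"
  assumes S: "S \<subseteq> {0..<K}" "card S = s"
  shows "(\<Sum>f | (\<forall>i\<in>{0..<s}. f i \<in> {0..<K}) \<and> (\<forall>i. i \<notin> {0..<s} \<longrightarrow> f i = i) \<and> f ` {0..<s} = S.
       (\<Prod>i<s. A (r i) (f i)) * Determinant.det (Matrix.mat s s (\<lambda>(i, j). B (f i) (c j)))) =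
    minor A s r (set_enum S) * minor B s (set_enum S) c"
proof -
  have fin: "finite S" using S finite_subset by blast
  define e where "e = set_enum S"
  have e: "bij_betw e {0..<s} S" unfolding e_def by (rule set_enum_bij[OF fin S(2)])
  define h where "h = (\<lambda>p i. if i < s then e (p i) else i :: nat)"
  define g where "g = (\<lambda>f i. if i < s then inv_into {0..<s} e (f i) else i)"
  let ?F = "{f. (\<forall>i\<in>{0..<s}. f i \<in> {0..<K}) \<and> (\<forall>i. i \<notin> {0..<s} \<longrightarrow> f i = i) \<and> f ` {0..<s} = S}"
  let ?P = "{p. p permutes {0..<s}}"
  have "(\<Sum>f\<in>?F. (\<Prod>i<s. A (r i) (f i)) * Determinant.det (Matrix.mat s s (\<lambda>(i, j). B (f i) (c j)))) =
     (\<Sum>p\<in>?P. signof p * (\<Prod>i<s. A (r i) (e (p i))) * minor B s e c)"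
  proof (rule sum.reindex_bij_witness[where i = h and j = g])
    fix f assume f: "f \<in> ?F"
    hence fS: "f ` {0..<s} = S" and out: "\<And>i. i \<notin> {0..<s} \<Longrightarrow> f i = i" by auto
    have injf: "inj_on f {0..<s}"
      by (rule eq_card_imp_inj_on) (use fS S in auto)
    have bf: "bij_betw f {0..<s} S" using injf fS by (simp add: bij_betw_def)
    have gb: "bij_betw (inv_into {0..<s} e \<circ> f) {0..<s} {0..<s}"
      by (rule bij_betw_trans[OF bf bij_betw_inv_into[OF e]])
    have "bij_betw (g f) {0..<s} {0..<s}"
      by (rule iffD1[OF bij_betw_cong gb]) (auto simp: g_def)
    hence gp: "g f permutes {0..<s}"
      by (rule bij_imp_permutes) (auto simp: g_def)
    thus "g f \<in> ?P" by simp
    have eg: "e (g f i) = f i" if "i < s" for i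
    proof -
      have "f i \<in> S" using fS that by auto
      thus ?thesis using e that by (auto simp: g_def bij_betw_def intro!: f_inv_into_f)
    qed
    show "h (g f) = f" using out by (auto simp: h_def fun_eq_iff eg)
    have 1: "Matrix.mat s s (\<lambda>(i, j). B (f i) (c j)) =
       Matrix.mat s s (\<lambda>(i, j). Matrix.mat s s (\<lambda>(i, j). B (e i) (c j)) $$ (g f i, j))"
      using permutes_in_image[OF gp] by (intro eq_matI) (auto simp: eg)
    have "Determinant.det (Matrix.mat s s (\<lambda>(i, j). B (f i) (c j))) = signof (g f) * minor B s e c"
      unfolding minor_def 1 by (rule det_permute_rows[OF _ gp]) simp
    thus "signof (g f) * (\<Prod>i<s. A (r i) (e (g f i))) * minor B s e c =
       (\<Prod>i<s. A (r i) (f i)) * Determinant.det (Matrix.mat s s (\<lambda>(i, j). B (f i) (c j)))"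
      by (simp add: eg mult_ac)
  next
    fix p assume "p \<in> ?P"
    hence p: "p permutes {0..<s}" by simp
    note pin = permutes_in_image[OF p]
    have eS: "e i \<in> S" if "i < s" for i using e that by (auto simp: bij_betw_def)
    have him: "h p ` {0..<s} = S"
    proof -
      have "h p ` {0..<s} = e ` (p ` {0..<s})" by (auto simp: h_def image_image)
      also have "\<dots> = S" using permutes_image[OF p] e by (simp add: bij_betw_def)
      finally show ?thesis .
    qed
    have "h p i < K" if "i < s" for i using eS[of "p i"] pin[of i] S that by (auto simp: h_def)
    moreover have "h p i = i" if "\<not> i < s" for i using that by (simp add: h_def)
    ultimately show "h p \<in> ?F" using him by simp
    show "g (h p) = p"
    proof
      fix i show "g (h p) i = p i"
      proof (cases "i < s")
        case True
        hence "p i < s" using pin[of i] by auto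
        thus ?thesis using True e by (auto simp: g_def h_def bij_betw_def)
      next
        case False
        thus ?thesis using permutes_not_in[OF p, of i] by (simp add: g_def h_def)
      qed
    qed
  qed
  also have "\<dots> = minor A s r e * minor B s e c"
    unfolding sum_distrib_right[symmetric]
  proof (rule arg_cong[where f = "\<lambda>x. x * _"])
    show "(\<Sum>p\<in>?P. signof p * (\<Prod>i<s. A (r i) (e (p i)))) = minor A s r e"
      unfolding minor_def
    proof (subst det_def'[OF minor_carrier], rule sum.cong[OF refl])
      fix p assume "p \<in> ?P"
      hence p: "p permutes {0..<s}" by simp
      have "(\<Prod>i<s. A (r i) (e (p i))) =
          (\<Prod>i = 0..<s. Matrix.mat s s (\<lambda>(i, j). A (r i) (e j)) $$ (i, p i))"
      proof (rule prod.cong)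
        fix i assume i: "i \<in> {0..<s}"
        hence "p i < s" using permutes_in_image[OF p, of i] by simp
        thus "A (r i) (e (p i)) = Matrix.mat s s (\<lambda>(i, j). A (r i) (e j)) $$ (i, p i)"
          using i by simp
      qed auto
      thus "signof p * (\<Prod>i<s. A (r i) (e (p i))) =
          signof p * (\<Prod>i = 0..<s. Matrix.mat s s (\<lambda>(i, j). A (r i) (e j)) $$ (i, p i))"
        by simp
    qed
  qed
  finally show ?thesis by (simp add: e_def)
qed

text \<open>
Choice functions that repeat a row contribute determinants with two equal rows; the others are
grouped by their image.
\<close>

theorem Cauchy_Binet:
  fixes A B :: "nat \<Rightarrow> nat \<Rightarrow> 'a::comm_ring_1"
  shows "minor (\<lambda>i j. \<Sum>k<K. A i k * B k j) s r c =
    (\<Sum>S | S \<subseteq> {0..<K} \<and> card S = s. minor A s r (set_enum S) * minor B s (set_enum S) c)"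
proof -
  let ?F = "{f. (\<forall>i\<in>{0..<s}. f i \<in> {0..<K}) \<and> (\<forall>i. i \<notin> {0..<s} \<longrightarrow> f i = i)}"
  let ?I = "{f \<in> ?F. inj_on f {0..<s}}"
  let ?\<S> = "{S. S \<subseteq> {0..<K} \<and> card S = s}"
  define t where "t = (\<lambda>f. (\<Prod>i<s. A (r i) (f i)) *
     Determinant.det (Matrix.mat s s (\<lambda>(i, j). B (f i) (c j))))"
  have finF: "finite ?F" by (rule finite_bounded_functions) auto
  have "minor (\<lambda>i j. \<Sum>k<K. A i k * B k j) s r c = sum t ?F"
    unfolding minor_expand_rows t_def ..
  also have "\<dots> = sum t ?I"
  proof (rule sum.mono_neutral_right[OF finF], blast, rule ballI)
    fix f assume "f \<in> ?F - ?I"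
    hence "\<not> inj_on f {0..<s}" by blast
    then obtain i j where ij: "i < s" "j < s" "i \<noteq> j" "f i = f j" by (auto simp: inj_on_def)
    have "Determinant.det (Matrix.mat s s (\<lambda>(i, j). B (f i) (c j))) = 0"
      by (rule det_identical_rows[of _ s i j]) (use ij in \<open>auto intro!: eq_vecI\<close>)
    thus "t f = 0" by (simp add: t_def)
  qed
  also have "\<dots> = (\<Sum>S\<in>?\<S>. sum t {f \<in> ?I. f ` {0..<s} = S})"
  proof (rule sum.group[symmetric])
    show "finite ?I" by (rule finite_subset[OF _ finF]) blast
    show "finite ?\<S>" by (rule finite_subset[of _ "Pow {0..<K}"]) auto
    show "(\<lambda>f. f ` {0..<s}) ` ?I \<subseteq> ?\<S>" by (auto simp: card_image)
  qed
  also have "\<dots> = (\<Sum>S\<in>?\<S>. minor A s r (set_enum S) * minor B s (set_enum S) c)"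
  proof (rule sum.cong[OF refl])
    fix S assume "S \<in> ?\<S>"
    hence S: "S \<subseteq> {0..<K}" "card S = s" by auto
    have "{f \<in> ?I. f ` {0..<s} = S} =
      {f. (\<forall>i\<in>{0..<s}. f i \<in> {0..<K}) \<and> (\<forall>i. i \<notin> {0..<s} \<longrightarrow> f i = i) \<and> f ` {0..<s} = S}"
      using S by (auto intro: eq_card_imp_inj_on)
    thus "sum t {f \<in> ?I. f ` {0..<s} = S} = minor A s r (set_enum S) * minor B s (set_enum S) c"
      using Cauchy_Binet_block[OF S, of A r B c] by (simp add: t_def)
  qed
  finally show ?thesis .
qed

lemma minor_cong:
  assumes "\<And>i j. i < s \<Longrightarrow> j < s \<Longrightarrow> M (r i) (c j) = M' (r' i) (c' j)"
  shows "minor M s r c = minor M' s r' c'"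
  unfolding minor_def by (rule arg_cong[where f = det], rule eq_matI) (use assms in auto)

lemma minor_transpose: "minor (\<lambda>i j. M j i) s r c = minor M s c r"
proof -
  have "Matrix.mat s s (\<lambda>(i, j). M (c j) (r i)) = transpose_mat (Matrix.mat s s (\<lambda>(i, j). M (c i) (r j)))"
    by (rule eq_matI) auto
  thus ?thesis unfolding minor_def by (simp add: det_transpose[of _ s])
qed

lemma minor_0 [simp]: "minor M 0 r c = 1"
  by (simp add: minor_def)

lemma minor_col_corner:
  assumes "\<And>i. 0 < i \<Longrightarrow> i < Suc s \<Longrightarrow> M (r i) (c 0) = 0"
  shows "minor M (Suc s) r c = M (r 0) (c 0) * minor M s (r \<circ> Suc) (c \<circ> Suc)"
proof -
  let ?A = "Matrix.mat (Suc s) (Suc s) (\<lambda>(i, j). M (r i) (c j))"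
  have "minor M (Suc s) r c = (\<Sum>i<Suc s. ?A $$ (i, 0) * cofactor ?A i 0)"
    unfolding minor_def by (rule laplace_expansion_column) auto
  also have "\<dots> = (\<Sum>i\<in>{0}. ?A $$ (i, 0) * cofactor ?A i 0)"
    by (rule sum.mono_neutral_right) (use assms in auto)
  also have "\<dots> = M (r 0) (c 0) * det (mat_delete ?A 0 0)" by (simp add: cofactor_def)
  also have "mat_delete ?A 0 0 = Matrix.mat s s (\<lambda>(i, j). M (r (Suc i)) (c (Suc j)))"
    by (rule eq_matI) (auto simp: mat_delete_def)
  finally show ?thesis by (simp add: minor_def)
qed

lemma minor_row_corner:
  assumes "\<And>j. 0 < j \<Longrightarrow> j < Suc s \<Longrightarrow> M (r 0) (c j) = 0"
  shows "minor M (Suc s) r c = M (r 0) (c 0) * minor M s (r \<circ> Suc) (c \<circ> Suc)"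
proof -
  have "minor (\<lambda>i j. M j i) (Suc s) c r = M (r 0) (c 0) * minor (\<lambda>i j. M j i) s (c \<circ> Suc) (r \<circ> Suc)"
    by (rule minor_col_corner) (rule assms)
  thus ?thesis by (simp only: minor_transpose[of M])
qed

lemma minor_proportional_cols:
  assumes "1 < s" "\<And>i. i < s \<Longrightarrow> M (r i) (c 0) = a * M (r i) (c 1)"
  shows "minor M s r c = 0"
proof -
  let ?B = "Matrix.mat s s (\<lambda>(i, j). if j = 0 then 0 else M (r i) (c j))"
  have "Matrix.mat s s (\<lambda>(i, j). M (r i) (c j)) = addcol a 0 1 ?B"
    by (rule eq_matI) (use assms in \<open>auto simp: mat_addcol_def\<close>)
  hence "minor M s r c = det ?B" unfolding minor_def using assms by (simp add: det_addcol)
  also have "\<dots> = (\<Sum>i<s. ?B $$ (i, 0) * cofactor ?B i 0)"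
    by (rule laplace_expansion_column) (use assms in auto)
  also have "\<dots> = 0" using assms by (intro sum.neutral) auto
  finally show ?thesis .
qed

lemma strict_mono_on_shift: "strict_mono_on {..<Suc s} r \<Longrightarrow> strict_mono_on {..<s} (r \<circ> Suc)"
  by (auto simp: strict_mono_on_def)


section \<open>Total positivity over a cone of nonnegative elements\<close>

text \<open>
Total positivity only uses that the nonnegative elements form a subsemiring.  Working over such a
cone treats real matrices and matrices of polynomials with nonnegative coefficients at once.
\<close>

locale nonneg_cone =
  fixes C :: "'a::comm_ring_1 set"
  assumes zero_in: "0 \<in> C" and one_in: "1 \<in> C"
    and add_in: "x \<in> C \<Longrightarrow> y \<in> C \<Longrightarrow> x + y \<in> C"
    and mult_in: "x \<in> C \<Longrightarrow> y \<in> C \<Longrightarrow> x * y \<in> C"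
begin

lemma sum_in: "(\<And>i. i \<in> I \<Longrightarrow> f i \<in> C) \<Longrightarrow> sum f I \<in> C"
  by (induction I rule: infinite_finite_induct) (auto simp: zero_in add_in)

lemma of_nat_in: "of_nat n \<in> C"
  by (induction n) (auto simp: zero_in one_in add_in)

lemma power_in: "x \<in> C \<Longrightarrow> x ^ n \<in> C"
  by (induction n) (auto simp: one_in mult_in)

definition TP :: "(nat \<Rightarrow> nat \<Rightarrow> 'a) \<Rightarrow> bool" where
  "TP M \<longleftrightarrow> (\<forall>s r c. strict_mono_on {..<s} r \<longrightarrow> strict_mono_on {..<s} c \<longrightarrow> minor M s r c \<in> C)"

lemma TP_D: "TP M \<Longrightarrow> strict_mono_on {..<s} r \<Longrightarrow> strict_mono_on {..<s} c \<Longrightarrow> minor M s r c \<in> C"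
  by (auto simp: TP_def)

lemma TP_entry: assumes "TP M" shows "M i j \<in> C"
proof -
  have "minor M 1 (\<lambda>_. i) (\<lambda>_. j) \<in> C" by (rule TP_D[OF assms]) (auto simp: strict_mono_on_def)
  moreover have "minor M 1 (\<lambda>_. i) (\<lambda>_. j) = M i j"
    unfolding minor_def by (subst det_single) auto
  ultimately show ?thesis by simp
qed

text \<open>
The minor of a product, in a form with separate row selections \<open>r'\<close> and \<open>r\<close> for the product and the
left factor: in the inductions below a row of \<open>M\<close> arises from an earlier row of \<open>M\<close> itself.
\<close>

lemma minor_product_in:
  assumes fin: "\<And>i. i < s \<Longrightarrow> finite {k. A (r i) k \<noteq> 0}"
    and M: "\<And>i j. i < s \<Longrightarrow> j < s \<Longrightarrow> M (r' i) (c j) = (\<Sum>k | A (r i) k \<noteq> 0. A (r i) k * B k (c j))"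
    and A: "\<And>k. strict_mono_on {..<s} k \<Longrightarrow> minor A s r k \<in> C"
    and B: "\<And>k. strict_mono_on {..<s} k \<Longrightarrow> minor B s k c \<in> C"
  shows "minor M s r' c \<in> C"
proof -
  have "finite (\<Union>i<s. {k. A (r i) k \<noteq> 0})" using fin by auto
  then obtain K where K: "\<And>i k. i < s \<Longrightarrow> A (r i) k \<noteq> 0 \<Longrightarrow> k < K"
    unfolding finite_nat_set_iff_bounded by blast
  have "minor M s r' c = minor (\<lambda>i j. \<Sum>k<K. A i k * B k j) s r c"
  proof (rule minor_cong)
    fix i j assume ij: "i < s" "j < s"
    show "M (r' i) (c j) = (\<Sum>k<K. A (r i) k * B k (c j))"
      unfolding M[OF ij] by (rule sum.mono_neutral_left) (use K ij in auto)
  qed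
  also have "\<dots> \<in> C"
    unfolding Cauchy_Binet
  proof (intro sum_in mult_in A B)
    fix S assume "S \<in> {S. S \<subseteq> {0..<K} \<and> card S = s}"
    hence "finite S" "card S = s" using finite_subset by auto
    thus "strict_mono_on {..<s} (set_enum S)" by (rule set_enum_strict_mono)
    thus "strict_mono_on {..<s} (set_enum S)" .
  qed
  finally show ?thesis .
qed

lemma TP_product:
  assumes "TP A" "TP B" "\<And>i. finite {k. A i k \<noteq> 0}"
    and "\<And>i j. M i j = (\<Sum>k | A i k \<noteq> 0. A i k * B k j)"
  shows "TP M"
  unfolding TP_def
proof (intro allI impI)
  fix s and r c :: "nat \<Rightarrow> nat"
  assume "strict_mono_on {..<s} r" "strict_mono_on {..<s} c"
  thus "minor M s r c \<in> C"
    by (intro minor_product_in[of s A r M r c B] assms(3,4) TP_D[OF assms(1)] TP_D[OF assms(2)])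
qed

text \<open>
In a minor of an upper bidiagonal matrix either the first column vanishes below its top entry or the
first row vanishes right of its first entry, so that the minor factors.
\<close>

lemma TP_bidiagonal:
  assumes x: "\<And>k. M k k \<in> C" and y: "\<And>k. M k (Suc k) \<in> C"
    and z: "\<And>i j. j \<noteq> i \<Longrightarrow> j \<noteq> Suc i \<Longrightarrow> M i j = 0"
  shows "TP M"
  unfolding TP_def
proof (intro allI impI)
  fix s and r c :: "nat \<Rightarrow> nat"
  assume "strict_mono_on {..<s} r" "strict_mono_on {..<s} c"
  thus "minor M s r c \<in> C"
  proof (induction s arbitrary: r c)
    case (Suc s)
    have IH: "minor M s (r \<circ> Suc) (c \<circ> Suc) \<in> C"
      using Suc by (auto intro: strict_mono_on_shift)
    have r: "r 0 < r i" and c: "c 0 < c i" if "0 < i" "i < Suc s" for i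
      using Suc.prems that by (auto simp: strict_mono_on_def)
    have M: "M i j \<in> C" for i j
      by (cases "j = i \<or> j = Suc i") (auto simp: x y z zero_in)
    have "minor M (Suc s) r c = M (r 0) (c 0) * minor M s (r \<circ> Suc) (c \<circ> Suc)"
    proof (cases "c 0 \<le> r 0")
      case True
      show ?thesis
      proof (rule minor_col_corner)
        fix i assume "0 < i" "i < Suc s"
        thus "M (r i) (c 0) = 0" using r[of i] True by (intro z) auto
      qed
    next
      case False
      show ?thesis
      proof (rule minor_row_corner)
        fix i assume "0 < i" "i < Suc s"
        thus "M (r 0) (c i) = 0" using c[of i] False by (intro z) auto
      qed
    qed
    thus ?case using IH M by (simp add: mult_in)
  qed (simp add: one_in)
qed

text \<open>
Below the diagonal such a matrix has rank one.  If the second selected column still meets the first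
selected row there, the first two selected columns are proportional; otherwise the first row has only
its corner entry.
\<close>

lemma TP_single_pair:
  assumes M: "\<And>i j. M i j \<in> C" and z: "\<And>i j. i < j \<Longrightarrow> M i j = 0"
    and sp: "\<And>i j k. k \<le> j \<Longrightarrow> j \<le> i \<Longrightarrow> M i k = M j k * M i j"
  shows "TP M"
  unfolding TP_def
proof (intro allI impI)
  fix s and r c :: "nat \<Rightarrow> nat"
  assume "strict_mono_on {..<s} r" "strict_mono_on {..<s} c"
  thus "minor M s r c \<in> C"
  proof (induction s arbitrary: r c)
    case (Suc s)
    have IH: "minor M s (r \<circ> Suc) (c \<circ> Suc) \<in> C"
      using Suc by (auto intro: strict_mono_on_shift)
    have r: "r 0 \<le> r i" if "i < Suc s" for i
      using Suc.prems that by (cases "i = 0") (auto simp: strict_mono_on_def less_imp_le)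
    have c: "c 1 \<le> c i" if "0 < i" "i < Suc s" for i
      using Suc.prems that by (cases "i = 1") (auto simp: strict_mono_on_def less_imp_le)
    show ?case
    proof (cases "s \<noteq> 0 \<and> c 1 \<le> r 0")
      case True
      hence "c 0 < c 1" using Suc.prems by (auto simp: strict_mono_on_def)
      have "minor M (Suc s) r c = 0"
      proof (rule minor_proportional_cols[where a = "M (c 1) (c 0)"])
        fix i assume "i < Suc s"
        show "M (r i) (c 0) = M (c 1) (c 0) * M (r i) (c 1)"
          using True r[OF \<open>i < Suc s\<close>] \<open>c 0 < c 1\<close> by (intro sp) auto
      qed (use True in auto)
      thus ?thesis by (simp add: zero_in)
    next
      case False
      have "minor M (Suc s) r c = M (r 0) (c 0) * minor M s (r \<circ> Suc) (c \<circ> Suc)"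
      proof (rule minor_row_corner)
        fix i assume "0 < i" "i < Suc s"
        thus "M (r 0) (c i) = 0" using c[of i] False by (intro z) auto
      qed
      thus ?thesis using IH M by (simp add: mult_in)
    qed
  qed (simp add: one_in)
qed

end


section \<open>Production operators and Hankel matrices\<close>

definition lin_op :: "('a::comm_ring_1 poly \<Rightarrow> 'a poly) \<Rightarrow> bool" where
  "lin_op X \<longleftrightarrow> (\<forall>p q. X (p + q) = X p + X q) \<and> (\<forall>r p. X (smult r p) = smult r (X p))"

lemma lin_opI: "(\<And>p q. X (p + q) = X p + X q) \<Longrightarrow> (\<And>r p. X (smult r p) = smult r (X p)) \<Longrightarrow> lin_op X"
  by (simp add: lin_op_def)

lemma lin_op_add: "lin_op X \<Longrightarrow> X (p + q) = X p + X q"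
  and lin_op_smult: "lin_op X \<Longrightarrow> X (smult r p) = smult r (X p)"
  by (simp_all add: lin_op_def)

lemma lin_op_0: "lin_op X \<Longrightarrow> X 0 = 0"
  using lin_op_smult[of X 0 0] by simp

lemma lin_op_diff: "lin_op X \<Longrightarrow> X (p - q) = X p - X q"
  using lin_op_add[of X "p - q" q] by simp

lemma lin_op_sum: "lin_op X \<Longrightarrow> X (sum f I) = (\<Sum>i\<in>I. X (f i))"
  by (induction I rule: infinite_finite_induct) (auto simp: lin_op_0 lin_op_add)

lemma lin_op_funpow: "lin_op X \<Longrightarrow> lin_op (X ^^ n)"
  by (induction n) (auto simp: lin_op_def)

lemma lin_op_mult: "lin_op (\<lambda>p. q * p)"
  by (rule lin_opI) (auto simp: algebra_simps)

lemma lin_op_comp: "lin_op X \<Longrightarrow> lin_op Y \<Longrightarrow> lin_op (\<lambda>p. Y (X p))"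
  by (simp add: lin_op_def)

lemma lin_op_expand:
  assumes "lin_op X"
  shows "X p = (\<Sum>k\<le>degree p. smult (coeff p k) (X (monom 1 k)))"
proof -
  have "X p = X (\<Sum>k\<le>degree p. smult (coeff p k) (monom 1 k))"
    by (simp add: smult_monom poly_as_sum_of_monoms)
  also have "\<dots> = (\<Sum>k\<le>degree p. smult (coeff p k) (X (monom 1 k)))"
    using assms by (simp add: lin_op_sum lin_op_smult)
  finally show ?thesis .
qed

lemma lin_op_eqI:
  assumes "lin_op X" "lin_op Y" "\<And>k. X (monom 1 k) = Y (monom 1 k)"
  shows "X p = Y p"
  using lin_op_expand[OF assms(1), of p] lin_op_expand[OF assms(2), of p] assms(3) by simp

text \<open>
Row \<open>k\<close> holds the coefficients of the image of the \<open>k\<close>-th power, so that composing operators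
multiplies their matrices in the opposite order.
\<close>

definition op_matrix :: "('a::comm_ring_1 poly \<Rightarrow> 'a poly) \<Rightarrow> nat \<Rightarrow> nat \<Rightarrow> 'a" where
  "op_matrix X k j = coeff (X (monom 1 k)) j"

lemma finite_coeff_support: "finite {k. coeff p k \<noteq> 0}"
  by (rule finite_subset[of _ "{..degree p}"]) (auto intro: le_degree)

lemma coeff_lin_op:
  assumes "lin_op X"
  shows "coeff (X p) j = (\<Sum>k | coeff p k \<noteq> 0. coeff p k * op_matrix X k j)"
proof -
  have "coeff (X p) j = (\<Sum>k\<le>degree p. coeff p k * op_matrix X k j)"
    by (subst lin_op_expand[OF assms]) (simp add: coeff_sum op_matrix_def)
  also have "\<dots> = (\<Sum>k | coeff p k \<noteq> 0. coeff p k * op_matrix X k j)"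
    by (rule sum.mono_neutral_right) (auto intro: le_degree)
  finally show ?thesis .
qed

context nonneg_cone
begin

lemma TP_op_comp:
  assumes "lin_op Y" "TP (op_matrix X)" "TP (op_matrix Y)"
  shows "TP (op_matrix (\<lambda>p. Y (X p)))"
proof (rule TP_product[OF assms(2,3)])
  show "finite {k. op_matrix X i k \<noteq> 0}" for i
    unfolding op_matrix_def by (rule finite_coeff_support)
  show "op_matrix (\<lambda>p. Y (X p)) i j = (\<Sum>k | op_matrix X i k \<noteq> 0. op_matrix X i k * op_matrix Y k j)" for i j
    using coeff_lin_op[OF assms(1), of "X (monom 1 i)" j] by (simp add: op_matrix_def)
qed

lemma TP_op_id: "TP (op_matrix (\<lambda>p. p))"
  by (rule TP_bidiagonal) (auto simp: op_matrix_def zero_in one_in)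

lemma TP_op_funpow:
  assumes "lin_op X" "TP (op_matrix X)"
  shows "TP (op_matrix (X ^^ n))"
proof (induction n)
  case 0
  show ?case using TP_op_id by (simp add: id_def)
next
  case (Suc n)
  show ?case using TP_op_comp[OF assms(1) Suc assms(2)] by (simp add: comp_def)
qed

lemma TP_op_mult_linear:
  assumes "x \<in> C" "y \<in> C"
  shows "TP (op_matrix (\<lambda>p. [:x, y:] * p))"
  by (rule TP_bidiagonal)
    (use assms in \<open>auto simp: op_matrix_def coeff_pCons zero_in split: nat.splits\<close>)

text \<open>
Row \<open>n\<close> of the output is row \<open>n - 1\<close> times the production matrix, and row \<open>0\<close> is the first unit vector.
A minor that uses row \<open>0\<close> reduces by its corner; otherwise all rows are shifted down by one with the
Cauchy--Binet formula.  The size plus the sum of the row indices decreases in both cases.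
\<close>

lemma TP_output_rows:
  assumes X: "lin_op X" and P: "TP (op_matrix X)"
  shows "TP (\<lambda>n k. coeff ((X ^^ n) 1) k)"
proof -
  define M where "M = (\<lambda>n k. coeff ((X ^^ n) 1) k)"
  have "minor M s r c \<in> C" if "strict_mono_on {..<s} r" "strict_mono_on {..<s} c" for s r c
    using that
  proof (induction "s + (\<Sum>i<s. r i)" arbitrary: s r c rule: less_induct)
    case less
    show ?case
    proof (cases s)
      case 0
      thus ?thesis by (simp add: one_in)
    next
      case (Suc s')
      have mono: "r 0 < r i" "c 0 < c i" if "0 < i" "i < s" for i
        using less.prems that by (auto simp: strict_mono_on_def)
      show ?thesis
      proof (cases "r 0 = 0")
        case True
        have "minor M (Suc s') r c = M (r 0) (c 0) * minor M s' (r \<circ> Suc) (c \<circ> Suc)"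
        proof (rule minor_row_corner)
          fix j assume "0 < j" "j < Suc s'"
          thus "M (r 0) (c j) = 0" using mono(2)[of j] True Suc by (auto simp: M_def)
        qed
        moreover have "M (r 0) (c 0) \<in> C"
          using True by (auto simp: M_def one_in zero_in)
        moreover have "minor M s' (r \<circ> Suc) (c \<circ> Suc) \<in> C"
        proof (rule less.hyps)
          show "s' + (\<Sum>i<s'. (r \<circ> Suc) i) < s + (\<Sum>i<s. r i)"
            unfolding Suc sum.lessThan_Suc_shift by simp
        qed (use less.prems Suc in \<open>auto intro: strict_mono_on_shift\<close>)
        ultimately show ?thesis using Suc by (simp add: mult_in)
      next
        case False
        have pos: "0 < r i" if "i < s" for i
          using mono(1)[of i] False that by (cases "i = 0") auto
        have shifted: "strict_mono_on {..<s} (\<lambda>i. r i - 1)"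
          using less.prems pos unfolding strict_mono_on_def by (auto intro!: diff_less_mono simp: Suc_le_eq)
        show ?thesis
        proof (rule minor_product_in[of s M "\<lambda>i. r i - 1" M r c "op_matrix X"])
          show "finite {k. M (r i - 1) k \<noteq> 0}" for i
            unfolding M_def by (rule finite_coeff_support)
          show "M (r i) (c j) = (\<Sum>k | M (r i - 1) k \<noteq> 0. M (r i - 1) k * op_matrix X k (c j))"
            if "i < s" "j < s" for i j
          proof -
            have "(X ^^ r i) 1 = X ((X ^^ (r i - 1)) 1)"
              using pos[OF that(1)] by (cases "r i") auto
            thus ?thesis using coeff_lin_op[OF X, of "(X ^^ (r i - 1)) 1"] by (simp add: M_def)
          qed
          show "minor M s (\<lambda>i. r i - 1) k \<in> C" if "strict_mono_on {..<s} k" for k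
          proof (rule less.hyps[OF _ shifted that])
            have "(\<Sum>i<s. r i - 1) < (\<Sum>i<s. r i)"
              using pos Suc by (intro sum_strict_mono) auto
            thus "s + (\<Sum>i<s. r i - 1) < s + (\<Sum>i<s. r i)" by simp
          qed
          show "minor (op_matrix X) s k c \<in> C" if "strict_mono_on {..<s} k" for k
            by (rule TP_D[OF P that less.prems(2)])
        qed
      qed
    qed
  qed
  thus ?thesis unfolding TP_def M_def by blast
qed

text \<open>
The dual of the previous lemma: column \<open>n\<close> is the production matrix times column \<open>n - 1\<close>, and column \<open>0\<close>
is the first unit vector.
\<close>

lemma TP_output_columns:
  assumes X: "lin_op X" and P: "TP (op_matrix X)"
  shows "TP (\<lambda>k n. coeff ((X ^^ n) (monom 1 k)) 0)"
proof -
  define M where "M = (\<lambda>k n. coeff ((X ^^ n) (monom 1 k)) 0)"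
  have "minor M s r c \<in> C" if "strict_mono_on {..<s} r" "strict_mono_on {..<s} c" for s r c
    using that
  proof (induction "s + (\<Sum>i<s. c i)" arbitrary: s r c rule: less_induct)
    case less
    show ?case
    proof (cases s)
      case 0
      thus ?thesis by (simp add: one_in)
    next
      case (Suc s')
      have mono: "r 0 < r i" "c 0 < c i" if "0 < i" "i < s" for i
        using less.prems that by (auto simp: strict_mono_on_def)
      show ?thesis
      proof (cases "c 0 = 0")
        case True
        have "minor M (Suc s') r c = M (r 0) (c 0) * minor M s' (r \<circ> Suc) (c \<circ> Suc)"
        proof (rule minor_col_corner)
          fix j assume "0 < j" "j < Suc s'"
          thus "M (r j) (c 0) = 0" using mono(1)[of j] True Suc by (auto simp: M_def)
        qed
        moreover have "M (r 0) (c 0) \<in> C"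
          using True by (auto simp: M_def one_in zero_in)
        moreover have "minor M s' (r \<circ> Suc) (c \<circ> Suc) \<in> C"
        proof (rule less.hyps)
          show "s' + (\<Sum>i<s'. (c \<circ> Suc) i) < s + (\<Sum>i<s. c i)"
            unfolding Suc sum.lessThan_Suc_shift by simp
        qed (use less.prems Suc in \<open>auto intro: strict_mono_on_shift\<close>)
        ultimately show ?thesis using Suc by (simp add: mult_in)
      next
        case False
        have pos: "0 < c i" if "i < s" for i
          using mono(2)[of i] False that by (cases "i = 0") auto
        have shifted: "strict_mono_on {..<s} (\<lambda>i. c i - 1)"
          using less.prems pos unfolding strict_mono_on_def by (auto intro!: diff_less_mono simp: Suc_le_eq)
        show ?thesis
        proof (rule minor_product_in[of s "op_matrix X" r M r c "\<lambda>k n. M k (n - 1)"])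
          show "finite {k. op_matrix X (r i) k \<noteq> 0}" for i
            unfolding op_matrix_def by (rule finite_coeff_support)
          show "M (r i) (c j) = (\<Sum>k | op_matrix X (r i) k \<noteq> 0. op_matrix X (r i) k * M k (c j - 1))"
            if "i < s" "j < s" for i j
          proof -
            have "(X ^^ c j) (monom 1 (r i)) = (X ^^ (c j - 1)) (X (monom 1 (r i)))"
              using pos[OF that(2)] by (cases "c j") (auto simp: funpow_swap1)
            thus ?thesis
              using coeff_lin_op[OF lin_op_funpow[OF X], of "c j - 1" "X (monom 1 (r i))" 0]
              by (simp add: M_def op_matrix_def)
          qed
          show "minor (\<lambda>k n. M k (n - 1)) s k c \<in> C" if "strict_mono_on {..<s} k" for k
          proof -
            have "minor (\<lambda>k n. M k (n - 1)) s k c = minor M s k (\<lambda>i. c i - 1)"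
              by (rule minor_cong) simp
            also have "\<dots> \<in> C"
            proof (rule less.hyps[OF _ that shifted])
              have "(\<Sum>i<s. c i - 1) < (\<Sum>i<s. c i)"
                using pos Suc by (intro sum_strict_mono) auto
              thus "s + (\<Sum>i<s. c i - 1) < s + (\<Sum>i<s. c i)" by simp
            qed
            finally show ?thesis .
          qed
          show "minor (op_matrix X) s r k \<in> C" if "strict_mono_on {..<s} k" for k
            by (rule TP_D[OF P less.prems(1) that])
        qed
      qed
    qed
  qed
  thus ?thesis unfolding TP_def M_def by blast
qed

text \<open>
Splitting \<open>X\<^sup>i\<^sup>+\<^sup>j\<close> as \<open>X\<^sup>j X\<^sup>i\<close> factors the Hankel matrix into the output rows and the output columns.
\<close>

theorem TP_Hankel_output:
  assumes X: "lin_op X" and P: "TP (op_matrix X)"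
  shows "TP (\<lambda>i j. coeff ((X ^^ (i + j)) 1) 0)"
proof (rule TP_product[OF TP_output_rows[OF X P] TP_output_columns[OF X P]])
  show "finite {k. coeff ((X ^^ i) 1) k \<noteq> 0}" for i by (rule finite_coeff_support)
  show "coeff ((X ^^ (i + j)) 1) 0 =
     (\<Sum>k | coeff ((X ^^ i) 1) k \<noteq> 0. coeff ((X ^^ i) 1) k * coeff ((X ^^ j) (monom 1 k)) 0)" for i j
    using coeff_lin_op[OF lin_op_funpow[OF X], of j "(X ^^ i) 1" 0]
    by (simp add: op_matrix_def add.commute[of i] funpow_add)
qed

end


section \<open>Condensation of Hankel determinants and log-convexity\<close>

lemma minor_Suc_expand:
  "minor M (Suc s) r c = (\<Sum>j<Suc s. (-1) ^ j * M (r 0) (c j) *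
     minor M s (r \<circ> Suc) (\<lambda>i. c (if i < j then i else Suc i)))"
proof -
  let ?A = "Matrix.mat (Suc s) (Suc s) (\<lambda>(i, j). M (r i) (c j))"
  have "minor M (Suc s) r c = (\<Sum>j<Suc s. ?A $$ (0, j) * cofactor ?A 0 j)"
    unfolding minor_def by (rule laplace_expansion_row) auto
  also have "\<dots> = (\<Sum>j<Suc s. (-1) ^ j * M (r 0) (c j) *
     minor M s (r \<circ> Suc) (\<lambda>i. c (if i < j then i else Suc i)))"
  proof (rule sum.cong[OF refl])
    fix j assume j: "j \<in> {..<Suc s}"
    have "mat_delete ?A 0 j = Matrix.mat s s (\<lambda>(i, j'). M (r (Suc i)) (c (if j' < j then j' else Suc j')))"
      by (rule eq_matI) (use j in \<open>auto simp: mat_delete_def\<close>)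
    thus "?A $$ (0, j) * cofactor ?A 0 j = (-1) ^ j * M (r 0) (c j) *
       minor M s (r \<circ> Suc) (\<lambda>i. c (if i < j then i else Suc i))"
      using j by (simp add: cofactor_def minor_def mult_ac)
  qed
  finally show ?thesis .
qed

lemma minor_1: "minor M (Suc 0) r c = M (r 0) (c 0)"
  using minor_Suc_expand[of M 0 r c] by simp

lemma minor_2: "minor M (Suc (Suc 0)) r c = M (r 0) (c 0) * M (r 1) (c 1) - M (r 0) (c 1) * M (r 1) (c 0)"
  by (subst minor_Suc_expand) (simp add: minor_1)

definition hankel_det2 :: "(nat \<Rightarrow> 'a::comm_ring_1) \<Rightarrow> nat \<Rightarrow> 'a" where
  "hankel_det2 \<alpha> i = \<alpha> i * \<alpha> (i + 2) - (\<alpha> (i + 1))\<^sup>2"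

definition hankel_det3 :: "(nat \<Rightarrow> 'a::comm_ring_1) \<Rightarrow> nat \<Rightarrow> 'a" where
  "hankel_det3 \<alpha> i = minor (\<lambda>i j. \<alpha> (i + j)) (Suc (Suc (Suc 0))) (\<lambda>k. i + k) (\<lambda>k. k)"

definition hankel_det4 :: "(nat \<Rightarrow> 'a::comm_ring_1) \<Rightarrow> nat \<Rightarrow> 'a" where
  "hankel_det4 \<alpha> i = minor (\<lambda>i j. \<alpha> (i + j)) (Suc (Suc (Suc (Suc 0)))) (\<lambda>k. i + k) (\<lambda>k. k)"

lemma hankel_det3_eq:
  "hankel_det3 \<alpha> i =
      \<alpha> i * (\<alpha> (i + 2) * \<alpha> (i + 4) - (\<alpha> (i + 3))\<^sup>2)
    - \<alpha> (i + 1) * (\<alpha> (i + 1) * \<alpha> (i + 4) - \<alpha> (i + 2) * \<alpha> (i + 3))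
    + \<alpha> (i + 2) * (\<alpha> (i + 1) * \<alpha> (i + 3) - (\<alpha> (i + 2))\<^sup>2)"
  unfolding hankel_det3_def
  by (subst minor_Suc_expand) (simp add: minor_2 eval_nat_numeral algebra_simps)

lemma hankel_det4_eq:
  "hankel_det4 \<alpha> i =
      \<alpha> i * hankel_det3 \<alpha> (i + 2)
    - \<alpha> (i + 1) * (\<alpha> (i + 1) * (\<alpha> (i + 4) * \<alpha> (i + 6) - (\<alpha> (i + 5))\<^sup>2)
        - \<alpha> (i + 2) * (\<alpha> (i + 3) * \<alpha> (i + 6) - \<alpha> (i + 4) * \<alpha> (i + 5))
        + \<alpha> (i + 3) * (\<alpha> (i + 3) * \<alpha> (i + 5) - (\<alpha> (i + 4))\<^sup>2))
    + \<alpha> (i + 2) * (\<alpha> (i + 1) * (\<alpha> (i + 3) * \<alpha> (i + 6) - \<alpha> (i + 4) * \<alpha> (i + 5))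
        - \<alpha> (i + 2) * (\<alpha> (i + 2) * \<alpha> (i + 6) - (\<alpha> (i + 4))\<^sup>2)
        + \<alpha> (i + 3) * (\<alpha> (i + 2) * \<alpha> (i + 5) - \<alpha> (i + 3) * \<alpha> (i + 4)))
    - \<alpha> (i + 3) * (\<alpha> (i + 1) * (\<alpha> (i + 3) * \<alpha> (i + 5) - (\<alpha> (i + 4))\<^sup>2)
        - \<alpha> (i + 2) * (\<alpha> (i + 2) * \<alpha> (i + 5) - \<alpha> (i + 3) * \<alpha> (i + 4))
        + \<alpha> (i + 3) * (\<alpha> (i + 2) * \<alpha> (i + 4) - (\<alpha> (i + 3))\<^sup>2))"
  unfolding hankel_det4_def hankel_det3_eq
  by (subst minor_Suc_expand, subst minor_Suc_expand)
    (simp add: minor_2 minor_Suc_expand[of _ "Suc (Suc 0)"] eval_nat_numeral algebra_simps)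

text \<open>
Dodgson condensation of the Hankel matrix of size 3, and in the next lemma of size 4.  The two
off-diagonal minors coincide because the matrix is symmetric.
\<close>

lemma hankel_condensation3:
  "hankel_det2 \<alpha> i * hankel_det2 \<alpha> (i + 2) - (hankel_det2 \<alpha> (i + 1))\<^sup>2 = \<alpha> (i + 2) * hankel_det3 \<alpha> i"
  unfolding hankel_det2_def hankel_det3_eq
  by (simp add: add.assoc) (simp add: eval_nat_numeral algebra_simps)

lemma hankel_condensation4:
  "hankel_det3 \<alpha> i * hankel_det3 \<alpha> (i + 2) - (hankel_det3 \<alpha> (i + 1))\<^sup>2 = hankel_det2 \<alpha> (i + 2) * hankel_det4 \<alpha> i"
proof -
  define x0 x1 x2 x3 x4 x5 x6 where "x0 = \<alpha> i" and "x1 = \<alpha> (i + 1)" and "x2 = \<alpha> (i + 2)"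
    and "x3 = \<alpha> (i + 3)" and "x4 = \<alpha> (i + 4)" and "x5 = \<alpha> (i + 5)" and "x6 = \<alpha> (i + 6)"
  note x = this
  have s: "i + 1 + 1 = i + 2" "i + 1 + 2 = i + 3" "i + 1 + 3 = i + 4" "i + 1 + 4 = i + 5"
     "i + 2 + 1 = i + 3" "i + 2 + 2 = i + 4" "i + 2 + 3 = i + 5" "i + 2 + 4 = i + 6" by simp_all
  show ?thesis
    unfolding hankel_det2_def hankel_det4_eq hankel_det3_eq s x[symmetric]
    by (simp add: power2_eq_square algebra_simps)
qed

lemma L_op_Suc: "L_op \<alpha> (Suc i) = hankel_det2 \<alpha> i"
  by (simp add: L_op_def hankel_det2_def)

lemma L_op2: "(L_op ^^ 2) \<alpha> (i + 2) = \<alpha> (i + 2) * hankel_det3 \<alpha> i"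
proof -
  have "(L_op ^^ 2) \<alpha> (i + 2) = L_op \<alpha> (Suc i) * L_op \<alpha> (Suc (i + 2)) - (L_op \<alpha> (Suc (i + 1)))\<^sup>2"
    by (simp add: numeral_2_eq_2 L_op_def[of "L_op \<alpha>"])
  thus ?thesis by (simp only: L_op_Suc hankel_condensation3)
qed

text \<open>
With \<open>h\<^sub>s\<close> for the Hankel determinant of size \<open>s\<close>, the third iterate is
\<open>\<alpha>\<^sub>i\<^sub>+\<^sub>2 \<alpha>\<^sub>i\<^sub>+\<^sub>4 h\<^sub>3(i) h\<^sub>3(i+2) - \<alpha>\<^sub>i\<^sub>+\<^sub>3\<^sup>2 h\<^sub>3(i+1)\<^sup>2\<close>; adding and subtracting \<open>\<alpha>\<^sub>i\<^sub>+\<^sub>3\<^sup>2 h\<^sub>3(i) h\<^sub>3(i+2)\<close> splits off the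
factor \<open>h\<^sub>2(i+2)\<close> and leaves a difference that condenses.
\<close>

lemma L_op3: "(L_op ^^ 3) \<alpha> (i + 3) =
   hankel_det2 \<alpha> (i + 2) * hankel_det3 \<alpha> i * hankel_det3 \<alpha> (i + 2)
   + (\<alpha> (i + 3))\<^sup>2 * hankel_det2 \<alpha> (i + 2) * hankel_det4 \<alpha> i"
proof -
  have "(L_op ^^ 3) \<alpha> (i + 3) = (L_op ^^ 2) \<alpha> (i + 2) * (L_op ^^ 2) \<alpha> (i + 2 + 2) - ((L_op ^^ 2) \<alpha> (i + 1 + 2))\<^sup>2"
    by (simp add: numeral_3_eq_3 numeral_2_eq_2 L_op_def[of "L_op (L_op \<alpha>)"])
  also have "\<dots> = \<alpha> (i + 2) * hankel_det3 \<alpha> i * (\<alpha> (i + 4) * hankel_det3 \<alpha> (i + 2))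
      - (\<alpha> (i + 3) * hankel_det3 \<alpha> (i + 1))\<^sup>2"
    unfolding L_op2 by (simp add: eval_nat_numeral)
  also have "\<dots> = hankel_det2 \<alpha> (i + 2) * hankel_det3 \<alpha> i * hankel_det3 \<alpha> (i + 2)
     + (\<alpha> (i + 3))\<^sup>2 * (hankel_det3 \<alpha> i * hankel_det3 \<alpha> (i + 2) - (hankel_det3 \<alpha> (i + 1))\<^sup>2)"
    by (simp add: hankel_det2_def eval_nat_numeral algebra_simps)
  finally show ?thesis by (simp only: hankel_condensation4 mult.assoc)
qed

context nonneg_cone
begin

lemma hankel_dets_in:
  assumes "TP (\<lambda>i j. \<alpha> (i + j))"
  shows "\<alpha> i \<in> C" "hankel_det2 \<alpha> i \<in> C" "hankel_det3 \<alpha> i \<in> C" "hankel_det4 \<alpha> i \<in> C"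
proof -
  have m: "minor (\<lambda>i j. \<alpha> (i + j)) s (\<lambda>k. i + k) (\<lambda>k. k) \<in> C" for s
    by (rule TP_D[OF assms]) (auto simp: strict_mono_on_def)
  show "\<alpha> i \<in> C" using m[of "Suc 0"] by (simp add: minor_1)
  show "hankel_det2 \<alpha> i \<in> C" using m[of "Suc (Suc 0)"]
    by (simp add: minor_2 hankel_det2_def power2_eq_square)
  show "hankel_det3 \<alpha> i \<in> C" "hankel_det4 \<alpha> i \<in> C"
    unfolding hankel_det3_def hankel_det4_def by (rule m)+
qed

theorem TP_Hankel_imp_log_convex:
  assumes "TP (\<lambda>i j. \<alpha> (i + j))" "m \<in> {1..3}" "i \<ge> m"
  shows "(L_op ^^ m) \<alpha> i \<in> C"
proof -
  note h = hankel_dets_in[OF assms(1)]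
  obtain j where j: "i = j + m" using assms(3) by (metis le_add_diff_inverse2)
  have "m = 1 \<or> m = 2 \<or> m = 3" using assms(2) by auto
  moreover have "(L_op ^^ 1) \<alpha> (j + 1) \<in> C" using h by (simp add: L_op_Suc)
  moreover have "(L_op ^^ 2) \<alpha> (j + 2) \<in> C" unfolding L_op2 by (intro mult_in h)
  moreover have "(L_op ^^ 3) \<alpha> (j + 3) \<in> C" unfolding L_op3 by (intro add_in mult_in power_in h)
  ultimately show ?thesis unfolding j by blast
qed

end


section \<open>The production operator of the array\<close>

definition one_minus_deriv :: "'a::idom \<Rightarrow> 'a poly \<Rightarrow> 'a poly" where
  "one_minus_deriv \<beta> p = p - smult \<beta> (pderiv p)"

text \<open>
The image of the \<open>k\<close>-th power under the inverse of \<open>one_minus_deriv \<beta>\<close>, that is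
\<open>\<Sum>\<^sub>j k!/j! \<beta>\<^sup>k\<^sup>-\<^sup>j q\<^sup>j\<close>, by a recursion that needs no division.
\<close>

primrec resolvent_image :: "'a::idom \<Rightarrow> nat \<Rightarrow> 'a poly" where
  "resolvent_image \<beta> 0 = 1"
| "resolvent_image \<beta> (Suc k) = monom 1 (Suc k) + smult (of_nat (Suc k) * \<beta>) (resolvent_image \<beta> k)"

definition resolvent :: "'a::idom \<Rightarrow> 'a poly \<Rightarrow> 'a poly" where
  "resolvent \<beta> p = (\<Sum>k\<le>degree p. smult (coeff p k) (resolvent_image \<beta> k))"

lemma lin_op_one_minus_deriv: "lin_op (one_minus_deriv \<beta>)"
  by (rule lin_opI) (auto simp: one_minus_deriv_def pderiv_add pderiv_smult algebra_simps smult_add_right smult_diff_right)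

lemma resolvent_upto:
  assumes "degree p \<le> K"
  shows "resolvent \<beta> p = (\<Sum>k\<le>K. smult (coeff p k) (resolvent_image \<beta> k))"
  unfolding resolvent_def
  by (rule sum.mono_neutral_left) (use assms in \<open>auto simp: coeff_eq_0\<close>)

lemma lin_op_resolvent: "lin_op (resolvent \<beta>)"
proof (rule lin_opI)
  fix p q :: "'a poly" and r :: 'a
  define K where "K = max (degree p) (degree q)"
  have "degree (p + q) \<le> K" unfolding K_def by (rule degree_add_le_max)
  thus "resolvent \<beta> (p + q) = resolvent \<beta> p + resolvent \<beta> q"
    by (simp add: resolvent_upto[of _ K] K_def smult_add_left sum.distrib)
  have "smult r (sum f A) = (\<Sum>i\<in>A. smult r (f i))" for f :: "nat \<Rightarrow> 'a poly" and A
    by (induction A rule: infinite_finite_induct) (auto simp: smult_add_right)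
  thus "resolvent \<beta> (smult r p) = smult r (resolvent \<beta> p)"
    by (simp add: resolvent_upto[of _ "degree p"] degree_smult_le)
qed

lemma resolvent_monom: "resolvent \<beta> (monom 1 k) = resolvent_image \<beta> k"
  by (simp add: resolvent_def degree_monom_eq if_distrib[of "\<lambda>x. smult x _"] coeff_monom cong: if_cong)

lemma one_minus_deriv_resolvent_image: "one_minus_deriv \<beta> (resolvent_image \<beta> k) = monom 1 k"
proof (induction k)
  case 0
  show ?case by (simp add: one_minus_deriv_def one_pCons monom_0)
next
  case (Suc k)
  have "one_minus_deriv \<beta> (resolvent_image \<beta> (Suc k)) =
      one_minus_deriv \<beta> (monom 1 (Suc k)) + smult (of_nat (Suc k) * \<beta>) (one_minus_deriv \<beta> (resolvent_image \<beta> k))"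
    by (simp only: resolvent_image.simps lin_op_add[OF lin_op_one_minus_deriv] lin_op_smult[OF lin_op_one_minus_deriv])
  also have "\<dots> = monom 1 (Suc k)"
    unfolding Suc by (simp add: one_minus_deriv_def pderiv_monom smult_monom mult_ac)
  finally show ?case .
qed

lemma one_minus_deriv_resolvent: "one_minus_deriv \<beta> (resolvent \<beta> p) = p"
  using lin_op_eqI[OF lin_op_comp[OF lin_op_resolvent lin_op_one_minus_deriv], of "\<lambda>p. p" \<beta> \<beta> p]
  by (simp add: lin_op_def resolvent_monom one_minus_deriv_resolvent_image)

lemma resolvent_one_minus_deriv: "resolvent \<beta> (one_minus_deriv \<beta> p) = p"
proof -
  have "resolvent \<beta> (one_minus_deriv \<beta> (monom 1 k)) = monom 1 k" for k
  proof (cases k)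
    case 0
    thus ?thesis by (simp add: one_minus_deriv_def monom_0 resolvent_def one_pCons)
  next
    case (Suc j)
    have "one_minus_deriv \<beta> (monom 1 k) = monom 1 k - smult (of_nat k * \<beta>) (monom 1 j)"
      using Suc by (simp add: one_minus_deriv_def pderiv_monom smult_monom mult_ac)
    thus ?thesis
      using Suc by (simp add: lin_op_diff[OF lin_op_resolvent] lin_op_smult[OF lin_op_resolvent] resolvent_monom)
  qed
  thus ?thesis
    using lin_op_eqI[OF lin_op_comp[OF lin_op_one_minus_deriv lin_op_resolvent], of "\<lambda>p. p" \<beta> \<beta> p]
    by (simp add: lin_op_def)
qed

lemma one_minus_deriv_mult_X: "one_minus_deriv \<beta> ([:x, 1:] * p) = [:x, 1:] * one_minus_deriv \<beta> p - smult \<beta> p"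
  unfolding one_minus_deriv_def pderiv_mult by (simp add: pderiv_pCons algebra_simps smult_add_right)

lemma funpow_one_minus_deriv_mult_X:
  "(one_minus_deriv \<beta> ^^ Suc k) ([:x, 1:] * p) =
    [:x, 1:] * (one_minus_deriv \<beta> ^^ Suc k) p - smult (of_nat (Suc k) * \<beta>) ((one_minus_deriv \<beta> ^^ k) p)"
proof (induction k)
  case 0
  show ?case by (simp add: one_minus_deriv_mult_X del: mult_pCons_left)
next
  case (Suc k)
  have "(one_minus_deriv \<beta> ^^ Suc (Suc k)) ([:x, 1:] * p) = one_minus_deriv \<beta> ((one_minus_deriv \<beta> ^^ Suc k) ([:x, 1:] * p))"
    by simp
  also have "\<dots> = one_minus_deriv \<beta> ([:x, 1:] * (one_minus_deriv \<beta> ^^ Suc k) p)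
      - smult (of_nat (Suc k) * \<beta>) (one_minus_deriv \<beta> ((one_minus_deriv \<beta> ^^ k) p))"
    unfolding Suc by (simp only: lin_op_diff[OF lin_op_one_minus_deriv] lin_op_smult[OF lin_op_one_minus_deriv])
  also have "\<dots> = [:x, 1:] * (one_minus_deriv \<beta> ^^ Suc (Suc k)) p - smult (of_nat (Suc (Suc k)) * \<beta>) ((one_minus_deriv \<beta> ^^ Suc k) p)"
  proof -
    have "of_nat (Suc (Suc k)) * \<beta> = \<beta> + of_nat (Suc k) * \<beta>" by (simp add: algebra_simps)
    thus ?thesis unfolding one_minus_deriv_mult_X
      by (simp add: smult_add_left del: mult_pCons_left of_nat_Suc)
  qed
  finally show ?case .
qed

lemma funpow_inverse:
  assumes "\<And>p. f (g p) = p"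
  shows "(f ^^ k) ((g ^^ (k + m)) p) = (g ^^ m) p"
proof (induction k)
  case (Suc k)
  have "(f ^^ Suc k) ((g ^^ (Suc k + m)) p) = (f ^^ k) (f (g ((g ^^ (k + m)) p)))"
    by (simp add: funpow_swap1)
  thus ?case using Suc by (simp add: assms)
qed simp

lemma funpow_one_minus_deriv_resolvent: "(one_minus_deriv \<beta> ^^ k) ((resolvent \<beta> ^^ (k + m)) p) = (resolvent \<beta> ^^ m) p"
  by (rule funpow_inverse) (rule one_minus_deriv_resolvent)

lemma funpow_resolvent_one_minus_deriv: "(resolvent \<beta> ^^ k) ((one_minus_deriv \<beta> ^^ (k + m)) p) = (one_minus_deriv \<beta> ^^ m) p"
  by (rule funpow_inverse) (rule resolvent_one_minus_deriv)

definition production_op :: "'a::idom \<Rightarrow> nat \<Rightarrow> nat \<Rightarrow> 'a \<Rightarrow> 'a poly \<Rightarrow> 'a poly" where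
  "production_op \<beta> m D x p = (resolvent \<beta> ^^ D) ([:x, 1:] * (resolvent \<beta> ^^ m) p)"

lemma lin_op_production_op: "lin_op (production_op \<beta> m D x)"
  unfolding production_op_def
  by (rule lin_op_comp[OF lin_op_comp[OF lin_op_funpow[OF lin_op_resolvent] lin_op_mult]
        lin_op_funpow[OF lin_op_resolvent]])

text \<open>
In operator form \<open>N\<^sup>m\<^sup>+\<^sup>1\<^sup>+\<^sup>D (E\<^sup>D w E\<^sup>m) = N\<^sup>m\<^sup>+\<^sup>1 w E\<^sup>m = w N - (m + 1) \<beta>\<close>; the next lemma is its
counterpart with the factors in the other order.
\<close>

lemma one_minus_deriv_production_op:
  "(one_minus_deriv \<beta> ^^ Suc (m + D)) (production_op \<beta> m D x p) = [:x, 1:] * one_minus_deriv \<beta> p - smult (of_nat (Suc m) * \<beta>) p"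
proof -
  have "(one_minus_deriv \<beta> ^^ Suc (m + D)) (production_op \<beta> m D x p) =
      (one_minus_deriv \<beta> ^^ Suc m) ((one_minus_deriv \<beta> ^^ D) ((resolvent \<beta> ^^ (D + 0)) ([:x, 1:] * (resolvent \<beta> ^^ m) p)))"
    by (simp add: production_op_def funpow_add)
  also have "\<dots> = (one_minus_deriv \<beta> ^^ Suc m) ([:x, 1:] * (resolvent \<beta> ^^ m) p)"
    by (subst funpow_one_minus_deriv_resolvent) simp
  also have "\<dots> = [:x, 1:] * one_minus_deriv \<beta> ((one_minus_deriv \<beta> ^^ m) ((resolvent \<beta> ^^ (m + 0)) p))
      - smult (of_nat (Suc m) * \<beta>) ((one_minus_deriv \<beta> ^^ m) ((resolvent \<beta> ^^ (m + 0)) p))"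
    unfolding funpow_one_minus_deriv_mult_X by simp
  also have "\<dots> = [:x, 1:] * one_minus_deriv \<beta> p - smult (of_nat (Suc m) * \<beta>) p"
    unfolding funpow_one_minus_deriv_resolvent by simp
  finally show ?thesis .
qed

lemma production_op_one_minus_deriv:
  "production_op \<beta> m D x ((one_minus_deriv \<beta> ^^ Suc (m + D)) p) = [:x, 1:] * one_minus_deriv \<beta> p + smult (of_nat D * \<beta>) p"
proof -
  have "(resolvent \<beta> ^^ m) ((one_minus_deriv \<beta> ^^ (m + Suc D)) p) = (one_minus_deriv \<beta> ^^ Suc D) p"
    by (rule funpow_resolvent_one_minus_deriv)
  hence "production_op \<beta> m D x ((one_minus_deriv \<beta> ^^ Suc (m + D)) p) = (resolvent \<beta> ^^ D) ([:x, 1:] * (one_minus_deriv \<beta> ^^ Suc D) p)"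
    by (simp add: production_op_def)
  also have "[:x, 1:] * (one_minus_deriv \<beta> ^^ Suc D) p =
      (one_minus_deriv \<beta> ^^ (D + 1)) ([:x, 1:] * p) + smult (of_nat (Suc D) * \<beta>) ((one_minus_deriv \<beta> ^^ (D + 0)) p)"
    using funpow_one_minus_deriv_mult_X[of D \<beta> x p] by simp
  also have "(resolvent \<beta> ^^ D) \<dots> = one_minus_deriv \<beta> ([:x, 1:] * p) + smult (of_nat (Suc D) * \<beta>) p"
    unfolding lin_op_add[OF lin_op_funpow[OF lin_op_resolvent]]
      lin_op_smult[OF lin_op_funpow[OF lin_op_resolvent]] funpow_resolvent_one_minus_deriv by simp
  also have "\<dots> = [:x, 1:] * one_minus_deriv \<beta> p + smult (of_nat D * \<beta>) p"
    unfolding one_minus_deriv_mult_X by (simp add: algebra_simps smult_add_left)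
  finally show ?thesis .
qed

text \<open>
Comparing the two preceding lemmas gives \<open>N\<^sup>a X = X N\<^sup>a - a \<beta>\<close> for \<open>a = m + D + 1\<close>.  Therefore
\<open>X N\<^sup>a R\<^sub>n = X R\<^sub>n - a \<beta> n R\<^sub>n\<close> propagates along \<open>R\<^sub>n\<^sub>+\<^sub>1 = c X R\<^sub>n\<close>, and the left-hand side is
\<open>w N R\<^sub>n + D \<beta> R\<^sub>n\<close>.
\<close>

lemma production_op_iterate_step:
  fixes c \<beta> x :: "'a::idom" and m D :: nat
  defines "R \<equiv> (\<lambda>n. ((\<lambda>p. smult c (production_op \<beta> m D x p)) ^^ n) 1)"
  shows "production_op \<beta> m D x (R n) = [:x, 1:] * one_minus_deriv \<beta> (R n) + smult (\<beta> * of_nat (D + Suc (m + D) * n)) (R n)"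
proof -
  define X where "X = production_op \<beta> m D x"
  define N where "N = one_minus_deriv \<beta> ^^ Suc (m + D)"
  define a where "a = Suc (m + D)"
  have lX: "lin_op X" unfolding X_def by (rule lin_op_production_op)
  have lN: "lin_op N" unfolding N_def by (rule lin_op_funpow[OF lin_op_one_minus_deriv])
  have XN: "X (N p) = [:x, 1:] * one_minus_deriv \<beta> p + smult (of_nat D * \<beta>) p" for p
    unfolding X_def N_def by (rule production_op_one_minus_deriv)
  have NX: "N (X p) = X (N p) - smult (of_nat a * \<beta>) p" for p
    unfolding XN unfolding X_def N_def one_minus_deriv_production_op by (simp add: a_def smult_add_left algebra_simps)
  have R_Suc: "R (Suc n) = smult c (X (R n))" for n by (simp add: R_def X_def)
  have "X (R n) = X (N (R n)) + smult (of_nat (a * n) * \<beta>) (R n)"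
  proof (induction n)
    case 0
    have "one_minus_deriv \<beta> 1 = 1" by (simp add: one_minus_deriv_def one_pCons)
    hence "(one_minus_deriv \<beta> ^^ k) 1 = 1" for k by (induction k) auto
    thus ?case by (simp add: R_def N_def del: funpow.simps)
  next
    case (Suc n)
    have "X (N (R (Suc n))) = smult c (X (X (N (R n))) - smult (of_nat a * \<beta>) (X (R n)))"
      unfolding R_Suc by (simp only: lin_op_smult[OF lX] lin_op_smult[OF lN] NX lin_op_diff[OF lX])
    also have "X (N (R n)) = X (R n) - smult (of_nat (a * n) * \<beta>) (R n)"
      using Suc by (simp add: algebra_simps)
    also have "X \<dots> = X (X (R n)) - smult (of_nat (a * n) * \<beta>) (X (R n))"
      by (simp only: lin_op_diff[OF lX] lin_op_smult[OF lX])
    also have "smult c (\<dots> - smult (of_nat a * \<beta>) (X (R n))) =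
        X (R (Suc n)) - smult (of_nat (a * Suc n) * \<beta>) (R (Suc n))"
      unfolding R_Suc lin_op_smult[OF lX]
      by (simp add: smult_diff_right smult_add_left smult_add_right algebra_simps)
    finally show ?case by simp
  qed
  thus ?thesis unfolding XN unfolding X_def a_def
    by (simp add: smult_add_left algebra_simps)
qed

definition row_poly :: "nat \<Rightarrow> 'a::idom \<Rightarrow> 'a \<Rightarrow> 'a \<Rightarrow> 'a \<Rightarrow> nat \<Rightarrow> 'a poly" where
  "row_poly a d c b l n = (\<Sum>k\<le>n. monom (T_arr a d c b l n k) k)"

lemma coeff_row_poly: "coeff (row_poly a d c b l n) k = T_arr a d c b l n k"
  by (simp add: row_poly_def coeff_sum coeff_monom T_arr_eq_0)

lemma poly_row_poly: "poly (row_poly a d c b l n) q = T_row a d c b l q n"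
  by (simp add: row_poly_def T_row_def poly_sum poly_monom)

lemma row_poly_0: "row_poly a d c b l 0 = 1"
  by (simp add: row_poly_def monom_0 one_pCons)

lemma row_poly_Suc:
  "row_poly a d c b l (Suc n) =
     [:c * l, c:] * row_poly a d c b l n + smult (of_nat a * b * (of_nat n + d)) (row_poly a d c b l n)
     - smult b ([:l, 1:] * pderiv (row_poly a d c b l n))"
  by (rule poly_eqI)
    (simp add: coeff_row_poly coeff_pCons coeff_pderiv algebra_simps split: nat.splits)

lemma row_poly_Suc_one_minus_deriv:
  assumes "b = c * \<beta>" "of_nat a * d = of_nat D"
  shows "row_poly a d c b l (Suc n) =
     smult c ([:l, 1:] * one_minus_deriv \<beta> (row_poly a d c b l n) + smult (\<beta> * of_nat (D + a * n)) (row_poly a d c b l n))"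
proof -
  have "of_nat a * b * (of_nat n + d) = b * (of_nat a * d + of_nat a * of_nat n)"
    by (simp add: algebra_simps)
  also have "\<dots> = c * (\<beta> * of_nat (D + a * n))"
    unfolding assms by (simp add: algebra_simps)
  finally have *: "of_nat a * b * (of_nat n + d) = c * (\<beta> * of_nat (D + a * n))" .
  show ?thesis unfolding row_poly_Suc * unfolding assms(1)
    by (simp add: one_minus_deriv_def algebra_simps smult_diff_right smult_add_right)
qed

theorem row_poly_production:
  assumes b: "b = c * \<beta>" and d: "of_nat a * d = of_nat D" and a: "a = Suc (m + D)"
  shows "row_poly a d c b l n = ((\<lambda>p. smult c (production_op \<beta> m D l p)) ^^ n) 1"
proof (induction n)
  case (Suc n)
  show ?case
    unfolding row_poly_Suc_one_minus_deriv[OF b d] Suc funpow.simps comp_apply production_op_iterate_step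
    by (simp only: a)
qed (simp add: row_poly_0)

lemma funpow_resolvent_mult_X:
  "(resolvent \<beta> ^^ D) ([:x, 1:] * one_minus_deriv \<beta> p) =
   [:x, 1:] * one_minus_deriv \<beta> ((resolvent \<beta> ^^ D) p) + smult (of_nat D * \<beta>) ((resolvent \<beta> ^^ D) p)"
  using production_op_one_minus_deriv[of \<beta> 0 D x "(resolvent \<beta> ^^ D) p"]
    funpow_one_minus_deriv_resolvent[of D \<beta> 0 p]
  by (simp add: production_op_def)

text \<open>
Moving \<open>E\<^sup>D\<close> past \<open>w N\<close> costs exactly the term \<open>D \<beta> E\<^sup>D\<close> by which the two recurrences differ.
\<close>

theorem row_poly_shift_d:
  assumes b: "b = c * \<beta>" and d: "of_nat a * d = of_nat D"
  shows "row_poly a d c b l n = (resolvent \<beta> ^^ D) (row_poly a 0 c b l n)"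
proof (induction n)
  case 0
  have "resolvent \<beta> 1 = 1" by (simp add: resolvent_def)
  hence "(resolvent \<beta> ^^ k) 1 = 1" for k by (induction k) auto
  thus ?case by (simp add: row_poly_0)
next
  case (Suc n)
  let ?E = "resolvent \<beta> ^^ D"
  have lE: "lin_op ?E" by (rule lin_op_funpow[OF lin_op_resolvent])
  have d0: "of_nat a * (0 :: 'a) = of_nat 0" by simp
  show ?case
    unfolding row_poly_Suc_one_minus_deriv[OF b d] row_poly_Suc_one_minus_deriv[OF b d0] Suc
      lin_op_smult[OF lE] lin_op_add[OF lE] funpow_resolvent_mult_X
    by (simp add: algebra_simps smult_add_left)
qed

theorem row_poly_translate:
  "row_poly a d c b (l + q) n = pcompose (row_poly a d c b l n) [:q, 1:]"
proof (induction n)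
  case (Suc n)
  have 1: "[:c * (l + q), c:] = pcompose [:c * l, c:] [:q, 1:]" "[:l + q, 1:] = pcompose [:l, 1:] [:q, 1:]"
    by (simp_all add: pcompose_pCons algebra_simps)
  have 2: "pderiv (pcompose p [:q, 1:]) = pcompose (pderiv p) [:q, 1:]" for p
    by (simp add: pderiv_pcompose pderiv_pCons)
  show ?case unfolding row_poly_Suc[of a d c b "l + q"] row_poly_Suc[of a d c b l] Suc 1 2
    by (simp only: pcompose_diff pcompose_add pcompose_mult pcompose_smult)
qed (simp add: row_poly_0 one_pCons pcompose_const)

text \<open>
Evaluating at \<open>q\<close> is translating by \<open>q\<close> and taking the constant term, and translating replaces \<open>\<lambda>\<close> by
\<open>\<lambda> + q\<close>.  This turns the Hankel matrix of row polynomials into one of first column entries.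
\<close>

corollary T_row_eq_T_arr_0:
  fixes d c b l q :: "'a::idom"
  shows "T_row a d c b l q n = T_arr a d c b (l + q) n 0"
proof -
  have "T_arr a d c b (l + q) n 0 = poly (row_poly a d c b (l + q) n) 0"
    by (simp add: poly_0_coeff_0 coeff_row_poly)
  also have "\<dots> = T_row a d c b l q n"
    unfolding row_poly_translate by (simp add: poly_pcompose poly_row_poly)
  finally show ?thesis by simp
qed

locale nonneg_cone_idom = nonneg_cone C for C :: "'a::idom set"
begin

lemma TP_op_resolvent:
  assumes "\<beta> \<in> C"
  shows "TP (op_matrix (resolvent \<beta>))"
proof -
  have co: "coeff (resolvent_image \<beta> (Suc k)) j = (if j = Suc k then 1 else 0) + of_nat (Suc k) * \<beta> * coeff (resolvent_image \<beta> k) j"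
    for k j by (simp add: coeff_monom)
  have z: "coeff (resolvent_image \<beta> i) j = 0" if "i < j" for i j
    using that by (induction i) (auto simp: coeff_monom)
  have d: "coeff (resolvent_image \<beta> i) i = 1" for i
    by (cases i) (auto simp: co z simp del: resolvent_image.simps(2))
  show ?thesis
    unfolding op_matrix_def resolvent_monom
  proof (rule TP_single_pair)
    show "coeff (resolvent_image \<beta> i) j \<in> C" for i j
    proof (induction i)
      case (Suc i)
      show ?case unfolding co
        by (intro add_in mult_in of_nat_in assms Suc) (auto simp: zero_in one_in)
    qed (auto simp: zero_in one_in)
    show "coeff (resolvent_image \<beta> i) j = 0" if "i < j" for i j by (rule z[OF that])
    show "coeff (resolvent_image \<beta> i) k = coeff (resolvent_image \<beta> j) k * coeff (resolvent_image \<beta> i) j" if "k \<le> j" "j \<le> i" for i j k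
      using that(2)
    proof (induction i rule: dec_induct)
      case base
      show ?case by (simp add: d)
    next
      case (step i)
      show ?case unfolding co step.IH using step.hyps that(1) by (simp add: mult_ac)
    qed
  qed
qed

lemma TP_op_production_op:
  assumes "c \<in> C" "\<beta> \<in> C" "x \<in> C"
  shows "TP (op_matrix (\<lambda>p. smult c (production_op \<beta> m D x p)))"
proof -
  have E: "TP (op_matrix (resolvent \<beta> ^^ k))" for k
    by (rule TP_op_funpow[OF lin_op_resolvent TP_op_resolvent[OF assms(2)]])
  have eq: "(\<lambda>p. smult c (production_op \<beta> m D x p)) =
      (\<lambda>p. (resolvent \<beta> ^^ D) ([:c * x, c:] * (resolvent \<beta> ^^ m) p))"
    unfolding production_op_def lin_op_smult[OF lin_op_funpow[OF lin_op_resolvent], symmetric]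
    by (simp add: smult_add_right)
  show ?thesis
    unfolding eq
    by (intro TP_op_comp[OF lin_op_funpow[OF lin_op_resolvent] _ E]
        TP_op_comp[OF lin_op_mult E] TP_op_mult_linear mult_in assms)
qed

text \<open>
The rows for \<open>d = 0\<close> have a totally positive production matrix for every \<open>a \<ge> 1\<close>, and the rows for \<open>d\<close> are
obtained from them by the totally positive matrix of \<open>E\<^sup>D\<close>.  The element \<open>\<beta>\<close> stands for \<open>b / c\<close> without
requiring division in the ring.
\<close>

theorem TP_T_arr:
  assumes c: "c \<in> C" and \<beta>: "\<beta> \<in> C" and l: "l \<in> C"
    and b: "b = c * \<beta>" and d: "of_nat a * d = of_nat D" and a: "a \<ge> 1"
  shows "TP (T_arr a d c b l)"
proof -
  define X where "X = (\<lambda>p. smult c (production_op \<beta> (a - 1) 0 l p))"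
  have lX: "lin_op X" unfolding X_def
    by (rule lin_opI) (simp_all add: lin_op_add[OF lin_op_production_op] lin_op_smult[OF lin_op_production_op] smult_add_right mult.commute)
  have TX: "TP (op_matrix X)" unfolding X_def by (rule TP_op_production_op[OF c \<beta> l])
  have T0: "row_poly a 0 c b l n = (X ^^ n) 1" for n
    unfolding X_def by (rule row_poly_production[OF b]) (use a in auto)
  have lE: "lin_op (resolvent \<beta> ^^ D)" by (rule lin_op_funpow[OF lin_op_resolvent])
  show ?thesis
  proof (rule TP_product[OF TP_output_rows[OF lX TX] TP_op_funpow[OF lin_op_resolvent TP_op_resolvent[OF \<beta>]]])
    show "finite {k. coeff ((X ^^ i) 1) k \<noteq> 0}" for i by (rule finite_coeff_support)
    show "T_arr a d c b l i j = (\<Sum>k | coeff ((X ^^ i) 1) k \<noteq> 0. coeff ((X ^^ i) 1) k * op_matrix (resolvent \<beta> ^^ D) k j)" for i j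
      using coeff_lin_op[OF lE, of "(X ^^ i) 1" j]
      by (simp add: T0[symmetric] row_poly_shift_d[OF b d, symmetric] coeff_row_poly)
  qed
qed

theorem TP_Hankel_T_arr_0:
  assumes c: "c \<in> C" and \<beta>: "\<beta> \<in> C" and l: "l \<in> C"
    and b: "b = c * \<beta>" and d: "of_nat a * d = of_nat D" and a: "D < a"
  shows "TP (\<lambda>i j. T_arr a d c b l (i + j) 0)"
proof -
  define m where "m = a - Suc D"
  have am: "a = Suc (m + D)" using a by (simp add: m_def)
  define X where "X = (\<lambda>p. smult c (production_op \<beta> m D l p))"
  have lX: "lin_op X" unfolding X_def
    by (rule lin_opI) (simp_all add: lin_op_add[OF lin_op_production_op] lin_op_smult[OF lin_op_production_op] smult_add_right mult.commute)
  have TX: "TP (op_matrix X)" unfolding X_def by (rule TP_op_production_op[OF c \<beta> l])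
  have "T_arr a d c b l n 0 = coeff ((X ^^ n) 1) 0" for n
    unfolding X_def row_poly_production[OF b d am, symmetric] coeff_row_poly ..
  thus ?thesis using TP_Hankel_output[OF lX TX] by simp
qed

corollary TP_Hankel_T_row:
  assumes "c \<in> C" "\<beta> \<in> C" "l \<in> C" "q \<in> C" "b = c * \<beta>" "of_nat a * d = of_nat D" "D < a"
  shows "TP (\<lambda>i j. T_row a d c b l q (i + j))"
  unfolding T_row_eq_T_arr_0 using assms by (intro TP_Hankel_T_arr_0[of c \<beta>] add_in)

end


section \<open>The explicit formula for the entries\<close>

text \<open>
The coefficient of \<open>b\<^sup>n\<^sup>-\<^sup>k\<close> in the entry \<open>(n, k)\<close> for \<open>\<lambda> = 0\<close>, that is \<open>n!\<close> times the coefficient of \<open>t\<^sup>n\<close> in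
\<open>(1 - a t)\<^sup>-\<^sup>d (c (1 - (1 - a t)\<^sup>1\<^sup>/\<^sup>a))\<^sup>k / k!\<close>, expanded with the binomial theorem.
\<close>

definition entry_coeff :: "nat \<Rightarrow> real \<Rightarrow> real \<Rightarrow> nat \<Rightarrow> nat \<Rightarrow> real" where
  "entry_coeff a d c n k = c ^ k / fact k * real a ^ n *
     (\<Sum>i\<le>k. (-1) ^ (n + i) * real (k choose i) * falling_factorial ((real i - real a * d) / real a) n)"

lemma falling_factorial_Suc: "falling_factorial x (Suc n) = falling_factorial x n * (x - of_nat n)"
  by (simp add: falling_factorial_def)

text \<open>
The additional factor of the falling factorial is \<open>a n + a d - i\<close> up to sign and a factor \<open>a\<close>.  Writing
it as \<open>(a n + a d - k) + (k - i)\<close> and absorbing \<open>k - i\<close> into the binomial coefficient produces the two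
terms of the recurrence.
\<close>

lemma entry_coeff_Suc:
  assumes a: "a \<ge> 1"
  shows "entry_coeff a d c (Suc n) k = c * (if k = 0 then 0 else entry_coeff a d c n (k - 1))
     + (real a * real n - real k + real a * d) * entry_coeff a d c n k"
proof -
  define X where "X = (\<lambda>i. (-1) ^ (n + i) * falling_factorial ((real i - real a * d) / real a) n :: real)"
  have S: "entry_coeff a d c n k = c ^ k / fact k * real a ^ n * (\<Sum>i\<le>k. real (k choose i) * X i)" for k
    by (simp add: entry_coeff_def X_def mult_ac)
  have absorb: "real (k choose i) * (real k - real i) = real k * real (k - 1 choose i)" if "i \<le> k" for i
    using arg_cong[OF binomial_absorb_comp[of k i], of real] that
    by (simp only: of_nat_mult of_nat_diff mult.commute)
  have step: "real a * ((-1) ^ (Suc n + i) * real (k choose i) * falling_factorial ((real i - real a * d) / real a) (Suc n)) =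
      (real a * real n - real k + real a * d) * (real (k choose i) * X i) + real k * (real (k - 1 choose i) * X i)"
    if "i \<le> k" for i
  proof -
    have "real a * ((real i - real a * d) / real a - real n) = real i - real a * d - real a * real n"
      using a by (simp add: field_simps)
    hence "real a * ((-1) ^ (Suc n + i) * real (k choose i) * falling_factorial ((real i - real a * d) / real a) (Suc n)) =
        - (real (k choose i) * X i) * (real i - real a * d - real a * real n)"
      unfolding falling_factorial_Suc X_def by (simp add: mult_ac)
    also have "\<dots> = (real a * real n - real k + real a * d) * (real (k choose i) * X i)
        + (real (k choose i) * (real k - real i)) * X i"
      by (simp add: algebra_simps)
    finally show ?thesis unfolding absorb[OF that] by (simp add: mult_ac)
  qed
  have "entry_coeff a d c (Suc n) k = c ^ k / fact k * real a ^ n *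
      (\<Sum>i\<le>k. real a * ((-1) ^ (Suc n + i) * real (k choose i) * falling_factorial ((real i - real a * d) / real a) (Suc n)))"
    unfolding sum_distrib_left[symmetric] by (simp add: entry_coeff_def mult_ac)
  also have "(\<Sum>i\<le>k. real a * ((-1) ^ (Suc n + i) * real (k choose i) * falling_factorial ((real i - real a * d) / real a) (Suc n))) =
      (real a * real n - real k + real a * d) * (\<Sum>i\<le>k. real (k choose i) * X i) + real k * (\<Sum>i\<le>k. real (k - 1 choose i) * X i)"
    unfolding sum_distrib_left sum.distrib[symmetric] by (intro sum.cong refl step) simp
  finally have 1: "entry_coeff a d c (Suc n) k = (real a * real n - real k + real a * d) * entry_coeff a d c n k
      + c ^ k / fact k * real a ^ n * (real k * (\<Sum>i\<le>k. real (k - 1 choose i) * X i))"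
    unfolding S by (simp only: distrib_left mult_ac)
  have 2: "c ^ k / fact k * real a ^ n * (real k * (\<Sum>i\<le>k. real (k - 1 choose i) * X i)) =
      c * (if k = 0 then 0 else entry_coeff a d c n (k - 1))"
  proof (cases k)
    case (Suc j)
    have "(\<Sum>i\<le>k. real (k - 1 choose i) * X i) = (\<Sum>i\<le>j. real (j choose i) * X i)"
      by (simp add: Suc)
    moreover have "c ^ k / fact k * real k = c * (c ^ j / fact j)"
      by (simp add: Suc del: of_nat_Suc)
    ultimately show ?thesis by (simp add: S Suc mult_ac)
  qed simp
  show ?thesis unfolding 1 2 by simp
qed

lemma T_arr_eq_entry_coeff:
  assumes a: "a \<ge> 1"
  shows "T_arr a d c 1 0 n k = entry_coeff a d c n k"
proof (induction n arbitrary: k)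
  case 0
  show ?case using choose_alternating_sum[of k, where 'a = real]
    by (simp add: entry_coeff_def falling_factorial_def)
next
  case (Suc n)
  show ?case unfolding entry_coeff_Suc[OF a] Suc[symmetric] by simp
qed

text \<open>
The sum is a nonzero multiple of an entry above the diagonal.
\<close>

lemma entry_coeff_sum_vanishes:
  fixes c d :: real
  assumes a: "a \<ge> 1" and c: "c > 0" and n: "n < m"
  shows "(\<Sum>i\<le>m. (-1) ^ (n + i) * real (m choose i) * falling_factorial ((real i - real a * d) / real a) n) = 0"
  using T_arr_eq_0[OF n, of a d c 1 0] a c unfolding T_arr_eq_entry_coeff[OF a] entry_coeff_def by simp

lemma Const_add: "Const (x + y) = Const x + Const y"
  by (simp add: Const_def single_add)

lemma Const_mult: "Const (x * y) = Const x * Const y"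
  by (simp add: Const_def mult_single)

lemma Const_0 [simp]: "Const 0 = 0" and Const_1 [simp]: "Const 1 = 1"
  by (simp_all add: Const_def)

lemma Const_of_nat: "Const (of_nat n) = of_nat n"
  by (simp add: Const_def)

lemma Const_diff: "Const (x - y) = Const x - Const y"
  using Const_add[of "x - y" y] by (simp add: algebra_simps)

lemma Const_sum: "Const (sum f I) = (\<Sum>i\<in>I. Const (f i))"
  by (induction I rule: infinite_finite_induct) (auto simp: Const_add)

lemma T_arr_Const:
  "k \<le> n \<Longrightarrow> T_arr a (Const d) (Const c) B 0 n k = Const (T_arr a d c 1 0 n k) * B ^ (n - k)"
proof -
  define t where "t = T_arr a d c 1 0"
  have "T_arr a (Const d) (Const c) B 0 n k = Const (t n k) * (if k \<le> n then B ^ (n - k) else 0)" for k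
  proof (induction n arbitrary: k)
    case 0
    show ?case by (simp add: t_def)
  next
    case (Suc n)
    define e where "e = (\<lambda>n k. if k \<le> n then B ^ (n - k) else 0)"
    have t0: "t n k = 0" if "k > n" for k using that by (simp add: t_def T_arr_eq_0)
    have 1: "(if k = 0 then 0 else T_arr a (Const d) (Const c) B 0 n (k - 1)) =
        Const (if k = 0 then 0 else t n (k - 1)) * e (Suc n) k"
      unfolding Suc by (cases k) (auto simp: e_def)
    have 2: "B * T_arr a (Const d) (Const c) B 0 n k = Const (t n k) * e (Suc n) k"
      unfolding Suc by (cases "k \<le> n") (auto simp: e_def t0 Suc_diff_le)
    have "T_arr a (Const d) (Const c) B 0 (Suc n) k =
        Const c * (if k = 0 then 0 else T_arr a (Const d) (Const c) B 0 n (k - 1))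
        + (of_nat a * of_nat n - of_nat k + of_nat a * Const d) * (B * T_arr a (Const d) (Const c) B 0 n k)"
      by (simp add: algebra_simps)
    also have "\<dots> = Const (c * (if k = 0 then 0 else t n (k - 1)) + (of_nat a * of_nat n - of_nat k + of_nat a * d) * t n k) * e (Suc n) k"
      unfolding 1 2 by (simp only: Const_add Const_mult Const_diff Const_of_nat distrib_right mult.assoc)
    also have "c * (if k = 0 then 0 else t n (k - 1)) + (of_nat a * of_nat n - of_nat k + of_nat a * d) * t n k = t (Suc n) k"
      by (simp add: t_def)
    finally show ?case by (simp add: e_def)
  qed
  thus "k \<le> n \<Longrightarrow> ?thesis" by (simp add: t_def)
qed

lemma pcompose_monom_general: "pcompose (monom r m) q = smult r (q ^ m)"
proof (induction m)
  case (Suc m)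
  thus ?case by (simp add: monom_Suc pcompose_pCons)
qed (simp add: monom_0)

text \<open>
Expansion of the row polynomial for \<open>\<lambda> = 0\<close> at \<open>q + \<lambda>\<close> in powers of \<open>q\<close>.
\<close>

lemma T_arr_translate:
  fixes d c b l :: "'a::idom"
  shows "T_arr a d c b l n k = (\<Sum>m\<in>{k..n}. T_arr a d c b 0 n m * of_nat (m choose k) * l ^ (m - k))"
proof -
  have "T_arr a d c b (0 + l) n k = coeff (pcompose (row_poly a d c b 0 n) [:l, 1:]) k"
    unfolding row_poly_translate[symmetric] coeff_row_poly ..
  also have "\<dots> = (\<Sum>m\<le>n. T_arr a d c b 0 n m * coeff ([:l, 1:] ^ m) k)"
    by (simp add: row_poly_def pcompose_sum pcompose_monom_general coeff_sum)
  also have "\<dots> = (\<Sum>m\<in>{k..n}. T_arr a d c b 0 n m * coeff ([:l, 1:] ^ m) k)"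
  proof (rule sum.mono_neutral_right)
    show "\<forall>m\<in>{..n} - {k..n}. T_arr a d c b 0 n m * coeff ([:l, 1:] ^ m) k = 0"
      by (auto intro!: coeff_eq_0 simp: degree_linear_power)
  qed auto
  also have "\<dots> = (\<Sum>m\<in>{k..n}. T_arr a d c b 0 n m * of_nat (m choose k) * l ^ (m - k))"
    by (intro sum.cong) (auto simp: coeff_linear_poly_power mult.assoc)
  finally show ?thesis by simp
qed

theorem T_arr_explicit:
  assumes a: "a \<ge> 1"
  shows "T_arr a (Const d) (Const c) B l n k = Const (real a ^ n / fact k) *
          (\<Sum>j | k + j \<le> n. \<Sum>i\<le>k+j.
             Const ((-1) ^ (n - i) * c ^ (k + j) / fact j * real ((k + j) choose i)
                * falling_factorial ((real i - real a * d) / real a) n)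
             * B ^ (n - k - j) * l ^ j)"
proof -
  define Y where "Y = (\<lambda>i. falling_factorial ((real i - real a * d) / real a) n)"
  have "T_arr a (Const d) (Const c) B l n k =
      (\<Sum>m\<in>{k..n}. T_arr a (Const d) (Const c) B 0 n m * of_nat (m choose k) * l ^ (m - k))"
    by (rule T_arr_translate)
  also have "\<dots> = (\<Sum>j | k + j \<le> n. T_arr a (Const d) (Const c) B 0 n (k + j) * of_nat ((k + j) choose k) * l ^ j)"
    by (rule sum.reindex_bij_witness[where i = "\<lambda>j. k + j" and j = "\<lambda>m. m - k"]) auto
  also have "\<dots> = (\<Sum>j | k + j \<le> n. Const (real a ^ n / fact k) * (\<Sum>i\<le>k+j.
      Const ((-1) ^ (n - i) * c ^ (k + j) / fact j * real ((k + j) choose i) * Y i) * B ^ (n - k - j) * l ^ j))"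
  proof (rule sum.cong[OF refl])
    fix j assume "j \<in> {j. k + j \<le> n}"
    hence j: "k + j \<le> n" by simp
    have "T_arr a (Const d) (Const c) B 0 n (k + j) * of_nat ((k + j) choose k) * l ^ j =
        Const (entry_coeff a d c n (k + j) * real ((k + j) choose k)) * B ^ (n - k - j) * l ^ j"
      unfolding T_arr_Const[OF j] T_arr_eq_entry_coeff[OF a] Const_mult Const_of_nat by (simp add: mult_ac)
    also have "entry_coeff a d c n (k + j) * real ((k + j) choose k) =
        real a ^ n / fact k * (\<Sum>i\<le>k+j. (-1) ^ (n - i) * c ^ (k + j) / fact j * real ((k + j) choose i) * Y i)"
    proof -
      have "real ((k + j) choose k) / fact (k + j) = 1 / fact k * (1 / fact j)"
        by (simp add: binomial_fact)
      hence "entry_coeff a d c n (k + j) * real ((k + j) choose k) = real a ^ n / fact k * (c ^ (k + j) / fact j *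
          (\<Sum>i\<le>k+j. (-1) ^ (n + i) * real ((k + j) choose i) * Y i))"
        unfolding entry_coeff_def Y_def by (simp add: field_simps)
      also have "c ^ (k + j) / fact j * (\<Sum>i\<le>k+j. (-1) ^ (n + i) * real ((k + j) choose i) * Y i) =
          (\<Sum>i\<le>k+j. (-1) ^ (n - i) * c ^ (k + j) / fact j * real ((k + j) choose i) * Y i)"
        unfolding sum_distrib_left
      proof (rule sum.cong[OF refl])
        fix i assume "i \<in> {..k + j}"
        hence "(-1 :: real) ^ (n + i) = (-1) ^ (n - i)"
          using j by (intro minus_one_power_iff[THEN trans] trans[OF _ minus_one_power_iff[symmetric]]) auto
        thus "c ^ (k + j) / fact j * ((-1) ^ (n + i) * real ((k + j) choose i) * Y i) =
           (-1) ^ (n - i) * c ^ (k + j) / fact j * real ((k + j) choose i) * Y i" by simp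
      qed
      finally show ?thesis .
    qed
    finally show "T_arr a (Const d) (Const c) B 0 n (k + j) * of_nat ((k + j) choose k) * l ^ j =
      Const (real a ^ n / fact k) * (\<Sum>i\<le>k+j.
      Const ((-1) ^ (n - i) * c ^ (k + j) / fact j * real ((k + j) choose i) * Y i) * B ^ (n - k - j) * l ^ j)"
      by (simp only: Const_mult[of "_ ^ n / _"] Const_sum sum_distrib_right mult.assoc)
  qed
  finally show ?thesis unfolding Y_def by (simp only: sum_distrib_left)
qed


section \<open>The cone of polynomials with nonnegative coefficients\<close>

lemma nonneg_coeffs_add: "nonneg_coeffs p \<Longrightarrow> nonneg_coeffs q \<Longrightarrow> nonneg_coeffs (p + q)"
  by (simp add: nonneg_coeffs_def lookup_add)

lemma nonneg_coeffs_mult: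
  assumes "nonneg_coeffs p" "nonneg_coeffs q"
  shows "nonneg_coeffs (p * q)"
  using assms unfolding nonneg_coeffs_def lookup_mult Sum_any.expand_set
  by (auto intro!: sum_nonneg mult_nonneg_nonneg simp: when_def)

lemma polys_in_add: "p \<in> polys_in X \<Longrightarrow> q \<in> polys_in X \<Longrightarrow> p + q \<in> polys_in X"
  using keys_add[of p q] by (auto simp: polys_in_def)

lemma polys_in_mult:
  assumes "p \<in> polys_in X" "q \<in> polys_in X"
  shows "p * q \<in> polys_in X"
  unfolding polys_in_def
proof (intro CollectI ballI)
  fix m assume "m \<in> Poly_Mapping.keys (p * q)"
  then obtain m1 m2 where "m = m1 + m2" "m1 \<in> Poly_Mapping.keys p" "m2 \<in> Poly_Mapping.keys q"
    using keys_mult[of p q] by blast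
  thus "Poly_Mapping.keys m \<subseteq> X"
    using assms keys_add[of m1 m2] unfolding polys_in_def by blast
qed

text \<open>
Including the restriction on the indeterminates in the cone makes the membership of the matrix
entries in \<open>polys_in X\<close> the case of minors of size one.
\<close>

definition nonneg_polys :: "nat set \<Rightarrow> rpoly set" where
  "nonneg_polys X = {p \<in> polys_in X. nonneg_coeffs p}"

lemma nonneg_polys_cone: "nonneg_cone_idom (nonneg_polys X)"
proof unfold_locales
  show "0 \<in> nonneg_polys X" "1 \<in> nonneg_polys X"
    by (auto simp: nonneg_polys_def polys_in_def nonneg_coeffs_def lookup_one when_def)
qed (auto simp: nonneg_polys_def polys_in_add polys_in_mult nonneg_coeffs_add nonneg_coeffs_mult)

lemma Const_nonneg_polys: "r \<ge> 0 \<Longrightarrow> Const r \<in> nonneg_polys X"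
  by (auto simp: nonneg_polys_def polys_in_def nonneg_coeffs_def Const_def lookup_single when_def)

lemma Var_nonneg_polys: "v \<in> X \<Longrightarrow> Var v \<in> nonneg_polys X"
  by (auto simp: nonneg_polys_def polys_in_def nonneg_coeffs_def Var_def lookup_single when_def)

lemma poly_TP_nonneg_polys:
  assumes "nonneg_cone.TP (nonneg_polys X) M"
  shows "poly_TP X M"
proof -
  interpret nonneg_cone_idom "nonneg_polys X" by (rule nonneg_polys_cone)
  show ?thesis
    using TP_entry[OF assms] TP_D[OF assms] by (auto simp: poly_TP_def nonneg_polys_def)
qed

lemma poly_SM_log_convex:
  assumes "nonneg_cone.TP (nonneg_polys X) (\<lambda>i j. \<alpha> (i + j))"
  shows "poly_SM X \<alpha>" "poly_log_convex 3 X \<alpha>"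
proof -
  interpret nonneg_cone_idom "nonneg_polys X" by (rule nonneg_polys_cone)
  show "poly_SM X \<alpha>" unfolding poly_SM_def by (rule poly_TP_nonneg_polys[OF assms])
  show "poly_log_convex 3 X \<alpha>"
    using hankel_dets_in(1)[OF assms] TP_Hankel_imp_log_convex[OF assms]
    by (auto simp: poly_log_convex_def nonneg_polys_def)
qed


section \<open>Principal minors and positive semidefiniteness\<close>

text \<open>
Clearing the first selected column by a unitriangular row operation leaves the pivot and the Schur
complement.
\<close>

lemma minor_Schur_complement:
  fixes A :: "nat \<Rightarrow> nat \<Rightarrow> 'a::field"
  assumes a: "A (r 0) (c 0) \<noteq> 0"
  shows "minor A (Suc s) r c = A (r 0) (c 0) *
     minor (\<lambda>i j. A i j - A i (c 0) * A (r 0) j / A (r 0) (c 0)) s (r \<circ> Suc) (c \<circ> Suc)"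
proof -
  define n where "n = Suc s"
  define B where "B = Matrix.mat n n (\<lambda>(i, j). A (r i) (c j))"
  define U where "U = Matrix.mat n n (\<lambda>(i, j). if i = j then 1 else if j = 0 then - A (r i) (c 0) / A (r 0) (c 0) else 0)"
  define B' where "B' = (\<lambda>i j. if i = 0 then A (r 0) (c j)
     else A (r i) (c j) - A (r i) (c 0) * A (r 0) (c j) / A (r 0) (c 0))"
  have "det U = prod_list (diag_mat U)"
    by (rule det_lower_triangular[of n]) (auto simp: U_def)
  also have "diag_mat U = replicate n 1"
    by (auto simp: diag_mat_def U_def intro!: nth_equalityI)
  finally have detU: "det U = 1" by simp
  have "U * B = Matrix.mat n n (\<lambda>(i, j). B' i j)"
  proof (rule eq_matI)
    fix i j assume "i < dim_row (Matrix.mat n n (\<lambda>(i, j). B' i j))" "j < dim_col (Matrix.mat n n (\<lambda>(i, j). B' i j))"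
    hence ij: "i < n" "j < n" by auto
    have "(U * B) $$ (i, j) = (\<Sum>k = 0..<n. U $$ (i, k) * B $$ (k, j))"
      using ij by (simp add: U_def B_def scalar_prod_def)
    also have "\<dots> = (\<Sum>k\<in>{0, i}. U $$ (i, k) * B $$ (k, j))"
      by (rule sum.mono_neutral_right) (use ij in \<open>auto simp: U_def\<close>)
    also have "\<dots> = B' i j"
      using ij by (cases "i = 0") (auto simp: U_def B_def B'_def n_def)
    finally show "(U * B) $$ (i, j) = Matrix.mat n n (\<lambda>(i, j). B' i j) $$ (i, j)" using ij by simp
  qed (auto simp: U_def B_def)
  moreover have "det (U * B) = det U * det B"
    by (rule det_mult[of _ n]) (auto simp: U_def B_def)
  ultimately have "minor A n r c = minor B' n (\<lambda>i. i) (\<lambda>i. i)"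
    by (simp add: detU minor_def B_def)
  also have "\<dots> = B' 0 0 * minor B' s ((\<lambda>i. i) \<circ> Suc) ((\<lambda>i. i) \<circ> Suc)"
    unfolding n_def by (rule minor_col_corner) (use a in \<open>auto simp: B'_def\<close>)
  also have "minor B' s ((\<lambda>i. i) \<circ> Suc) ((\<lambda>i. i) \<circ> Suc) =
     minor (\<lambda>i j. A i j - A i (c 0) * A (r 0) j / A (r 0) (c 0)) s (r \<circ> Suc) (c \<circ> Suc)"
    by (rule minor_cong) (auto simp: B'_def)
  finally show ?thesis by (simp add: n_def B'_def)
qed

lemma double_sum_lessThan_Suc_shift:
  fixes f :: "nat \<Rightarrow> nat \<Rightarrow> real"
  shows "(\<Sum>i<Suc n. \<Sum>j<Suc n. f i j) =
    f 0 0 + (\<Sum>j<n. f 0 (Suc j)) + (\<Sum>i<n. f (Suc i) 0) + (\<Sum>i<n. \<Sum>j<n. f (Suc i) (Suc j))"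
  by (simp only: sum.lessThan_Suc_shift sum.distrib)

text \<open>
Complete the square in the first variable.  If the pivot is positive, the rest is the quadratic form
of the Schur complement, whose principal minors are those of \<open>A\<close> containing index \<open>0\<close> divided by the
pivot.  If the pivot is zero, the principal minors of size two force the whole first row to vanish.
\<close>

theorem principal_minors_nonneg_imp_psd:
  fixes A :: "nat \<Rightarrow> nat \<Rightarrow> real"
  assumes "\<And>i j. A i j = A j i"
    and "\<And>s r. strict_mono_on {..<s} r \<Longrightarrow> 0 \<le> minor A s r r"
  shows "0 \<le> (\<Sum>i<n. \<Sum>j<n. x i * x j * A i j)"
  using assms
proof (induction n arbitrary: A x)
  case (Suc n)
  note sym = Suc.prems(1) and pm = Suc.prems(2)
  define a where "a = A 0 0"
  have "strict_mono_on {..<Suc 0} (\<lambda>_. 0 :: nat)" by (auto simp: strict_mono_on_def)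
  from pm[OF this] have a: "a \<ge> 0" by (simp add: minor_1 a_def)
  have sym0: "A (Suc i) 0 = A 0 (Suc i)" for i by (rule sym)
  have step: "strict_mono_on {..<Suc s} (case_nat 0 (Suc \<circ> r))" if "strict_mono_on {..<s} r" for s r
    using that by (auto simp: strict_mono_on_def split: nat.splits)
  show ?case
  proof (cases "a = 0")
    case True
    have z: "A 0 j = 0" for j
    proof (cases j)
      case (Suc k)
      have "0 \<le> minor A (Suc (Suc 0)) (case_nat 0 (Suc \<circ> (\<lambda>_. k))) (case_nat 0 (Suc \<circ> (\<lambda>_. k)))"
        by (intro pm step) (auto simp: strict_mono_on_def)
      hence "(A 0 j)\<^sup>2 \<le> 0" using True Suc sym[of "Suc k" 0]
        by (simp add: minor_2 a_def power2_eq_square)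
      thus ?thesis by simp
    qed (use True a_def in simp)
    have "0 \<le> (\<Sum>i<n. \<Sum>j<n. x (Suc i) * x (Suc j) * A (Suc i) (Suc j))"
    proof (rule Suc.IH[of "\<lambda>i j. A (Suc i) (Suc j)" "\<lambda>i. x (Suc i)"])
      fix s and r :: "nat \<Rightarrow> nat" assume r: "strict_mono_on {..<s} r"
      have "minor (\<lambda>i j. A (Suc i) (Suc j)) s r r = minor A s (Suc \<circ> r) (Suc \<circ> r)"
        by (rule minor_cong) simp
      also have "\<dots> \<ge> 0" by (rule pm) (use r in \<open>auto simp: strict_mono_on_def\<close>)
      finally show "0 \<le> minor (\<lambda>i j. A (Suc i) (Suc j)) s r r" .
    qed (rule sym)
    thus ?thesis unfolding double_sum_lessThan_Suc_shift using z by (simp add: sym0)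
  next
    case False
    with a have a: "a > 0" by simp
    define A' where "A' = (\<lambda>i j. A (Suc i) (Suc j) - A (Suc i) 0 * A 0 (Suc j) / a)"
    define B where "B = (\<Sum>i<n. x (Suc i) * A 0 (Suc i))"
    have "0 \<le> (\<Sum>i<n. \<Sum>j<n. x (Suc i) * x (Suc j) * A' i j)"
    proof (rule Suc.IH[of A' "\<lambda>i. x (Suc i)"])
      fix i j show "A' i j = A' j i"
        unfolding A'_def using sym[of "Suc i" "Suc j"] sym[of "Suc i" 0] sym[of "Suc j" 0] by simp
    next
      fix s and r :: "nat \<Rightarrow> nat" assume r: "strict_mono_on {..<s} r"
      let ?r = "case_nat 0 (Suc \<circ> r)"
      have "0 \<le> minor A (Suc s) ?r ?r" by (intro pm step r)
      also have "\<dots> = a * minor (\<lambda>i j. A i j - A i 0 * A 0 j / a) s (?r \<circ> Suc) (?r \<circ> Suc)"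
        using a by (subst minor_Schur_complement) (auto simp: a_def)
      also have "minor (\<lambda>i j. A i j - A i 0 * A 0 j / a) s (?r \<circ> Suc) (?r \<circ> Suc) = minor A' s r r"
        by (rule minor_cong) (simp add: A'_def)
      finally show "0 \<le> minor A' s r r" using a by (simp add: zero_le_mult_iff)
    qed
    also have "(\<Sum>i<n. \<Sum>j<n. x (Suc i) * x (Suc j) * A' i j) =
       (\<Sum>i<n. \<Sum>j<n. x (Suc i) * x (Suc j) * A (Suc i) (Suc j)) - B * B / a"
    proof -
      have "B * B / a = (\<Sum>i<n. \<Sum>j<n. x (Suc i) * A 0 (Suc i) * (x (Suc j) * A 0 (Suc j)) / a)"
        unfolding B_def sum_product sum_divide_distrib ..
      also have "\<dots> = (\<Sum>i<n. \<Sum>j<n. x (Suc i) * x (Suc j) * (A (Suc i) 0 * A 0 (Suc j) / a))"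
        by (intro sum.cong refl) (simp add: sym0 mult_ac)
      finally show ?thesis
        by (simp add: A'_def right_diff_distrib sum_subtractf)
    qed
    finally have *: "0 \<le> (\<Sum>i<n. \<Sum>j<n. x (Suc i) * x (Suc j) * A (Suc i) (Suc j)) - B * B / a" .
    have "(\<Sum>i<Suc n. \<Sum>j<Suc n. x i * x j * A i j) =
       x 0 * x 0 * a + 2 * x 0 * B + (\<Sum>i<n. \<Sum>j<n. x (Suc i) * x (Suc j) * A (Suc i) (Suc j))"
      unfolding double_sum_lessThan_Suc_shift
      by (simp add: a_def B_def sym0 sum_distrib_left mult_ac)
    also have "x 0 * x 0 * a + 2 * x 0 * B = (a * x 0 + B)\<^sup>2 / a - B * B / a"
      using a by (simp add: field_simps power2_eq_square)
    finally have eq: "(\<Sum>i<Suc n. \<Sum>j<Suc n. x i * x j * A i j) =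
       (a * x 0 + B)\<^sup>2 / a - B * B / a + (\<Sum>i<n. \<Sum>j<n. x (Suc i) * x (Suc j) * A (Suc i) (Suc j))" .
    have "0 \<le> (a * x 0 + B)\<^sup>2 / a" using a by simp
    thus ?thesis unfolding eq using * by linarith
  qed
qed simp


section \<open>Positivity of the moment functional on the half-line\<close>

definition moment_functional :: "(nat \<Rightarrow> real) \<Rightarrow> real poly \<Rightarrow> real" where
  "moment_functional s p = (\<Sum>k\<le>degree p. coeff p k * s k)"

lemma moment_functional_upto:
  assumes "degree p \<le> K"
  shows "moment_functional s p = (\<Sum>k\<le>K. coeff p k * s k)"
  unfolding moment_functional_def
  by (rule sum.mono_neutral_left) (use assms in \<open>auto simp: coeff_eq_0\<close>)

lemma moment_functional_add: "moment_functional s (p + q) = moment_functional s p + moment_functional s q"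
proof -
  define K where "K = max (degree p) (degree q)"
  have "degree (p + q) \<le> K" unfolding K_def by (rule degree_add_le_max)
  thus ?thesis by (simp add: moment_functional_upto[of _ K] K_def distrib_right sum.distrib)
qed

lemma moment_functional_smult: "moment_functional s (smult r p) = r * moment_functional s p"
  by (simp add: moment_functional_upto[of _ "degree p"] degree_smult_le sum_distrib_left mult_ac)

lemma moment_functional_monom: "moment_functional s (monom r k) = r * s k"
proof (cases "r = 0")
  case False
  thus ?thesis
    by (simp add: moment_functional_def degree_monom_eq coeff_monom if_distrib[of "\<lambda>x. x * _"] cong: if_cong)
qed (simp add: moment_functional_def)

lemma moment_functional_sum: "moment_functional s (sum f I) = (\<Sum>i\<in>I. moment_functional s (f i))"
proof (induction I rule: infinite_finite_induct)
  case (insert i I)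
  thus ?case by (simp add: moment_functional_add)
qed (simp_all add: moment_functional_def)

lemma moment_functional_monom_square:
  "moment_functional s (monom 1 m * (p * p)) =
    (\<Sum>i<Suc (degree p). \<Sum>j<Suc (degree p). coeff p i * coeff p j * s (i + j + m))"
proof -
  let ?n = "Suc (degree p)"
  have p: "p = (\<Sum>i<?n. monom (coeff p i) i)"
    unfolding lessThan_Suc_atMost by (rule poly_as_sum_of_monoms[symmetric])
  have "monom 1 m * (p * p) = monom 1 m * ((\<Sum>i<?n. monom (coeff p i) i) * (\<Sum>j<?n. monom (coeff p j) j))"
    using p by simp
  also have "(\<Sum>i<?n. monom (coeff p i) i) * (\<Sum>j<?n. monom (coeff p j) j) =
      (\<Sum>i<?n. \<Sum>j<?n. monom (coeff p i * coeff p j) (i + j))"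
    by (simp only: sum_product mult_monom)
  also have "monom 1 m * \<dots> = (\<Sum>i<?n. \<Sum>j<?n. monom (coeff p i * coeff p j) (i + j + m))"
    by (simp only: sum_distrib_left mult_monom mult_1 add.commute[of m])
  finally show ?thesis by (simp only: moment_functional_sum moment_functional_monom)
qed

lemma poly_nonneg_at_right:
  fixes q :: "real poly"
  assumes "\<And>x. x > r \<Longrightarrow> poly q x \<ge> 0"
  shows "poly q r \<ge> 0"
proof (rule tendsto_lowerbound)
  show "((poly q) \<longlongrightarrow> poly q r) (at_right r)"
    by (intro tendsto_intros)
  show "\<forall>\<^sub>F x in at_right r. 0 \<le> poly q x"
    using assms by (auto simp: eventually_at_filter)
qed simp

lemma poly_attains_inf_halfline:
  fixes p :: "real poly"
  assumes nn: "\<And>x. x \<ge> 0 \<Longrightarrow> poly p x \<ge> 0"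
  obtains r where "r \<ge> 0" "\<And>x. x \<ge> 0 \<Longrightarrow> poly p r \<le> poly p x"
proof (cases "degree p = 0")
  case True
  then obtain c where "p = [:c:]" by (rule degree_eq_zeroE)
  thus ?thesis using that[of 0] by simp
next
  case False
  obtain c q where p: "p = pCons c q" by (cases p)
  with False have "q \<noteq> 0" by auto
  from poly_infinity[OF this, of "\<bar>poly p 0\<bar>" c]
  obtain R where R: "\<And>z. R \<le> norm z \<Longrightarrow> \<bar>poly p 0\<bar> \<le> norm (poly p z)" unfolding p by blast
  have "\<exists>r\<in>{0..max R 0}. \<forall>x\<in>{0..max R 0}. poly p r \<le> poly p x"
    by (rule continuous_attains_inf) (auto intro!: continuous_intros)
  then obtain r where r: "r \<ge> 0" "\<And>x. 0 \<le> x \<Longrightarrow> x \<le> max R 0 \<Longrightarrow> poly p r \<le> poly p x" by auto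
  show ?thesis
  proof (rule that[OF r(1)])
    fix x :: real assume x: "x \<ge> 0"
    show "poly p r \<le> poly p x"
    proof (cases "x \<le> max R 0")
      case False
      hence "poly p 0 \<le> poly p x" using R[of x] nn[of 0] nn[OF x] x by simp
      thus ?thesis using r(2)[of 0] by simp
    qed (use r x in auto)
  qed
qed

text \<open>
Subtract from \<open>p\<close> its minimum on the half-line, attained at \<open>r\<close> say.  The difference is \<open>q\<close> times the
variable if \<open>r = 0\<close>, and \<open>q\<close> times \<open>(x - r)\<^sup>2\<close> if \<open>r > 0\<close>, where \<open>q\<close> is again nonnegative on the half-line.
Multiplying by this factor and then applying \<open>L\<close> is a functional with the same positivity properties,
so the induction has to quantify over \<open>L\<close>.
\<close>

theorem square_positive_imp_halfline_positive:
  fixes L :: "real poly \<Rightarrow> real"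
  assumes "\<And>p q. L (p + q) = L p + L q" "\<And>r p. L (smult r p) = r * L p"
    and "\<And>p. 0 \<le> L (p * p)" "\<And>p. 0 \<le> L ([:0, 1:] * (p * p))"
    and "\<And>x. x \<ge> 0 \<Longrightarrow> poly p x \<ge> 0"
  shows "0 \<le> L p"
  using assms
proof (induction "degree p" arbitrary: p L rule: less_induct)
  case less
  note add = less.prems(1) and scale = less.prems(2) and sq = less.prems(3) and Xsq = less.prems(4)
    and nn = less.prems(5)
  have const: "0 \<le> L [:m:]" if "m \<ge> 0" for m
    using sq[of 1] scale[of m 1] that by (simp add: one_pCons)
  show ?case
  proof (cases "degree p = 0")
    case True
    then obtain m where p: "p = [:m:]" by (metis degree_eq_zeroE)
    show ?thesis using const[of m] nn[of 0] by (simp add: p)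
  next
    case False
    obtain r where r: "r \<ge> 0" "\<And>x. x \<ge> 0 \<Longrightarrow> poly p r \<le> poly p x"
      using poly_attains_inf_halfline[OF nn] by blast
    define m where "m = poly p r"
    have m: "m \<ge> 0" using nn[OF r(1)] by (simp add: m_def)
    have "poly (p - [:m:]) r = 0" by (simp add: m_def)
    then obtain q where q: "p - [:m:] = [:-r, 1:] * q"
      unfolding poly_eq_0_iff_dvd dvd_def by blast
    have deg_pm: "degree (p - [:m:]) = degree p"
      using degree_add_eq_left[of "-[:m:]" p] False unfolding diff_conv_add_uminus by simp
    have "q \<noteq> 0" using q deg_pm False by auto
    hence degq: "degree p = Suc (degree q)" using deg_pm unfolding q by (simp add: degree_mult_eq del: mult_pCons_left)
    have qx: "(x - r) * poly q x \<ge> 0" if "x \<ge> 0" for x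
    proof -
      have "(x - r) * poly q x = poly ([:-r, 1:] * q) x" by (simp add: algebra_simps)
      also have "\<dots> = poly p x - m" unfolding q[symmetric] by simp
      finally show ?thesis using r(2)[OF that] by (simp add: m_def)
    qed
    have q_right: "poly q x \<ge> 0" if "x > r" for x
      using qx[of x] that r(1) by (simp add: zero_le_mult_iff)
    have "0 \<le> L ([:-r, 1:] * q)"
    proof (cases "r = 0")
      case True
      have "0 \<le> L ([:0, 1:] * q)"
      proof (rule less.hyps[of q "\<lambda>q. L ([:0, 1:] * q)"])
        show "degree q < degree p" using degq by simp
        show "L ([:0, 1:] * (p + q)) = L ([:0, 1:] * p) + L ([:0, 1:] * q)" for p q
          by (simp only: distrib_left add)
        show "L ([:0, 1:] * smult a p) = a * L ([:0, 1:] * p)" for a p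
          by (simp only: mult_smult_right scale)
        show "0 \<le> L ([:0, 1:] * (p * p))" for p by (rule Xsq)
        show "0 \<le> L ([:0, 1:] * ([:0, 1:] * (p * p)))" for p
          using sq[of "[:0, 1:] * p"] by (simp only: mult_ac)
        show "0 \<le> poly q x" if "x \<ge> 0" for x
          using q_right[of x] poly_nonneg_at_right[of 0 q] q_right True that by (cases "x = 0") auto
      qed
      thus ?thesis using True by simp
    next
      case False
      with r(1) have r0: "r > 0" by simp
      have "poly q r \<ge> 0" by (rule poly_nonneg_at_right) (rule q_right)
      moreover have "poly q r \<le> 0"
      proof (rule tendsto_upperbound)
        show "((poly q) \<longlongrightarrow> poly q r) (at_left r)" by (intro tendsto_intros)
        have "poly q x \<le> 0" if "0 < x" "x < r" for x
          using qx[of x] that by (simp add: zero_le_mult_iff)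
        moreover have "\<forall>\<^sub>F x in at_left r. x \<in> {0<..<r}"
          by (rule eventually_at_leftI[of 0]) (use r0 in auto)
        ultimately show "\<forall>\<^sub>F x in at_left r. poly q x \<le> 0"
          by (auto elim!: eventually_mono)
      qed simp
      ultimately have "poly q r = 0" by simp
      then obtain q2 where q2: "q = [:-r, 1:] * q2"
        unfolding poly_eq_0_iff_dvd dvd_def by blast
      have "q2 \<noteq> 0" using q2 \<open>q \<noteq> 0\<close> by auto
      hence deg2: "degree q = Suc (degree q2)" unfolding q2 by (simp add: degree_mult_eq del: mult_pCons_left)
      have q2x: "poly q2 x \<ge> 0" if "x \<ge> 0" "x \<noteq> r" for x
      proof -
        have "(x - r) * poly q x = (x - r)\<^sup>2 * poly q2 x" by (simp add: q2 power2_eq_square algebra_simps)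
        thus ?thesis using qx[OF that(1)] that(2) by (simp add: zero_le_mult_iff)
      qed
      have "0 \<le> L ([:-r, 1:] * ([:-r, 1:] * q2))"
      proof (rule less.hyps[of q2 "\<lambda>q. L ([:-r, 1:] * ([:-r, 1:] * q))"])
        show "degree q2 < degree p" using degq deg2 by simp
        show "L ([:-r, 1:] * ([:-r, 1:] * (p + q))) = L ([:-r, 1:] * ([:-r, 1:] * p)) + L ([:-r, 1:] * ([:-r, 1:] * q))" for p q
          by (simp only: distrib_left add)
        show "L ([:-r, 1:] * ([:-r, 1:] * smult a p)) = a * L ([:-r, 1:] * ([:-r, 1:] * p))" for a p
          by (simp only: mult_smult_right scale)
        show "0 \<le> L ([:-r, 1:] * ([:-r, 1:] * (p * p)))" for p
          using sq[of "[:-r, 1:] * p"] by (simp only: mult_ac)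
        show "0 \<le> L ([:-r, 1:] * ([:-r, 1:] * ([:0, 1:] * (p * p))))" for p
          using Xsq[of "[:-r, 1:] * p"] by (simp only: mult_ac)
        show "0 \<le> poly q2 x" if "x \<ge> 0" for x
          using q2x[OF that] poly_nonneg_at_right[of r q2] q2x r0 by (cases "x = r") auto
      qed
      thus ?thesis by (simp only: q2)
    qed
    moreover have "L p = L [:m:] + L ([:-r, 1:] * q)"
      by (subst add[symmetric]) (simp only: q[symmetric], simp)
    ultimately show ?thesis using const[OF m] by simp
  qed
qed


section \<open>From a positive functional to a measure\<close>

text \<open>
The one-step extension argument of M. Riesz, iterated.  The extended functional is represented by its
values \<open>w i\<close> on the functions \<open>e i\<close>, and the only thing remembered about it is that combinations which
are nonnegative on the half-line get nonnegative values.  A new value \<open>w n\<close> is admissible if it is the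
infimum of the values of the combinations that dominate \<open>e n\<close>.
\<close>

lemma countable_positive_extension:
  fixes L :: "real poly \<Rightarrow> real" and e :: "nat \<Rightarrow> real \<Rightarrow> real"
  assumes add: "\<And>p q. L (p + q) = L p + L q" and scale: "\<And>r p. L (smult r p) = r * L p"
    and pos: "\<And>p. (\<And>x. x \<ge> 0 \<Longrightarrow> poly p x \<ge> 0) \<Longrightarrow> 0 \<le> L p"
    and e01: "\<And>n x. 0 \<le> e n x \<and> e n x \<le> 1"
  obtains w :: "nat \<Rightarrow> real" where
    "\<And>n p a. (\<And>x. x \<ge> 0 \<Longrightarrow> 0 \<le> poly p x + (\<Sum>i<n. a i * e i x)) \<Longrightarrow> 0 \<le> L p + (\<Sum>i<n. a i * w i)"
proof -
  define Q where "Q = (\<lambda>n (g :: nat \<Rightarrow> real). \<forall>p a. (\<forall>x\<ge>0. 0 \<le> poly p x + (\<Sum>i<n. a i * e i x))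
     \<longrightarrow> 0 \<le> L p + (\<Sum>i<n. a i * g i))"
  have step: "\<exists>c. Q (Suc n) (g(n := c))" if Q: "Q n g" for n g
  proof -
    define S where "S = {L p + (\<Sum>i<n. a i * g i) | p a. \<forall>x\<ge>0. e n x \<le> poly p x + (\<Sum>i<n. a i * e i x)}"
    have S_nonneg: "0 \<le> y" if "y \<in> S" for y
    proof -
      from that obtain p a where y: "y = L p + (\<Sum>i<n. a i * g i)"
        and "\<forall>x\<ge>0. e n x \<le> poly p x + (\<Sum>i<n. a i * e i x)" unfolding S_def by blast
      hence "\<forall>x\<ge>0. 0 \<le> poly p x + (\<Sum>i<n. a i * e i x)" using e01[of n] by (meson order_trans)
      thus ?thesis using Q unfolding Q_def y by blast
    qed
    have "L 1 + (\<Sum>i<n. 0 * g i) \<in> S"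
      unfolding S_def by (rule CollectI, rule exI[of _ 1], rule exI[of _ "\<lambda>_. 0"]) (use e01 in simp)
    hence ne: "S \<noteq> {}" by blast
    have bdd: "bdd_below S" using S_nonneg by (auto simp: bdd_below_def)
    define c where "c = Inf S"
    have "Q (Suc n) (g(n := c))"
      unfolding Q_def
    proof (intro allI impI)
      fix p a assume "\<forall>x\<ge>0. 0 \<le> poly p x + (\<Sum>i<Suc n. a i * e i x)"
      hence nn: "0 \<le> poly p x + (\<Sum>i<n. a i * e i x) + a n * e n x" if "x \<ge> 0" for x
        using that by (simp add: add.assoc)
      define A where "A = L p + (\<Sum>i<n. a i * g i)"
      have "0 \<le> A + a n * c"
      proof (cases "a n" "0 :: real" rule: linorder_cases)
        case equal
        thus ?thesis using nn Q by (simp add: Q_def A_def)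
      next
        case less
        \<comment> \<open>rescaled so that the combination dominates the new function\<close>
        define t where "t = - 1 / a n"
        have t: "t > 0" "t * a n = -1" using less by (auto simp: t_def field_simps)
        have "L (smult t p) + (\<Sum>i<n. (t * a i) * g i) \<in> S"
          unfolding S_def
        proof (rule CollectI, rule exI[of _ "smult t p"], rule exI[of _ "\<lambda>i. t * a i"], intro conjI refl allI impI)
          fix x :: real assume "x \<ge> 0"
          hence "0 \<le> t * (poly p x + (\<Sum>i<n. a i * e i x) + a n * e n x)" using nn t by simp
          also have "\<dots> = t * poly p x + t * (\<Sum>i<n. a i * e i x) + (t * a n) * e n x"
            by (simp add: algebra_simps)
          finally show "e n x \<le> poly (smult t p) x + (\<Sum>i<n. t * a i * e i x)"
            using t(2) by (simp add: sum_distrib_left mult.assoc)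
        qed
        hence "c \<le> L (smult t p) + (\<Sum>i<n. (t * a i) * g i)"
          unfolding c_def by (rule cInf_lower[OF _ bdd])
        hence "c \<le> t * A" by (simp add: scale A_def sum_distrib_left distrib_left mult.assoc)
        hence "- a n * c \<le> - a n * (t * A)" using less by (intro mult_left_mono) auto
        also have "\<dots> = A" using t(2) by (metis minus_mult_left mult.assoc mult.commute mult_1 minus_minus)
        finally show ?thesis by simp
      next
        case greater
        define t where "t = 1 / a n"
        have t: "t > 0" "t * a n = 1" using greater by (auto simp: t_def field_simps)
        have "- (t * A) \<le> c"
          unfolding c_def
        proof (rule cInf_greatest[OF ne])
          fix y assume "y \<in> S"
          then obtain p' a' where y: "y = L p' + (\<Sum>i<n. a' i * g i)"
            and le: "\<forall>x\<ge>0. e n x \<le> poly p' x + (\<Sum>i<n. a' i * e i x)" unfolding S_def by blast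
          have "0 \<le> L (p' + smult t p) + (\<Sum>i<n. (a' i + t * a i) * g i)"
          proof (rule Q[unfolded Q_def, rule_format])
            fix x :: real assume x: "x \<ge> 0"
            have "0 \<le> t * (poly p x + (\<Sum>i<n. a i * e i x) + a n * e n x)" using nn[OF x] t by simp
            also have "\<dots> = t * poly p x + t * (\<Sum>i<n. a i * e i x) + (t * a n) * e n x"
              by (simp add: algebra_simps)
            finally show "0 \<le> poly (p' + smult t p) x + (\<Sum>i<n. (a' i + t * a i) * e i x)"
              using t(2) le[rule_format, OF x] by (simp add: sum_distrib_left distrib_right sum.distrib mult.assoc)
          qed
          also have "\<dots> = y + t * A"
            by (simp add: y A_def add scale sum_distrib_left distrib_left distrib_right sum.distrib mult.assoc)
          finally show "- (t * A) \<le> y" by simp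
        qed
        hence "a n * (- (t * A)) \<le> a n * c" using greater by (intro mult_left_mono) auto
        moreover have "a n * (- (t * A)) = - A" using t(2) by (metis mult.assoc mult.commute mult_1 mult_minus_right)
        ultimately show ?thesis by linarith
      qed
      thus "0 \<le> L p + (\<Sum>i<Suc n. a i * (g(n := c)) i)" by (simp add: A_def add.assoc)
    qed
    thus ?thesis by blast
  qed
  have "\<exists>G. \<forall>n. Q n (G n) \<and> (\<exists>c. G (Suc n) = (G n)(n := c))"
  proof (rule dependent_nat_choice)
    show "\<exists>g. Q 0 g" using pos by (auto simp: Q_def)
    show "\<exists>h. Q (Suc n) h \<and> (\<exists>c. h = g(n := c))" if "Q n g" for g n
      using step[OF that] by blast
  qed
  then obtain G where G: "\<And>n. Q n (G n)" "\<And>n. \<exists>c. G (Suc n) = (G n)(n := c)" by blast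
  define w where "w = (\<lambda>i. G (Suc i) i)"
  have Gw: "G n i = w i" if "i < n" for n i
    using that
  proof (induction n)
    case (Suc n)
    show ?case
    proof (cases "i = n")
      case False
      obtain c where "G (Suc n) = (G n)(n := c)" using G(2) by blast
      thus ?thesis using False Suc by simp
    qed (simp add: w_def)
  qed simp
  show ?thesis
  proof (rule that)
    fix n p a assume nn: "\<And>x. x \<ge> 0 \<Longrightarrow> 0 \<le> poly p x + (\<Sum>i<n. a i * e i x)"
    have "0 \<le> L p + (\<Sum>i<n. a i * G n i)" using G(1)[of n] nn unfolding Q_def by blast
    thus "0 \<le> L p + (\<Sum>i<n. a i * w i)" by (simp add: Gw)
  qed
qed

text \<open>
The previous lemma for the indicators of rational half-lines, enumerated in any way.  The points \<open>t i\<close>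
may repeat, which lets equidistant sums be fed in directly.
\<close>

lemma rational_tail_extension:
  fixes L :: "real poly \<Rightarrow> real"
  assumes add: "\<And>p q. L (p + q) = L p + L q" and scale: "\<And>r p. L (smult r p) = r * L p"
    and pos: "\<And>p. (\<And>x. x \<ge> 0 \<Longrightarrow> poly p x \<ge> 0) \<Longrightarrow> 0 \<le> L p"
  obtains w :: "real \<Rightarrow> real" where
    "\<And>(n::nat) t p a. (\<And>i. i < n \<Longrightarrow> t i \<in> \<rat>) \<Longrightarrow>
       (\<And>x. x \<ge> 0 \<Longrightarrow> 0 \<le> poly p x + (\<Sum>i<n. a i * indicator {t i<..} x)) \<Longrightarrow>
       0 \<le> L p + (\<Sum>i<n. a i * w (t i))"
proof -
  let ?e = "\<lambda>n x. indicator {from_nat_into \<rat> n<..} x :: real"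
  obtain v where v: "\<And>n p a. (\<And>x. x \<ge> 0 \<Longrightarrow> 0 \<le> poly p x + (\<Sum>i<n. a i * ?e i x)) \<Longrightarrow>
      0 \<le> L p + (\<Sum>i<n. a i * v i)"
    by (rule countable_positive_extension[of L ?e, OF add scale pos]) (auto simp: indicator_def)
  show ?thesis
  proof (rule that[of "\<lambda>q. v (to_nat_on \<rat> q)"])
    fix n :: nat and t p a
    assume t: "\<And>i. i < n \<Longrightarrow> t i \<in> (\<rat> :: real set)"
      and nn: "\<And>x. x \<ge> 0 \<Longrightarrow> 0 \<le> poly p x + (\<Sum>i<n. a i * indicator {t i<..} x)"
    define \<tau> where "\<tau> = (\<lambda>i. to_nat_on \<rat> (t i))"
    obtain K where K: "\<And>i. i < n \<Longrightarrow> \<tau> i < K"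
      using finite_nat_set_iff_bounded[of "\<tau> ` {..<n}"] by auto
    define b where "b = (\<lambda>j. \<Sum>i | i \<in> {..<n} \<and> \<tau> i = j. a i)"
    have regroup: "(\<Sum>i<n. a i * f (\<tau> i)) = (\<Sum>j<K. b j * f j)" for f :: "nat \<Rightarrow> real"
    proof -
      have "(\<Sum>j<K. b j * f j) = (\<Sum>j<K. \<Sum>i | i \<in> {..<n} \<and> \<tau> i = j. a i * f (\<tau> i))"
        unfolding b_def sum_distrib_right by (intro sum.cong) auto
      also have "\<dots> = (\<Sum>i<n. a i * f (\<tau> i))"
        by (rule sum.group) (use K in auto)
      finally show ?thesis ..
    qed
    have e: "?e (\<tau> i) x = indicator {t i<..} x" if "i < n" for i x
      using t[OF that] by (simp add: \<tau>_def countable_rat)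
    have "0 \<le> L p + (\<Sum>j<K. b j * v j)"
    proof (rule v)
      fix x :: real assume x: "x \<ge> 0"
      have "(\<Sum>j<K. b j * ?e j x) = (\<Sum>i<n. a i * indicator {t i<..} x)"
        unfolding regroup[symmetric] by (intro sum.cong) (simp_all add: e)
      thus "0 \<le> poly p x + (\<Sum>j<K. b j * ?e j x)" using nn[OF x] by simp
    qed
    thus "0 \<le> L p + (\<Sum>i<n. a i * v (to_nat_on \<rat> (t i)))"
      using regroup[of v] by (simp add: \<tau>_def)
  qed
qed

text \<open>
The values \<open>w q\<close> need not be right-continuous, so the tail of the measure is the supremum of \<open>w\<close> to the
right; it is squeezed between values of \<open>w\<close> at neighbouring rationals, which is all that is needed to
compute moments.
\<close>

lemma tail_function_measure:
  fixes w :: "real \<Rightarrow> real" and S :: real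
  assumes anti: "\<And>q q'. q \<in> \<rat> \<Longrightarrow> q' \<in> \<rat> \<Longrightarrow> q \<le> q' \<Longrightarrow> w q' \<le> w q"
    and bounds: "\<And>q. q \<in> \<rat> \<Longrightarrow> 0 \<le> w q \<and> w q \<le> S"
    and neg: "\<And>q. q \<in> \<rat> \<Longrightarrow> q < 0 \<Longrightarrow> w q = S"
    and lim: "\<And>\<epsilon>. \<epsilon> > 0 \<Longrightarrow> \<exists>q\<in>\<rat>. w q < \<epsilon>"
  obtains M :: "real measure" where "sets M = sets borel" "finite_measure M" "measure M UNIV = S"
    "AE x in M. 0 \<le> x" "\<And>q. q \<in> \<rat> \<Longrightarrow> measure M {q<..} \<le> w q"
    "\<And>q q'. q' \<in> \<rat> \<Longrightarrow> q < q' \<Longrightarrow> w q' \<le> measure M {q<..}"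
proof -
  define H where "H = (\<lambda>x. Sup (w ` {q \<in> \<rat>. x < q}))"
  have ne: "w ` {q \<in> \<rat>. x < q} \<noteq> {}" for x
    using Rats_dense_in_real[of x "x + 1"] by auto
  have bdd: "bdd_above (w ` {q \<in> \<rat>. x < q})" for x
    using bounds by (auto simp: bdd_above_def)
  have wH: "w q \<le> H x" if "q \<in> \<rat>" "x < q" for q x
    unfolding H_def by (rule cSup_upper[OF _ bdd]) (use that in auto)
  have H_anti: "H y \<le> H x" if "x \<le> y" for x y
    unfolding H_def by (rule cSup_subset_mono[OF ne bdd]) (use that in auto)
  have H_le: "H x \<le> b" if "\<And>q. q \<in> \<rat> \<Longrightarrow> x < q \<Longrightarrow> w q \<le> b" for x b
    unfolding H_def by (rule cSup_least[OF ne]) (use that in auto)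
  have H_nonneg: "0 \<le> H x" for x
  proof -
    obtain q where "q \<in> \<rat>" "x < q" using Rats_dense_in_real[of x "x + 1"] by auto
    thus ?thesis using wH[of q x] bounds[of q] by linarith
  qed
  have H_S: "H x \<le> S" for x by (rule H_le) (use bounds in auto)
  have H_neg: "H x = S" if "x < 0" for x
  proof (rule antisym[OF H_S])
    obtain q where "q \<in> \<rat>" "x < q" "q < 0" using Rats_dense_in_real[OF \<open>x < 0\<close>] by auto
    thus "S \<le> H x" using wH[of q x] neg[of q] by simp
  qed
  have H_lim: "(H \<longlongrightarrow> 0) at_top"
  proof (rule order_tendstoI)
    fix a :: real assume "a < 0"
    thus "\<forall>\<^sub>F x in at_top. a < H x" using H_nonneg by (intro always_eventually) (auto intro: less_le_trans)
  next
    fix a :: real assume "0 < a"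
    then obtain q where q: "q \<in> \<rat>" "w q < a" using lim by blast
    have "H x < a" if "q \<le> x" for x
      using H_le[of x "w q"] anti[OF q(1)] q(2) that by fastforce
    thus "\<forall>\<^sub>F x in at_top. H x < a" by (auto simp: eventually_at_top_linorder)
  qed
  define F where "F = (\<lambda>x. S - H x)"
  have mono: "F x \<le> F y" if "x \<le> y" for x y using H_anti[OF that] by (simp add: F_def)
  have cont: "continuous (at_right a) F" for a
    unfolding continuous_within
  proof (rule order_tendstoI)
    fix y assume "y < F a"
    thus "\<forall>\<^sub>F x in at_right a. y < F x"
      using mono by (auto simp: eventually_at_filter intro!: always_eventually intro: less_le_trans)
  next
    fix y assume y: "F a < y"
    hence "S - y < H a" by (simp add: F_def)
    then obtain q where q: "q \<in> \<rat>" "a < q" "S - y < w q"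
      unfolding H_def by (subst (asm) less_cSup_iff[OF ne bdd]) auto
    have "F x < y" if "x < q" for x using wH[OF q(1) that] q(3) by (simp add: F_def)
    thus "\<forall>\<^sub>F x in at_right a. F x < y"
      using q(2) by (intro eventually_at_rightI[of a q]) auto
  qed
  define M where "M = interval_measure F"
  have Ioc: "emeasure M {x<..y} = ennreal (F y - F x)" if "x \<le> y" for x y
    unfolding M_def by (rule emeasure_interval_measure_Ioc[OF that mono cont])
  have sets: "sets M = sets borel" by (simp add: M_def)
  have tail: "emeasure M {x<..} = ennreal (H x)" for x
  proof -
    have "(\<lambda>n. emeasure M {x<..x + real n}) \<longlonglongrightarrow> emeasure M (\<Union>n. {x<..x + real n})"
      by (rule Lim_emeasure_incseq) (auto simp: sets incseq_def)
    moreover have "(\<Union>n. {x<..x + real n}) = {x<..}"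
    proof safe
      fix y assume "x < y"
      obtain n where "y - x \<le> real n" using real_arch_simple by blast
      thus "y \<in> (\<Union>n. {x<..x + real n})" using \<open>x < y\<close> by (auto intro!: exI[of _ n])
    qed auto
    moreover have "(\<lambda>n. emeasure M {x<..x + real n}) \<longlonglongrightarrow> ennreal (H x)"
    proof -
      have "filterlim (\<lambda>n. x + real n) at_top sequentially"
        by (rule filterlim_tendsto_add_at_top[OF tendsto_const filterlim_real_sequentially])
      hence "(\<lambda>n. H (x + real n)) \<longlonglongrightarrow> 0" by (rule filterlim_compose[OF H_lim])
      hence "(\<lambda>n. H x - H (x + real n)) \<longlonglongrightarrow> H x - 0" by (intro tendsto_intros)
      hence "(\<lambda>n. ennreal (H x - H (x + real n))) \<longlonglongrightarrow> ennreal (H x)" by (simp add: tendsto_ennrealI)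
      thus ?thesis by (simp add: Ioc F_def)
    qed
    ultimately show ?thesis using LIMSEQ_unique by metis
  qed
  have UNIV: "emeasure M UNIV = ennreal S"
  proof -
    have "(\<lambda>n. emeasure M {- real (Suc n)<..}) \<longlonglongrightarrow> emeasure M (\<Union>n. {- real (Suc n)<..})"
      by (rule Lim_emeasure_incseq) (auto simp: sets incseq_def)
    moreover have "(\<Union>n. {- real (Suc n)<..}) = UNIV"
    proof (rule UNIV_eq_I[symmetric])
      fix y :: real
      obtain n where "- y < real n" using reals_Archimedean2 by blast
      hence "y \<in> {- real (Suc n)<..}" by simp
      thus "y \<in> (\<Union>n. {- real (Suc n)<..})" by blast
    qed
    moreover have "emeasure M {- real (Suc n)<..} = ennreal S" for n
      by (subst tail, subst H_neg) simp_all
    ultimately have "(\<lambda>n::nat. ennreal S) \<longlonglongrightarrow> emeasure M UNIV" by simp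
    thus ?thesis using LIMSEQ_unique[OF tendsto_const] by metis
  qed
  have space: "space M = UNIV" using sets_eq_imp_space_eq[OF sets] by simp
  have fin: "finite_measure M" by (rule finite_measureI) (simp add: space UNIV)
  interpret finite_measure M by (rule fin)
  have S0: "0 \<le> S" using H_nonneg H_S order_trans by blast
  have mtail: "measure M {x<..} = H x" for x
    using tail[of x] H_nonneg by (simp add: emeasure_eq_measure)
  have mUNIV: "measure M UNIV = S" using UNIV S0 by (simp add: emeasure_eq_measure)
  have "AE x in M. - 1 / real (Suc n) < x" for n
  proof -
    have "measure M (space M - {- 1 / real (Suc n)<..}) = measure M (space M) - measure M {- 1 / real (Suc n)<..}"
      by (rule finite_measure_compl) (simp add: sets)
    also have "\<dots> = 0" unfolding mtail space mUNIV by (subst H_neg) auto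
    finally have "emeasure M (space M - {- 1 / real (Suc n)<..}) = 0" by (simp add: emeasure_eq_measure)
    thus ?thesis
      by (intro AE_I[where N = "space M - {- 1 / real (Suc n)<..}"]) (auto simp: sets space)
  qed
  hence "AE x in M. \<forall>n. - 1 / real (Suc n) < x" by (simp add: AE_all_countable)
  hence nonneg: "AE x in M. 0 \<le> x"
  proof (rule AE_mp, intro AE_I2 impI)
    fix x assume x: "\<forall>n. - 1 / real (Suc n) < x"
    show "0 \<le> x"
    proof (rule ccontr)
      assume "\<not> 0 \<le> x"
      then obtain n where "inverse (real (Suc n)) < - x" using reals_Archimedean[of "- x"] by auto
      thus False using x[rule_format, of n] by (simp add: field_simps)
    qed
  qed
  show ?thesis
  proof (rule that[OF sets fin mUNIV nonneg])
    show "measure M {q<..} \<le> w q" if "q \<in> \<rat>" for q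
      unfolding mtail by (rule H_le) (use anti that in auto)
    show "w q' \<le> measure M {q<..}" if "q' \<in> \<rat>" "q < q'" for q q'
      unfolding mtail by (rule wH[OF that])
  qed
qed

text \<open>
Lower and upper step functions for the truncated power.  The term \<open>0 ^ k\<close> makes the statement uniform:
it is \<open>1\<close> for \<open>k = 0\<close>, where all increments vanish.
\<close>

lemma power_step_bounds:
  fixes pt :: "nat \<Rightarrow> real" and x :: real
  assumes pt0: "pt 0 = 0" and pt_mono: "\<And>i. pt i \<le> pt (Suc i)" and x: "x \<ge> 0"
  shows "0 ^ k + (\<Sum>i<M. (pt (Suc i) ^ k - pt i ^ k) * indicator {pt (Suc i)<..} x) \<le> (min x (pt M)) ^ k"
      (is ?lo)
    and "(min x (pt M)) ^ k \<le> 0 ^ k + (\<Sum>i<M. (pt (Suc i) ^ k - pt i ^ k) * indicator {pt i<..} x)"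
      (is ?up)
proof -
  have nn: "0 \<le> pt i" for i
    by (induction i) (use pt0 pt_mono order_trans in \<open>auto intro: order_trans\<close>)
  note pt = nn pt_mono
  show ?lo
  proof (induction M)
    case 0
    show ?case using x by (simp add: pt0)
  next
    case (Suc M)
    show ?case
    proof (cases "pt (Suc M) < x")
      case True
      hence "min x (pt M) = pt M" "min x (pt (Suc M)) = pt (Suc M)" using pt(2)[of M] by auto
      thus ?thesis using Suc True by simp
    next
      case False
      have "(min x (pt M)) ^ k \<le> (min x (pt (Suc M))) ^ k"
        using pt[of M] x by (intro power_mono) auto
      thus ?thesis using Suc False by simp
    qed
  qed
  show ?up
  proof (induction M)
    case 0
    show ?case using x by (simp add: pt0)
  next
    case (Suc M)
    show ?case
    proof (cases "pt M < x")
      case True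
      hence "min x (pt M) = pt M" by simp
      moreover have "(min x (pt (Suc M))) ^ k \<le> pt (Suc M) ^ k"
        using pt[of "Suc M"] x by (intro power_mono) auto
      ultimately show ?thesis using Suc True by simp
    next
      case False
      hence "min x (pt M) = x" "min x (pt (Suc M)) = x" using pt(2)[of M] by auto
      thus ?thesis using Suc False by simp
    qed
  qed
qed

lemma power_small_steps:
  fixes \<epsilon> :: real and k R :: nat
  assumes "\<epsilon> > 0"
  obtains N where "N > 0" "\<And>i. i < R * N \<Longrightarrow> (real (Suc i) / real N) ^ k - (real i / real N) ^ k \<le> \<epsilon>"
proof -
  have "uniformly_continuous_on {0..real R} (\<lambda>x. x ^ k)"
    by (rule compact_uniformly_continuous) (auto intro!: continuous_intros)
  then obtain \<delta> where \<delta>: "\<delta> > 0"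
    "\<And>x y. x \<in> {0..real R} \<Longrightarrow> y \<in> {0..real R} \<Longrightarrow> dist y x < \<delta> \<Longrightarrow> dist (y ^ k) (x ^ k) < \<epsilon>"
    using assms unfolding uniformly_continuous_on_def by meson
  obtain n where n: "inverse (real (Suc n)) < \<delta>" using reals_Archimedean[OF \<delta>(1)] by blast
  show ?thesis
  proof (rule that[of "Suc n"])
    fix i assume "i < R * Suc n"
    hence "Suc i \<le> R * Suc n" by simp
    hence "real (Suc i) \<le> real R * real (Suc n)" by (metis of_nat_le_iff of_nat_mult)
    hence le: "real (Suc i) / real (Suc n) \<le> real R" by (simp add: pos_divide_le_eq del: of_nat_Suc)
    have eq: "real (Suc i) / real (Suc n) - real i / real (Suc n) = inverse (real (Suc n))"
      by (simp add: field_simps)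
    have pos: "0 < inverse (real (Suc n))" by simp
    have "0 \<le> real i / real (Suc n)" by simp
    moreover from this have "real i / real (Suc n) \<le> real R" "0 \<le> real (Suc i) / real (Suc n)"
      using eq pos le by linarith+
    ultimately have "real i / real (Suc n) \<in> {0..real R}" "real (Suc i) / real (Suc n) \<in> {0..real R}"
      using le by (auto simp del: of_nat_Suc)
    moreover have "dist (real (Suc i) / real (Suc n)) (real i / real (Suc n)) < \<delta>"
      unfolding dist_real_def eq using n pos by linarith
    ultimately have "dist ((real (Suc i) / real (Suc n)) ^ k) ((real i / real (Suc n)) ^ k) < \<epsilon>"
      by (intro \<delta>(2))
    thus "(real (Suc i) / real (Suc n)) ^ k - (real i / real (Suc n)) ^ k \<le> \<epsilon>"
      by (simp add: dist_real_def)
  qed simp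
qed

text \<open>
Both the extended functional and the measure satisfy the step-function bounds for the powers.  The
tails of the measure lie between consecutive values of \<open>w\<close>, so the two sets of bounds differ by
telescoping sums that are small for fine partitions.  Truncation at \<open>R\<close> costs at most
\<open>s\<^sub>k\<^sub>+\<^sub>1 / R\<close> because \<open>x\<^sup>k \<le> min(x, R)\<^sup>k + x\<^sup>k\<^sup>+\<^sup>1 / R\<close>.
\<close>

theorem positive_functional_representation:
  fixes L :: "real poly \<Rightarrow> real"
  assumes add: "\<And>p q. L (p + q) = L p + L q" and scale: "\<And>r p. L (smult r p) = r * L p"
    and pos: "\<And>p. (\<And>x. x \<ge> 0 \<Longrightarrow> poly p x \<ge> 0) \<Longrightarrow> 0 \<le> L p"
  shows "stieltjes_moment (\<lambda>k. L (monom 1 k))"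
proof -
  obtain w where w: "\<And>(n::nat) t p a. (\<And>i. i < n \<Longrightarrow> t i \<in> \<rat>) \<Longrightarrow>
       (\<And>x. x \<ge> 0 \<Longrightarrow> 0 \<le> poly p x + (\<Sum>i<n. a i * indicator {t i<..} x)) \<Longrightarrow>
       0 \<le> L p + (\<Sum>i<n. a i * w (t i))"
    using rational_tail_extension[of L, OF add scale pos] by blast
  define s where "s = (\<lambda>k. L (monom 1 k))"
  define S where "S = L 1"
  have const: "L [:r:] = r * S" for r using scale[of r 1] by (simp add: S_def one_pCons)
  have L0: "L 0 = 0" using scale[of 0 0] by simp
  have minus: "L (- p) = - L p" for p using scale[of "-1" p] by simp
  have w_nonneg: "0 \<le> w q" if "q \<in> \<rat>" for q
    using w[of "Suc 0" "\<lambda>_. q" 0 "\<lambda>_. 1"] that by (simp add: L0)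
  have w_le: "w q \<le> S" if "q \<in> \<rat>" for q
    using w[of "Suc 0" "\<lambda>_. q" 1 "\<lambda>_. -1"] that by (simp add: S_def indicator_def)
  have w_anti: "w q' \<le> w q" if "q \<in> \<rat>" "q' \<in> \<rat>" "q \<le> q'" for q q'
    using w[of "Suc (Suc 0)" "\<lambda>i. if i = 0 then q else q'" 0 "\<lambda>i. if i = 0 then 1 else -1"] that
    by (simp add: L0 indicator_def)
  have w_neg: "w q = S" if "q \<in> \<rat>" "q < 0" for q
  proof (rule antisym[OF w_le[OF that(1)]])
    have "0 \<le> L (- 1) + (\<Sum>i<Suc 0. 1 * w q)"
      by (rule w[of "Suc 0" "\<lambda>_. q"]) (use that in \<open>auto simp: indicator_def\<close>)
    thus "S \<le> w q" by (simp add: minus S_def)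
  qed
  have w_lim: "\<exists>q\<in>\<rat>. w q < \<epsilon>" if "\<epsilon> > 0" for \<epsilon>
  proof -
    obtain n where n: "s 1 / \<epsilon> < real n" using reals_Archimedean2 by blast
    define q where "q = real (Suc n)"
    have q: "q > 0" "s 1 / \<epsilon> < q" using n by (auto simp: q_def)
    have "0 \<le> L (monom 1 1) + (\<Sum>i<Suc 0. (- q) * w q)"
    proof (rule w)
      fix x :: real assume "0 \<le> x"
      thus "0 \<le> poly (monom 1 1) x + (\<Sum>i<Suc 0. (- q) * indicator {q<..} x)"
        by (auto simp: poly_monom indicator_def)
    qed (simp add: q_def)
    hence "q * w q \<le> s 1" by (simp add: s_def)
    also have "s 1 < q * \<epsilon>" using q that by (simp add: pos_divide_less_eq)
    finally have "w q < \<epsilon>" using q by simp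
    thus ?thesis by (intro bexI[of _ q]) (auto simp: q_def)
  qed
  obtain M :: "real measure" where M: "sets M = sets borel" "finite_measure M" "measure M UNIV = S"
    and nonneg: "AE x in M. 0 \<le> x" and tail_le: "\<And>q. q \<in> \<rat> \<Longrightarrow> measure M {q<..} \<le> w q"
    and tail_ge: "\<And>q q'. q' \<in> \<rat> \<Longrightarrow> q < q' \<Longrightarrow> w q' \<le> measure M {q<..}"
    by (rule tail_function_measure[of w S]) (use w_nonneg w_le w_anti w_neg w_lim in blast)+
  interpret finite_measure M by (rule M(2))
  note [measurable_cong] = M(1)
  have space: "space M = UNIV" using sets_eq_imp_space_eq[OF M(1)] by simp
  have S0: "0 \<le> S" using M(3) measure_nonneg[of M UNIV] by simp
  have s_nonneg: "0 \<le> s k" for k unfolding s_def by (rule pos) (simp add: poly_monom)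
  define f where "f = (\<lambda>k (R :: nat) x :: real. (min (max x 0) (real R)) ^ k)"
  have f_bounds: "0 \<le> f k R x" "f k R x \<le> real R ^ k" for k R x
    unfolding f_def by (auto intro!: power_mono)
  have f_meas [measurable]: "f k R \<in> borel_measurable M" for k R unfolding f_def by measurable
  have f_int: "integrable M (f k R)" for k R
    by (rule integrable_const_bound[of _ "real R ^ k"]) (use f_bounds in auto)
  have ind_int: "integrable M (indicator {y<..} :: real \<Rightarrow> real)" for y
    by (rule integrable_real_indicator) (simp_all add: M(1) emeasure_eq_measure)
  have step_int: "integrable M (\<lambda>x. c + (\<Sum>i<n. a i * indicator {t i<..} x))"
    and step_eq: "(\<integral>x. c + (\<Sum>i<n. a i * indicator {t i<..} x) \<partial>M) = c * S + (\<Sum>i<n. a i * measure M {t i<..})"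
    for c n and a t :: "nat \<Rightarrow> real"
  proof -
    have int: "integrable M (\<lambda>x. \<Sum>i<n. a i * indicator {t i<..} x)"
      by (intro Bochner_Integration.integrable_sum integrable_mult_right ind_int)
    show "integrable M (\<lambda>x. c + (\<Sum>i<n. a i * indicator {t i<..} x))"
      by (intro Bochner_Integration.integrable_add integrable_const int)
    have "(\<integral>x. c + (\<Sum>i<n. a i * indicator {t i<..} x) \<partial>M) =
        (\<integral>x. c \<partial>M) + (\<integral>x. (\<Sum>i<n. a i * indicator {t i<..} x) \<partial>M)"
      by (rule Bochner_Integration.integral_add[OF integrable_const int])
    also have "(\<integral>x. (\<Sum>i<n. a i * indicator {t i<..} x) \<partial>M) = (\<Sum>i<n. \<integral>x. a i * indicator {t i<..} x \<partial>M)"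
      by (intro Bochner_Integration.integral_sum integrable_mult_right ind_int)
    also have "(\<integral>x. c \<partial>M) = c * S" using M(3) by (simp add: space)
    finally show "(\<integral>x. c + (\<Sum>i<n. a i * indicator {t i<..} x) \<partial>M) = c * S + (\<Sum>i<n. a i * measure M {t i<..})"
      by (simp add: space)
  qed
  have approx: "(\<integral>x. f k R x \<partial>M) \<le> s k + \<epsilon> * S" "s k - s (Suc k) / real R \<le> (\<integral>x. f k R x \<partial>M) + 2 * (\<epsilon> * S)"
    if R: "R > 0" and \<epsilon>: "\<epsilon> > 0" for k R \<epsilon>
  proof -
    obtain N where N: "N > 0" "\<And>i. i < R * N \<Longrightarrow> (real (Suc i) / real N) ^ k - (real i / real N) ^ k \<le> \<epsilon>"
      using power_small_steps[OF \<epsilon>, of R k] by blast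
    define pt where "pt = (\<lambda>i. real i / real N)"
    define dp where "dp = (\<lambda>i. pt (Suc i) ^ k - pt i ^ k)"
    have dp_eq: "dp i = pt (Suc i) ^ k - pt i ^ k" for i by (simp add: dp_def)
    define m where "m = R * N"
    have pt_rat: "pt i \<in> \<rat>" for i by (simp add: pt_def)
    have pt_less: "pt i < pt (Suc i)" for i using N(1) by (simp add: pt_def divide_strict_right_mono)
    have pt_m: "pt m = real R" using N(1) by (simp add: pt_def m_def)
    have dp: "0 \<le> dp i" for i
      using power_mono[OF less_imp_le[OF pt_less[of i]], of k] by (simp add: dp_def pt_def)
    have dp_le: "dp i \<le> \<epsilon>" if "i < m" for i using N(2) that by (simp add: dp_def pt_def m_def)
    have pt0: "pt 0 = 0" by (simp add: pt_def)
    note bounds = power_step_bounds[where pt = pt and k = k and M = m, OF pt0 less_imp_le[OF pt_less], folded dp_eq, unfolded pt_m]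
    define z where "z = (0 :: real) ^ k"
    have L_lo: "z * S + (\<Sum>i<m. dp i * w (pt (Suc i))) \<le> s k"
    proof -
      have "0 \<le> L (monom 1 k + [:- z:]) + (\<Sum>i<m. (- dp i) * w (pt (Suc i)))"
      proof (rule w)
        fix x :: real assume x: "0 \<le> x"
        have "(min x (real R)) ^ k \<le> x ^ k" using x by (intro power_mono) auto
        thus "0 \<le> poly (monom 1 k + [:- z:]) x + (\<Sum>i<m. (- dp i) * indicator {pt (Suc i)<..} x)"
          using bounds(1)[OF x] by (simp add: poly_monom z_def sum_negf)
      qed (rule pt_rat)
      thus ?thesis by (simp add: add const s_def sum_negf)
    qed
    have L_up: "s k \<le> z * S + (\<Sum>i<m. dp i * w (pt i)) + s (Suc k) / real R"
    proof -
      have "0 \<le> L (monom (-1) k + [:z:] + monom (1 / real R) (Suc k)) + (\<Sum>i<m. dp i * w (pt i))"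
      proof (rule w)
        fix x :: real assume x: "0 \<le> x"
        have "x ^ k \<le> (min x (real R)) ^ k + 1 / real R * x ^ Suc k"
        proof (cases "x \<le> real R")
          case True
          thus ?thesis using x R by simp
        next
          case False
          hence "x ^ k * 1 \<le> x ^ k * (x / real R)" using x R by (intro mult_left_mono) auto
          thus ?thesis using R by (simp add: mult.commute) (smt (verit) zero_le_power of_nat_0_le_iff x min_def)
        qed
        thus "0 \<le> poly (monom (-1) k + [:z:] + monom (1 / real R) (Suc k)) x + (\<Sum>i<m. dp i * indicator {pt i<..} x)"
          using bounds(2)[OF x] by (simp add: poly_monom z_def)
      qed (rule pt_rat)
      moreover have "L (monom r j) = r * s j" for r j
        using scale[of r "monom 1 j"] by (simp add: s_def smult_monom)
      ultimately show ?thesis by (simp add: add const)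
    qed
    \<comment> \<open>the same step functions, integrated against the measure\<close>
    have M_lo: "z * S + (\<Sum>i<m. dp i * measure M {pt (Suc i)<..}) \<le> (\<integral>x. f k R x \<partial>M)"
      unfolding step_eq[symmetric]
    proof (rule integral_mono_AE[OF step_int f_int])
      show "AE x in M. z + (\<Sum>i<m. dp i * indicator {pt (Suc i)<..} x) \<le> f k R x"
        using nonneg by eventually_elim (use bounds(1) in \<open>simp add: z_def f_def max_absorb1\<close>)
    qed
    have M_up: "(\<integral>x. f k R x \<partial>M) \<le> z * S + (\<Sum>i<m. dp i * measure M {pt i<..})"
      unfolding step_eq[symmetric]
    proof (rule integral_mono_AE[OF f_int step_int])
      show "AE x in M. f k R x \<le> z + (\<Sum>i<m. dp i * indicator {pt i<..} x)"
        using nonneg by eventually_elim (use bounds(2) in \<open>simp add: z_def f_def max_absorb1\<close>)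
    qed
    \<comment> \<open>the shift \<open>j\<close> is needed twice below: the lower bounds compare \<open>w\<close> at points two steps apart\<close>
    have tel: "(\<Sum>i<m. dp i * (w (pt (i + j)) - w (pt (Suc i + j)))) \<le> \<epsilon> * S" for j
    proof -
      have "(\<Sum>i<m. dp i * (w (pt (i + j)) - w (pt (Suc i + j)))) \<le> (\<Sum>i<m. \<epsilon> * (w (pt (i + j)) - w (pt (Suc i + j))))"
      proof (intro sum_mono mult_right_mono)
        fix i assume "i \<in> {..<m}"
        thus "dp i \<le> \<epsilon>" using dp_le by simp
        show "0 \<le> w (pt (i + j)) - w (pt (Suc i + j))"
          using w_anti[OF pt_rat pt_rat, of "i + j" "Suc i + j"] pt_less[of "i + j"] by simp
      qed
      also have "\<dots> = \<epsilon> * (w (pt (0 + j)) - w (pt (m + j)))"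
        unfolding sum_distrib_left[symmetric] by (subst sum_lessThan_telescope') simp
      also have "\<dots> \<le> \<epsilon> * S"
        using \<epsilon> w_le[OF pt_rat, of j] w_nonneg[OF pt_rat, of "m + j"] by (intro mult_left_mono) auto
      finally show ?thesis .
    qed
    have split: "(\<Sum>i<m. dp i * w (pt (i + j))) =
        (\<Sum>i<m. dp i * w (pt (Suc i + j))) + (\<Sum>i<m. dp i * (w (pt (i + j)) - w (pt (Suc i + j))))" for j
      by (simp add: right_diff_distrib sum_subtractf)
    have "(\<Sum>i<m. dp i * measure M {pt i<..}) \<le> (\<Sum>i<m. dp i * w (pt i))"
      by (intro sum_mono mult_left_mono tail_le pt_rat dp)
    thus "(\<integral>x. f k R x \<partial>M) \<le> s k + \<epsilon> * S"
      using M_up L_lo tel[of 0] split[of 0] by simp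
    have "(\<Sum>i<m. dp i * w (pt (Suc i + 1))) \<le> (\<Sum>i<m. dp i * measure M {pt (Suc i)<..})"
      using pt_less by (intro sum_mono mult_left_mono tail_ge pt_rat dp) simp
    thus "s k - s (Suc k) / real R \<le> (\<integral>x. f k R x \<partial>M) + 2 * (\<epsilon> * S)"
      using M_lo L_up tel[of 0] tel[of 1] split[of 0] split[of 1] by simp
  qed
  have I_up: "(\<integral>x. f k R x \<partial>M) \<le> s k" and I_lo: "s k - s (Suc k) / real R \<le> (\<integral>x. f k R x \<partial>M)" if "R > 0" for k R
  proof -
    have small: "\<exists>\<epsilon>>0. 0 \<le> \<epsilon> * S \<and> 2 * (\<epsilon> * S) \<le> e" if "e > 0" for e
      by (rule exI[of _ "e / (2 * S + 1)"]) (use S0 that in \<open>auto simp: field_simps\<close>)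
    show "(\<integral>x. f k R x \<partial>M) \<le> s k"
    proof (rule field_le_epsilon)
      fix e :: real assume e0: "e > 0"
      show "(\<integral>x. f k R x \<partial>M) \<le> s k + e"
        using small[OF e0] approx(1)[OF that, of _ k] by fastforce
    qed
    show "s k - s (Suc k) / real R \<le> (\<integral>x. f k R x \<partial>M)"
    proof (rule field_le_epsilon)
      fix e :: real assume e0: "e > 0"
      show "s k - s (Suc k) / real R \<le> (\<integral>x. f k R x \<partial>M) + e"
        using small[OF e0] approx(2)[OF that, of _ k] by fastforce
    qed
  qed
  have moment: "has_bochner_integral M (\<lambda>x. x ^ k) (s k)" for k
  proof -
    define u where "u = (\<lambda>n. f k (Suc n))"
    have mono: "AE x in M. mono (\<lambda>n. u n x)"
      unfolding u_def f_def by (intro AE_I2 monoI power_mono) auto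
    have lim: "AE x in M. (\<lambda>n. u n x) \<longlonglongrightarrow> x ^ k"
      using nonneg
    proof eventually_elim
      case (elim x)
      obtain n0 where "x \<le> real n0" using real_arch_simple by blast
      hence "u n x = x ^ k" if "n \<ge> n0" for n
        using that elim by (simp add: u_def f_def max_absorb1 min_absorb1)
      thus ?case by (intro tendsto_eventually) (auto simp: eventually_sequentially)
    qed
    have int: "(\<lambda>n. \<integral>x. u n x \<partial>M) \<longlonglongrightarrow> s k"
    proof (rule tendsto_sandwich)
      have "(\<lambda>n. s k - s (Suc k) / real (Suc n)) \<longlonglongrightarrow> s k - 0"
        by (intro tendsto_intros LIMSEQ_Suc[OF lim_const_over_n])
      thus "(\<lambda>n. s k - s (Suc k) / real (Suc n)) \<longlonglongrightarrow> s k" by simp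
      show "\<forall>\<^sub>F n in sequentially. s k - s (Suc k) / real (Suc n) \<le> (\<integral>x. u n x \<partial>M)"
        using I_lo unfolding u_def by (intro always_eventually) blast
      show "\<forall>\<^sub>F n in sequentially. (\<integral>x. u n x \<partial>M) \<le> s k"
        using I_up unfolding u_def by (intro always_eventually) blast
    qed (rule tendsto_const)
    have meas: "(\<lambda>x. x ^ k) \<in> borel_measurable M" by measurable
    note mc = integrable_monotone_convergence integral_monotone_convergence
    have "integrable M (u n)" for n unfolding u_def by (rule f_int)
    note args = this mono lim int meas
    show ?thesis unfolding has_bochner_integral_iff
      using mc(1)[OF args] mc(2)[OF args] by simp
  qed
  show ?thesis
    unfolding stieltjes_moment_def
  proof (intro exI[of _ "restrict_space M {0..}"] conjI allI)
    show "sets (restrict_space M {0..}) = sets (restrict_space borel {0..})"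
      by (rule sets_restrict_space_cong[OF M(1)])
    fix k
    have "has_bochner_integral M (\<lambda>x. indicator {0..} x *\<^sub>R x ^ k) (s k)"
    proof (rule iffD1[OF has_bochner_integral_cong_AE moment[of k]])
      show "AE x in M. x ^ k = indicator {0..} x *\<^sub>R x ^ k"
        using nonneg by eventually_elim (simp add: indicator_def)
    qed measurable
    thus "has_bochner_integral (restrict_space M {0..}) (\<lambda>x. x ^ k) (L (monom 1 k))"
      by (subst has_bochner_integral_restrict_space) (auto simp: s_def M(1) space)
  qed
qed

text \<open>
The two hypotheses express that the moment functional is nonnegative on squares and on squares times
the variable.
\<close>

theorem Stieltjes_criterion:
  assumes psd: "\<And>n x. 0 \<le> (\<Sum>i<n. \<Sum>j<n. x i * x j * s (i + j))"
    and psd': "\<And>n x. 0 \<le> (\<Sum>i<n. \<Sum>j<n. x i * x j * s (i + j + 1))"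
  shows "stieltjes_moment s"
proof -
  have "stieltjes_moment (\<lambda>k. moment_functional s (monom 1 k))"
  proof (rule positive_functional_representation)
    fix p :: "real poly" assume nn: "\<And>x. 0 \<le> x \<Longrightarrow> 0 \<le> poly p x"
    show "0 \<le> moment_functional s p"
    proof (rule square_positive_imp_halfline_positive[OF moment_functional_add moment_functional_smult])
      show "0 \<le> moment_functional s (p * p)" for p
        using moment_functional_monom_square[of s 0 p] psd[of "coeff p" "Suc (degree p)"]
        by (simp add: monom_0 del: sum.lessThan_Suc)
      show "0 \<le> moment_functional s ([:0, 1:] * (p * p))" for p
        using moment_functional_monom_square[of s 1 p] psd'[of "coeff p" "Suc (degree p)"]
        by (simp add: monom_Suc monom_0 del: sum.lessThan_Suc)
    qed (rule nn)
  qed (rule moment_functional_add moment_functional_smult)+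
  thus ?thesis by (simp add: moment_functional_monom)
qed


text \<open>
Replacing powers by moments preserves nonnegativity.  Applied once for each of two sequences, it takes
the place of a product measure.
\<close>

lemma stieltjes_moment_nonneg_sum:
  assumes s: "stieltjes_moment s" and I: "finite I"
    and nn: "\<And>u. u \<ge> 0 \<Longrightarrow> 0 \<le> (\<Sum>i\<in>I. a i * u ^ e i)"
  shows "0 \<le> (\<Sum>i\<in>I. a i * s (e i))"
proof -
  obtain M :: "real measure" where M: "sets M = sets (restrict_space borel {0..})"
    and mom: "\<And>k. has_bochner_integral M (\<lambda>x. x ^ k) (s k)"
    using s unfolding stieltjes_moment_def by blast
  have space: "space M = {0..}" using sets_eq_imp_space_eq[OF M] by (simp add: space_restrict_space)
  have "has_bochner_integral M (\<lambda>x. \<Sum>i\<in>I. a i * x ^ e i) (\<Sum>i\<in>I. a i * s (e i))"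
    by (intro has_bochner_integral_sum has_bochner_integral_mult_right mom)
  hence "(\<Sum>i\<in>I. a i * s (e i)) = (\<integral>x. (\<Sum>i\<in>I. a i * x ^ e i) \<partial>M)"
    by (simp add: has_bochner_integral_integral_eq)
  also have "\<dots> \<ge> 0"
    by (rule Bochner_Integration.integral_nonneg) (use nn in \<open>simp add: space\<close>)
  finally show ?thesis .
qed


section \<open>Stieltjes moment sequences from the array\<close>

interpretation real_cone: nonneg_cone_idom "{0..} :: real set"
  by unfold_locales auto

text \<open>
The shift by \<open>m\<close> covers the Hankel matrix and the shifted one at once: a principal minor of the shifted
matrix is a minor of the Hankel matrix.
\<close>

lemma Hankel_TP_imp_psd:
  assumes "real_cone.TP (\<lambda>i j. \<alpha> (i + j))"
  shows "0 \<le> (\<Sum>i<n. \<Sum>j<n. x i * x j * \<alpha> (i + j + m))"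
proof (rule principal_minors_nonneg_imp_psd)
  fix s and r :: "nat \<Rightarrow> nat" assume r: "strict_mono_on {..<s} r"
  have "minor (\<lambda>i j. \<alpha> (i + j + m)) s r r = minor (\<lambda>i j. \<alpha> (i + j)) s r (\<lambda>i. r i + m)"
    by (rule minor_cong) (simp add: add.assoc)
  moreover have "strict_mono_on {..<s} (\<lambda>i. r i + m)" using r by (auto simp: strict_mono_on_def)
  ultimately show "0 \<le> minor (\<lambda>i j. \<alpha> (i + j + m)) s r r"
    using real_cone.TP_D[OF assms r] by simp
qed (simp add: add.commute)

corollary Hankel_TP_imp_stieltjes_moment:
  assumes "real_cone.TP (\<lambda>i j. \<alpha> (i + j))" "c \<ge> 0"
  shows "stieltjes_moment (\<lambda>n. c * \<alpha> n)"
proof -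
  have "0 \<le> (\<Sum>i<n. \<Sum>j<n. x i * x j * (c * \<alpha> (i + j + m)))" for n m and x :: "nat \<Rightarrow> real"
  proof -
    have "(\<Sum>i<n. \<Sum>j<n. x i * x j * (c * \<alpha> (i + j + m))) = c * (\<Sum>i<n. \<Sum>j<n. x i * x j * \<alpha> (i + j + m))"
      by (simp add: sum_distrib_left mult_ac)
    thus ?thesis using Hankel_TP_imp_psd[OF assms(1), of x m n] assms(2) by simp
  qed
  from this[where m = 0] this[where m = 1] show ?thesis
    by (intro Stieltjes_criterion) simp_all
qed

text \<open>
Each term of the recurrence has weight \<open>n - k\<close> if \<open>b\<close> and \<open>\<lambda>\<close> have weight one.  It lets \<open>v = 0\<close> be treated
like any other \<open>v\<close>, with no division by \<open>v\<close>.
\<close>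

lemma T_arr_homogeneous:
  assumes "k \<le> n"
  shows "T_arr a d c (b * v) (l * v) n k = v ^ (n - k) * T_arr a d c b l n k"
proof -
  define T where "T = T_arr a d c b l"
  define T' where "T' = T_arr a d c (b * v) (l * v)"
  define e where "e = (\<lambda>n k. if k \<le> n then v ^ (n - k) else 0)"
  have "T' n k = e n k * T n k" for k
  proof (induction n arbitrary: k)
    case 0
    show ?case by (simp add: T'_def T_def e_def)
  next
    case (Suc n)
    have T0: "T n k = 0" if "k > n" for k using that by (simp add: T_def T_arr_eq_0)
    have 1: "(if k = 0 then 0 else T' n (k - 1)) = e (Suc n) k * (if k = 0 then 0 else T n (k - 1))"
      unfolding Suc by (cases k) (auto simp: e_def)
    have 2: "v * T' n k = e (Suc n) k * T n k"
      unfolding Suc by (cases "k \<le> n") (auto simp: e_def T0 Suc_diff_le)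
    have 3: "v * v * T' n (k + 1) = e (Suc n) k * T n (k + 1)"
    proof (cases "k + 1 \<le> n")
      case True
      then obtain j where "n = k + Suc j" by (metis le_iff_add add.assoc plus_1_eq_Suc)
      thus ?thesis unfolding Suc by (simp add: e_def Suc_diff_le mult_ac)
    qed (simp add: Suc T0)
    have "T' (Suc n) k = c * (if k = 0 then 0 else T' n (k - 1))
        + (of_nat a * b * of_nat n - b * of_nat k + of_nat a * b * d + c * l) * (v * T' n k)
        - b * l * of_nat (k + 1) * (v * v * T' n (k + 1))"
      unfolding T'_def T_arr.simps by (simp only: algebra_simps)
    also have "\<dots> = e (Suc n) k * T (Suc n) k"
      unfolding 1 2 3 unfolding T_def T_arr.simps by (simp only: algebra_simps)
    finally show ?case .
  qed
  thus ?thesis using assms by (simp add: T_def T'_def e_def)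
qed

theorem T_arr_convolution_preserves_SM:
  fixes b c d l :: real
  assumes c: "c > 0" and b: "b \<ge> 0" and l: "l \<ge> 0" and d: "real a * d = real D" and D: "D < a"
  shows "convolution_preserves_SM (T_arr a d c b l)"
  unfolding convolution_preserves_SM_def
proof (intro allI impI)
  fix x y assume x: "stieltjes_moment x" and y: "stieltjes_moment y"
  define h where "h = (\<lambda>u v n. \<Sum>k\<le>n. T_arr a d c b l n k * u ^ k * v ^ (n - k))"
  have psd: "0 \<le> (\<Sum>i<n. \<Sum>j<n. w i * w j * h u v (i + j + m))" if "u \<ge> 0" "v \<ge> 0" for u v n m and w :: "nat \<Rightarrow> real"
  proof -
    have "h u v n = T_row a d c (b * v) (l * v) u n" for n
      unfolding h_def T_row_def by (intro sum.cong) (auto simp: T_arr_homogeneous mult_ac)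
    moreover have "real_cone.TP (\<lambda>i j. T_row a d c (b * v) (l * v) u (i + j))"
      by (rule real_cone.TP_Hankel_T_row[of c "b * v / c" "l * v" u _ a d D]) (use assms that in auto)
    ultimately have "real_cone.TP (\<lambda>i j. h u v (i + j))" by simp
    thus ?thesis by (rule Hankel_TP_imp_psd)
  qed
  have key: "0 \<le> (\<Sum>i<n. \<Sum>j<n. w i * w j * (\<Sum>k\<le>i + j + m. T_arr a d c b l (i + j + m) k * x k * y (i + j + m - k)))"
    for n m and w :: "nat \<Rightarrow> real"
  proof -
    \<comment> \<open>index set of the triple sum, flattened so that each integration is a single sum over \<open>I\<close>\<close>
    define I where "I = (SIGMA p : {..<n} \<times> {..<n}. {..fst p + snd p + m})"
    have fin: "finite I" by (simp add: I_def)
    define g where "g = (\<lambda>t :: (nat \<times> nat) \<times> nat. w (fst (fst t)) * w (snd (fst t)) *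
        T_arr a d c b l (fst (fst t) + snd (fst t) + m) (snd t))"
    define e where "e = (\<lambda>t :: (nat \<times> nat) \<times> nat. fst (fst t) + snd (fst t) + m - snd t)"
    have regroup: "(\<Sum>t\<in>I. g t * X (snd t) * Y (e t)) =
        (\<Sum>i<n. \<Sum>j<n. w i * w j * (\<Sum>k\<le>i + j + m. T_arr a d c b l (i + j + m) k * X k * Y (i + j + m - k)))"
      for X Y :: "nat \<Rightarrow> real"
    proof -
      have "(\<Sum>t\<in>I. g t * X (snd t) * Y (e t)) =
          (\<Sum>p\<in>{..<n} \<times> {..<n}. \<Sum>k\<le>fst p + snd p + m. g (p, k) * X k * Y (e (p, k)))"
        unfolding I_def by (subst sum.Sigma) (auto intro!: sum.cong)
      also have "\<dots> = (\<Sum>i<n. \<Sum>j<n. \<Sum>k\<le>i + j + m. g ((i, j), k) * X k * Y (e ((i, j), k)))"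
        by (simp add: sum.cartesian_product')
      finally show ?thesis by (simp add: g_def e_def sum_distrib_left mult_ac)
    qed
    have "0 \<le> (\<Sum>t\<in>I. (g t * x (snd t)) * y (e t))"
    proof (rule stieltjes_moment_nonneg_sum[OF y fin])
      fix v :: real assume v: "v \<ge> 0"
      have "0 \<le> (\<Sum>t\<in>I. (g t * v ^ e t) * x (snd t))"
      proof (rule stieltjes_moment_nonneg_sum[OF x fin])
        fix u :: real assume u: "u \<ge> 0"
        have "(\<Sum>t\<in>I. (g t * v ^ e t) * u ^ snd t) = (\<Sum>t\<in>I. g t * u ^ snd t * v ^ e t)"
          by (simp add: mult_ac)
        also have "\<dots> = (\<Sum>i<n. \<Sum>j<n. w i * w j * h u v (i + j + m))"
          unfolding regroup[of "\<lambda>k. u ^ k" "\<lambda>k. v ^ k"] h_def ..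
        also have "\<dots> \<ge> 0" by (rule psd[OF u v])
        finally show "0 \<le> (\<Sum>t\<in>I. (g t * v ^ e t) * u ^ snd t)" .
      qed
      thus "0 \<le> (\<Sum>t\<in>I. (g t * x (snd t)) * v ^ e t)" by (simp add: mult_ac)
    qed
    thus ?thesis using regroup[of x y] by simp
  qed
  show "stieltjes_moment (\<lambda>n. \<Sum>k\<le>n. T_arr a d c b l n k * x k * y (n - k))"
  proof (rule Stieltjes_criterion)
    fix n and w :: "nat \<Rightarrow> real"
    show "0 \<le> (\<Sum>i<n. \<Sum>j<n. w i * w j * (\<Sum>k\<le>i + j. T_arr a d c b l (i + j) k * x k * y (i + j - k)))"
      using key[of w 0 n] by simp
    show "0 \<le> (\<Sum>i<n. \<Sum>j<n. w i * w j * (\<Sum>k\<le>i + j + 1. T_arr a d c b l (i + j + 1) k * x k * y (i + j + 1 - k)))"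
      by (rule key)
  qed
qed

text \<open>
Both \<open>f\<^sub>n\<^sub>+\<^sub>1\<close> and \<open>c T\<^sub>n\<^sub>,\<^sub>0\<close> for \<open>\<lambda> = 0\<close> and \<open>a d = a - 1\<close> are \<open>c\<close> times the product of
\<open>b (a i - 1)\<close> over \<open>i = 1, ..., n\<close>.
\<close>

theorem binomial_egf_stieltjes_moment:
  fixes b c :: real and f :: "nat \<Rightarrow> real"
  assumes a: "a \<ge> 1" and b: "b > 0" and c: "c > 0"
    and f: "Abs_fps (\<lambda>n. if n = 0 then 0 else f n / fact n) =
             fps_const (c / b) *
               (1 - fps_compose (fps_binomial (1 / real a)) (- fps_const (real a * b) * fps_X))"
  shows "stieltjes_moment (\<lambda>n. f (n + 1))"
proof -
  define d where "d = (real a - 1) / real a"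
  define \<alpha> where "\<alpha> = (\<lambda>n. T_arr a d 1 b 0 n 0)"
  have ad: "real a * d = real (a - 1)" using a by (simp add: d_def of_nat_diff)
  have \<alpha>_Suc: "\<alpha> (Suc n) = (1 / real a - real (Suc n)) * (- (real a * b)) * \<alpha> n" for n
  proof -
    have "\<alpha> (Suc n) = b * (real a * real n + real a * d) * \<alpha> n" by (simp add: \<alpha>_def algebra_simps)
    also have "b * (real a * real n + real a * d) = (1 / real a - real (Suc n)) * (- (real a * b))"
      unfolding ad using a by (simp add: of_nat_diff field_simps)
    finally show ?thesis .
  qed
  have f1: "f (n + 1) = fact (n + 1) * (c / b * - ((1 / real a gchoose (n + 1)) * (- (real a * b)) ^ (n + 1)))" for n
  proof -
    have "fps_nth (fps_compose (fps_binomial (1 / real a)) (fps_const (- (real a * b)) * fps_X)) (n + 1) =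
        (- (real a * b)) ^ (n + 1) * (1 / real a gchoose (n + 1))"
      by (simp add: fps_compose_linear)
    moreover have "f (n + 1) / fact (n + 1) = fps_nth (fps_const (c / b) *
        (1 - fps_compose (fps_binomial (1 / real a)) (fps_const (- (real a * b)) * fps_X))) (n + 1)"
      using arg_cong[OF f, of "\<lambda>F. fps_nth F (n + 1)"] by simp
    ultimately have "f (n + 1) / fact (n + 1) = c / b * - ((1 / real a gchoose (n + 1)) * (- (real a * b)) ^ (n + 1))"
      by (simp add: mult_ac)
    thus ?thesis by (simp add: divide_eq_eq mult_ac del: fact_Suc)
  qed
  have fact_gchoose: "fact k * (r gchoose k) = (\<Prod>i<k. r - real i)" for k and r :: real
    by (simp add: gbinomial_prod_rev atLeast0LessThan)
  have fn: "f (n + 1) = - (c / b) * (\<Prod>i<n + 1. 1 / real a - real i) * (- (real a * b)) ^ (n + 1)" for n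
    unfolding f1 fact_gchoose[symmetric] by (simp only: mult_ac mult_minus_left mult_minus_right)
  have "f (n + 1) = c * \<alpha> n" for n
  proof (induction n)
    case 0
    show ?case unfolding fn using a b by (simp add: \<alpha>_def)
  next
    case (Suc n)
    have "f (Suc n + 1) = f (n + 1) * ((1 / real a - real (n + 1)) * (- (real a * b)))"
      unfolding fn by (simp add: mult_ac)
    thus ?case unfolding Suc \<alpha>_Suc by simp
  qed
  moreover have "real_cone.TP (\<lambda>i j. \<alpha> (i + j))"
    unfolding \<alpha>_def
    by (rule real_cone.TP_Hankel_T_arr_0[of 1 b 0 b a d "a - 1"]) (use a b ad in auto)
  ultimately show ?thesis using Hankel_TP_imp_stieltjes_moment[of \<alpha> c] c by simp
qed


section \<open>The proposition\<close>

theorem proposition4p4: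
  fixes a :: nat and c d :: real and vb vl vq :: nat
    and T :: "nat \<Rightarrow> nat \<Rightarrow> rpoly"
  assumes "a \<ge> 1" and "real a * d \<in> \<nat>" and "c > 0"
    and "distinct [vb, vl, vq]"
  defines "T \<equiv> T_arr a (Const d) (Const c) (Var vb) (Var vl)"
  shows
    "(\<forall>n\<ge>1. \<forall>k\<ge>1.
        (\<forall>j. k + j > n \<longrightarrow>
           (\<Sum>i\<le>k+j. (-1) powi (int n - int i) * c ^ (k + j) / fact j * real ((k + j) choose i)
              * falling_factorial ((real i - real a * d) / real a) n) = 0) \<and>
        T n k = Const (real a ^ n / fact k) *
          (\<Sum>j | k + j \<le> n. \<Sum>i\<le>k+j.
             Const ((-1) ^ (n - i) * c ^ (k + j) / fact j * real ((k + j) choose i)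
                * falling_factorial ((real i - real a * d) / real a) n)
             * Var vb ^ (n - k - j) * Var vl ^ j))
   \<and> poly_TP {vb, vl} T
   \<and> (0 \<le> real a * d \<and> real a * d \<le> real a - 1 \<longrightarrow>
        poly_SM {vb, vl, vq} (T_row a (Const d) (Const c) (Var vb) (Var vl) (Var vq))
      \<and> poly_log_convex 3 {vb, vl, vq} (T_row a (Const d) (Const c) (Var vb) (Var vl) (Var vq))
      \<and> poly_SM {vb, vl} (\<lambda>n. T n 0)
      \<and> poly_log_convex 3 {vb, vl} (\<lambda>n. T n 0))
   \<and> (\<forall>b::real. b > 0 \<longrightarrow>
        (\<forall>f :: nat \<Rightarrow> real.
           Abs_fps (\<lambda>n. if n = 0 then 0 else f n / fact n) =
             fps_const (c / b) *
               (1 - fps_compose (fps_binomial (1 / real a)) (- fps_const (real a * b) * fps_X))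
           \<longrightarrow> stieltjes_moment (\<lambda>n. f (n + 1))))
   \<and> (0 \<le> real a * d \<and> real a * d \<le> real a - 1 \<longrightarrow>
        (\<forall>b l :: real. b \<ge> 0 \<longrightarrow> l \<ge> 0 \<longrightarrow> convolution_preserves_SM (T_arr a d c b l)))"
proof -
  obtain D where D: "real a * d = real D" using assms(2) by (auto elim: Nats_cases)
  define \<beta> where "\<beta> = Const (1 / c) * Var vb"
  have b: "Var vb = Const c * \<beta>"
    using assms(3) by (simp add: \<beta>_def mult.assoc[symmetric] Const_mult[symmetric])
  have d: "of_nat a * Const d = of_nat D"
    by (metis Const_mult Const_of_nat D)
  have elems: "Const c \<in> nonneg_polys X" "\<beta> \<in> nonneg_polys X" "Var vl \<in> nonneg_polys X"
    if "{vb, vl} \<subseteq> X" for X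
  proof -
    interpret nonneg_cone_idom "nonneg_polys X" by (rule nonneg_polys_cone)
    show "Const c \<in> nonneg_polys X" using assms(3) by (simp add: Const_nonneg_polys)
    show "\<beta> \<in> nonneg_polys X"
      unfolding \<beta>_def using assms(3) that by (intro mult_in Const_nonneg_polys Var_nonneg_polys) auto
    show "Var vl \<in> nonneg_polys X" using that by (simp add: Var_nonneg_polys)
  qed
  have sign: "(-1 :: real) powi (int n - int i) = (-1) ^ (n + i)" for n i :: nat
    by (simp add: power_int_diff power_add) (simp add: minus_one_power_iff)
  have vanish: "(\<Sum>i\<le>k+j. (-1) powi (int n - int i) * c ^ (k + j) / fact j * real ((k + j) choose i)
      * falling_factorial ((real i - real a * d) / real a) n) = 0" if "k + j > n" for n k j
  proof -
    have "(\<Sum>i\<le>k+j. (-1) powi (int n - int i) * c ^ (k + j) / fact j * real ((k + j) choose i)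
        * falling_factorial ((real i - real a * d) / real a) n) = c ^ (k + j) / fact j *
      (\<Sum>i\<le>k+j. (-1) ^ (n + i) * real ((k + j) choose i) * falling_factorial ((real i - real a * d) / real a) n)"
      unfolding sign sum_distrib_left by (simp add: mult_ac)
    thus ?thesis unfolding entry_coeff_sum_vanishes[OF assms(1,3) that] by simp
  qed
  have TP: "poly_TP {vb, vl} T"
  proof -
    interpret nonneg_cone_idom "nonneg_polys {vb, vl}" by (rule nonneg_polys_cone)
    show ?thesis unfolding T_def
      by (rule poly_TP_nonneg_polys[OF TP_T_arr[OF elems b d assms(1)]]) auto
  qed
  have Da: "D < a" if "real a * d \<le> real a - 1"
    using that unfolding D by linarith
  have SM: "poly_SM {vb, vl, vq} (T_row a (Const d) (Const c) (Var vb) (Var vl) (Var vq))"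
    "poly_log_convex 3 {vb, vl, vq} (T_row a (Const d) (Const c) (Var vb) (Var vl) (Var vq))"
    if "D < a"
  proof -
    interpret nonneg_cone_idom "nonneg_polys {vb, vl, vq}" by (rule nonneg_polys_cone)
    have "TP (\<lambda>i j. T_row a (Const d) (Const c) (Var vb) (Var vl) (Var vq) (i + j))"
      by (rule TP_Hankel_T_row[OF elems _ b d that]) (auto intro: Var_nonneg_polys)
    thus "poly_SM {vb, vl, vq} (T_row a (Const d) (Const c) (Var vb) (Var vl) (Var vq))"
      "poly_log_convex 3 {vb, vl, vq} (T_row a (Const d) (Const c) (Var vb) (Var vl) (Var vq))"
      by (rule poly_SM_log_convex)+
  qed
  have SM0: "poly_SM {vb, vl} (\<lambda>n. T n 0)" "poly_log_convex 3 {vb, vl} (\<lambda>n. T n 0)" if "D < a"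
  proof -
    interpret nonneg_cone_idom "nonneg_polys {vb, vl}" by (rule nonneg_polys_cone)
    have "TP (\<lambda>i j. T (i + j) 0)"
      unfolding T_def by (rule TP_Hankel_T_arr_0[OF elems b d that]) auto
    thus "poly_SM {vb, vl} (\<lambda>n. T n 0)" "poly_log_convex 3 {vb, vl} (\<lambda>n. T n 0)"
      by (rule poly_SM_log_convex)+
  qed
  show ?thesis
  proof (intro conjI allI impI)
    fix n k j :: nat assume "n < k + j"
    thus "(\<Sum>i\<le>k+j. (-1) powi (int n - int i) * c ^ (k + j) / fact j * real ((k + j) choose i)
              * falling_factorial ((real i - real a * d) / real a) n) = 0" by (rule vanish)
  next
    fix n k :: nat
    show "T n k = Const (real a ^ n / fact k) *
          (\<Sum>j | k + j \<le> n. \<Sum>i\<le>k+j.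
             Const ((-1) ^ (n - i) * c ^ (k + j) / fact j * real ((k + j) choose i)
                * falling_factorial ((real i - real a * d) / real a) n)
             * Var vb ^ (n - k - j) * Var vl ^ j)"
      unfolding T_def by (rule T_arr_explicit[OF assms(1)])
  next
    fix b :: real and f :: "nat \<Rightarrow> real"
    assume "b > 0" "Abs_fps (\<lambda>n. if n = 0 then 0 else f n / fact n) = fps_const (c / b) *
        (1 - fps_compose (fps_binomial (1 / real a)) (- fps_const (real a * b) * fps_X))"
    thus "stieltjes_moment (\<lambda>n. f (n + 1))" by (rule binomial_egf_stieltjes_moment[OF assms(1) _ assms(3)])
  next
    fix b l :: real assume "b \<ge> 0" "l \<ge> 0" "0 \<le> real a * d \<and> real a * d \<le> real a - 1"
    thus "convolution_preserves_SM (T_arr a d c b l)"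
      by (intro T_arr_convolution_preserves_SM[OF assms(3) _ _ D] Da) auto
  qed (use TP SM SM0 Da in auto)
qed

end
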